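(* Let $M$ be a connected compact manifold without boundary of dimension $n=3$, and let $A$ be an elliptic (formally) self-adjoint first order operator with infinitely smooth coefficients acting on columns of $m=2$ complex-valued half-densities over $M$. Suppose that $A$ is a differential operator and that its principal symbol $A_1(x,\xi)$ is trace-free, $\operatorname{tr}A_1=0$. Then $A$ is a massless Dirac operator on half-densities if and only if the following two conditions are satisfied at every point $x\in M$: (a) the subprincipal symbol $A_{\mathrm{sub}}(x)$ is proportional to the $2\times2$ identity matrix, and (b) the second asymptotic coefficient of the spectral function, $b(x)$, is zero.
   Context: Notation for symbols. $x$ are local coordinates on $M$, $\xi$ is the dual variable, $T'M$ is the cotangent bundle with the zero section removed, $n=3$. In local coordinates the full symbol of $A$ is $A_1(x,\xi)+A_0(x)$, with $A_1$ linear in $\xi$ (a Hermitian $2\times2$ matrix-function). Formal self-adjointness means $\int_M w^*Av\,dx=\int_M(Aw)^*v\,dx$ for all smooth columns of half-densities $v,w$ (here ${}^*$ is Hermitian conjugation). Ellipticity means $\det A_1(x,\xi)\ne0$ for all $(x,\xi)\in T'M$. The subprincipal symbol is $A_{\mathrm{sub}}:=A_0+\frac i2(A_1)_{x^\alpha\xi_\alpha}$ (summation over repeated indices; subscripts denote partial derivatives); for a first order differential operator it depends on $x$ only. Since $\operatorname{tr}A_1=0$, the eigenvalues of $A_1(x,\xi)$ are $\pm h^+(x,\xi)$ with $h^+>0$; let $v^+(x,\xi)$ be a (locally smooth) normalised eigenvector for $h^+$. For matrix-functions on $T'M$ put $\{P,R\}:=P_{x^\alpha}R_{\xi_\alpha}-P_{\xi_\alpha}R_{x^\alpha}$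 and $\{P,Q,R\}:=P_{x^\alpha}QR_{\xi_\alpha}-P_{\xi_\alpha}QR_{x^\alpha}$. The coefficient $b(x)$. The second asymptotic coefficient of the spectral function $e(\lambda,x,x)=\sum_{0<\lambda_k<\lambda}\|v_k(x)\|^2$ ($\lambda_k$, $v_k$ being eigenvalues and orthonormal eigenfunctions of $A$) is the density $$b(x)=-n\int_{h^+(x,\xi)<1}\Bigl([v^+]^*A_{\mathrm{sub}}v^+-\frac i2\{[v^+]^*,A_1-h^+,v^+\}+\frac i{n-1}h^+\{[v^+]^*,v^+\}\Bigr)(x,\xi)\,(2\pi)^{-n}d\xi ,\qquad n=3.$$ It does not depend on the choice of phase of $v^+$. It is defined by this formula irrespective of any assumptions on Hamiltonian trajectories. Massless Dirac operator. Let $g_{\alpha\beta}$ be a Riemannian metric on $M$ and let $V_j$, $j=1,2,3$, be a smooth frame of real vector fields on $M$, orthonormal with respect to $g$ (of either orientation), with components $V_j{}^\alpha$. Put $\sigma^\alpha(x):=s^jV_j{}^\alpha(x)$, where $$s^1=\begin{pmatrix}0&1\\1&0\end{pmatrix},\quad s^2=\begin{pmatrix}0&-i\\i&0\end{pmatrix},\quad s^3=\begin{pmatrix}1&0\\0&-1\end{pmatrix},$$ and $\sigma_\beta:=g_{\beta\alpha}\sigma^\alpha$. The massless Dirac operator (on 2-columns of complex-valued scalar functions) corresponding to this frame is $$W:=-i\sigma^\alpha\left(\frac\partial{\partial x^\alpha}+\frac14\sigma_\beta\left(\frac{\partial\sigma^\beta}{\partial x^\alpha}+\left\{{\beta\atop\alpha\gamma}\right\}\sigma^\gamma\right)\right),$$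 where $\left\{{\beta\atop\alpha\gamma}\right\}$ are the Christoffel symbols of $g$. The massless Dirac operator on half-densities is $W_{1/2}:=(\det g_{\kappa\lambda})^{1/4}\,W\,(\det g_{\mu\nu})^{-1/4}$. "$A$ is a massless Dirac operator on half-densities" means that $A=W_{1/2}$ for some Riemannian metric $g$ and some $g$-orthonormal frame $V_j$ on $M$. *)

theory Defs
  imports "HOL-Analysis.Analysis"
begin

section \<open>Infinitely smooth functions on open sets\<close>

definition pd :: "3 \<Rightarrow> (real^3 \<Rightarrow> 'b::real_normed_vector) \<Rightarrow> real^3 \<Rightarrow> 'b" where
  "pd \<alpha> f x = frechet_derivative f (at x) (axis \<alpha> 1)"

text \<open>The following two notions are only meaningful for open \<open>S\<close>.\<close>

fun Ck_on :: "nat \<Rightarrow> 'a::euclidean_space set \<Rightarrow> ('a \<Rightarrow> 'b::real_normed_vector) \<Rightarrow> bool" where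
  "Ck_on 0 S f \<longleftrightarrow> continuous_on S f"
| "Ck_on (Suc k) S f \<longleftrightarrow> (\<forall>x\<in>S. f differentiable (at x)) \<and>
     (\<forall>e\<in>Basis. Ck_on k S (\<lambda>x. frechet_derivative f (at x) e))"

definition smooth_on :: "'a::euclidean_space set \<Rightarrow> ('a \<Rightarrow> 'b::real_normed_vector) \<Rightarrow> bool" where
  "smooth_on S f \<longleftrightarrow> (\<forall>k. Ck_on k S f)"


section \<open>Smooth 3-manifolds\<close>

text \<open>
  The manifold is the whole of a Hausdorff topological space \<open>'a\<close> (second countability is automatic
  in the compact case). A chart is a domain together with a coordinate map; the values of the
  coordinate map outside the domain are irrelevant.
\<close>

type_synonym 'a chart = "'a set \<times> ('a \<Rightarrow> real^3)"

definition coords :: "'a chart \<Rightarrow> (real^3) set" where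
  "coords c = snd c ` fst c"

definition pt :: "'a chart \<Rightarrow> real^3 \<Rightarrow> 'a" where
  "pt c = inv_into (fst c) (snd c)"

definition transition :: "'a chart \<Rightarrow> 'a chart \<Rightarrow> real^3 \<Rightarrow> real^3" where
  "transition c d = snd d \<circ> pt c"

definition overlap :: "'a chart \<Rightarrow> 'a chart \<Rightarrow> (real^3) set" where
  "overlap c d = snd c ` (fst c \<inter> fst d)"

definition smooth_atlas :: "'a::t2_space chart set \<Rightarrow> bool" where
  "smooth_atlas \<A> \<longleftrightarrow>
     (\<Union>c\<in>\<A>. fst c) = UNIV \<and>
     (\<forall>c\<in>\<A>. open (fst c) \<and> open (coords c) \<and> homeomorphism (fst c) (coords c) (snd c) (pt c)) \<and>
     (\<forall>c\<in>\<A>. \<forall>d\<in>\<A>. smooth_on (overlap c d) (transition c d))"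

text \<open>\<open>jac c d x\<close> is the Jacobi matrix of the change of coordinates from \<open>c\<close> to \<open>d\<close>.\<close>

definition jac :: "'a chart \<Rightarrow> 'a chart \<Rightarrow> real^3 \<Rightarrow> real^3^3" where
  "jac c d x = jacobian (transition c d) (at x)"

text \<open>
  Geometric objects are given by their local representations: one function of the local coordinates
  for each chart, subject to the appropriate transformation law. Only the values on \<open>coords c\<close> of the
  representation in the chart \<open>c\<close> are meaningful.
\<close>

definition vector_field :: "'a chart set \<Rightarrow> ('a chart \<Rightarrow> real^3 \<Rightarrow> real^3) \<Rightarrow> bool" where
  "vector_field \<A> X \<longleftrightarrow>
     (\<forall>c\<in>\<A>. smooth_on (coords c) (X c)) \<and>
     (\<forall>c\<in>\<A>. \<forall>d\<in>\<A>. \<forall>x\<in>overlap c d. X d (transition c d x) = jac c d x *v X c x)"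

definition riemannian_metric :: "'a chart set \<Rightarrow> ('a chart \<Rightarrow> real^3 \<Rightarrow> real^3^3) \<Rightarrow> bool" where
  "riemannian_metric \<A> g \<longleftrightarrow>
     (\<forall>c\<in>\<A>. smooth_on (coords c) (g c) \<and>
        (\<forall>x\<in>coords c. transpose (g c x) = g c x \<and> (\<forall>u. u \<noteq> 0 \<longrightarrow> u \<bullet> (g c x *v u) > 0))) \<and>
     (\<forall>c\<in>\<A>. \<forall>d\<in>\<A>. \<forall>x\<in>overlap c d.
        g c x = transpose (jac c d x) ** g d (transition c d x) ** jac c d x)"

definition orthonormal_frame ::
  "'a chart set \<Rightarrow> ('a chart \<Rightarrow> real^3 \<Rightarrow> real^3^3) \<Rightarrow> (3 \<Rightarrow> 'a chart \<Rightarrow> real^3 \<Rightarrow> real^3) \<Rightarrow> bool" where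
  "orthonormal_frame \<A> g V \<longleftrightarrow>
     (\<forall>j. vector_field \<A> (V j)) \<and>
     (\<forall>c\<in>\<A>. \<forall>x\<in>coords c. \<forall>j k. V j c x \<bullet> (g c x *v V k c x) = (if j = k then 1 else 0))"

type_synonym 'a half_dens = "'a chart \<Rightarrow> real^3 \<Rightarrow> complex^2"

definition half_density :: "'a chart set \<Rightarrow> 'a half_dens \<Rightarrow> bool" where
  "half_density \<A> v \<longleftrightarrow>
     (\<forall>c\<in>\<A>. smooth_on (coords c) (v c)) \<and>
     (\<forall>c\<in>\<A>. \<forall>d\<in>\<A>. \<forall>x\<in>overlap c d.
        v c x = sqrt \<bar>det (jac c d x)\<bar> *\<^sub>R v d (transition c d x))"

text \<open>
  Integral over the compact manifold of a density with local representations \<open>\<rho> c\<close>: choose finitely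
  many charts covering the manifold and cut it into the disjoint Borel pieces
  \<open>U\<^sub>k - (\<Union>j<k. U\<^sub>j)\<close>. By the change of variables formula the result does not depend on the choice.
\<close>

definition density_integral :: "'a chart set \<Rightarrow> ('a chart \<Rightarrow> real^3 \<Rightarrow> complex) \<Rightarrow> complex" where
  "density_integral \<A> \<rho> =
     (let cs = (SOME cs. set cs \<subseteq> \<A> \<and> (\<Union>c\<in>set cs. fst c) = UNIV)
      in \<Sum>k<length cs.
           (LINT x : snd (cs!k) ` (fst (cs!k) - (\<Union>j<k. fst (cs!j))) | lborel. \<rho> (cs!k) x))"


section \<open>Operators on half-densities and their symbols\<close>

type_synonym 'a hd_op = "'a half_dens \<Rightarrow> 'a half_dens"

definition local_expr ::
  "'a chart set \<Rightarrow> 'a hd_op \<Rightarrow> 'a chart \<Rightarrow> (real^3 \<Rightarrow> complex^2^2^3) \<Rightarrow> (real^3 \<Rightarrow> complex^2^2) \<Rightarrow> bool" where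
  "local_expr \<A> A c P Q \<longleftrightarrow>
     smooth_on (coords c) P \<and> smooth_on (coords c) Q \<and>
     (\<forall>v. half_density \<A> v \<longrightarrow> (\<forall>x\<in>coords c.
        A v c x = (\<Sum>\<alpha>\<in>UNIV. P x $ \<alpha> *v pd \<alpha> (v c) x) + Q x *v v c x))"

definition first_order_diff_op :: "'a chart set \<Rightarrow> 'a hd_op \<Rightarrow> bool" where
  "first_order_diff_op \<A> A \<longleftrightarrow>
     (\<forall>v. half_density \<A> v \<longrightarrow> half_density \<A> (A v)) \<and>
     (\<forall>c\<in>\<A>. \<exists>P Q. local_expr \<A> A c P Q)"

text \<open>The coefficients are uniquely determined on \<open>coords c\<close>.\<close>

definition coeffs :: "'a chart set \<Rightarrow> 'a hd_op \<Rightarrow> 'a chart \<Rightarrow> (real^3 \<Rightarrow> complex^2^2^3) \<times> (real^3 \<Rightarrow> complex^2^2)" where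
  "coeffs \<A> A c = (SOME (P, Q). local_expr \<A> A c P Q)"

text \<open>The full symbol \<open>A\<^sub>1(x,\<xi>) + A\<^sub>0(x)\<close> arises by replacing \<open>\<partial>/\<partial>x\<^sup>\<alpha>\<close> by \<open>\<i> \<xi>\<^sub>\<alpha>\<close>. Scalars multiply
  matrices through \<open>mat k\<close>, the scalar matrix \<open>k I\<close>.\<close>

definition sym1 :: "'a chart set \<Rightarrow> 'a hd_op \<Rightarrow> 'a chart \<Rightarrow> real^3 \<Rightarrow> real^3 \<Rightarrow> complex^2^2" where
  "sym1 \<A> A c x \<xi> =
     (\<Sum>\<alpha>\<in>UNIV. mat (\<i> * complex_of_real (\<xi> $ \<alpha>)) ** (fst (coeffs \<A> A c) x $ \<alpha>))"

definition sym0 :: "'a chart set \<Rightarrow> 'a hd_op \<Rightarrow> 'a chart \<Rightarrow> real^3 \<Rightarrow> complex^2^2" where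
  "sym0 \<A> A c x = snd (coeffs \<A> A c) x"

text \<open>\<open>A\<^sub>1\<close> is linear in \<open>\<xi>\<close>, so its derivative in \<open>\<xi>\<close> may be taken at \<open>\<xi> = 0\<close> as well as anywhere else.\<close>

definition subprincipal :: "'a chart set \<Rightarrow> 'a hd_op \<Rightarrow> 'a chart \<Rightarrow> real^3 \<Rightarrow> complex^2^2" where
  "subprincipal \<A> A c x =
     sym0 \<A> A c x +
     mat (\<i> / 2) ** (\<Sum>\<alpha>\<in>UNIV. pd \<alpha> (\<lambda>y. pd \<alpha> (\<lambda>\<xi>. sym1 \<A> A c y \<xi>) 0) x)"

definition elliptic :: "'a chart set \<Rightarrow> 'a hd_op \<Rightarrow> bool" where
  "elliptic \<A> A \<longleftrightarrow> (\<forall>c\<in>\<A>. \<forall>x\<in>coords c. \<forall>\<xi>. \<xi> \<noteq> 0 \<longrightarrow> det (sym1 \<A> A c x \<xi>) \<noteq> 0)"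

definition trace_free :: "'a chart set \<Rightarrow> 'a hd_op \<Rightarrow> bool" where
  "trace_free \<A> A \<longleftrightarrow> (\<forall>c\<in>\<A>. \<forall>x\<in>coords c. \<forall>\<xi>. \<xi> \<noteq> 0 \<longrightarrow> trace (sym1 \<A> A c x \<xi>) = 0)"

definition formally_self_adjoint :: "'a chart set \<Rightarrow> 'a hd_op \<Rightarrow> bool" where
  "formally_self_adjoint \<A> A \<longleftrightarrow>
     (\<forall>v w. half_density \<A> v \<longrightarrow> half_density \<A> w \<longrightarrow>
        density_integral \<A> (\<lambda>c x. \<Sum>i\<in>UNIV. cnj (w c x $ i) * (A v c x $ i)) =
        density_integral \<A> (\<lambda>c x. \<Sum>i\<in>UNIV. cnj (A w c x $ i) * (v c x $ i)))"


section \<open>The second asymptotic coefficient\<close>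

definition herm_adj :: "complex^'n^'m \<Rightarrow> complex^'m^'n" where
  "herm_adj P = (\<chi> i j. cnj (P $ j $ i))"

definition poisson ::
  "(real^3 \<Rightarrow> real^3 \<Rightarrow> complex^'l^'k) \<Rightarrow> (real^3 \<Rightarrow> real^3 \<Rightarrow> complex^'n^'l) \<Rightarrow>
   real^3 \<Rightarrow> real^3 \<Rightarrow> complex^'n^'k" where
  "poisson P R x \<xi> =
     (\<Sum>\<alpha>\<in>UNIV. pd \<alpha> (\<lambda>y. P y \<xi>) x ** pd \<alpha> (\<lambda>\<eta>. R x \<eta>) \<xi>
             - pd \<alpha> (\<lambda>\<eta>. P x \<eta>) \<xi> ** pd \<alpha> (\<lambda>y. R y \<xi>) x)"

definition poisson3 ::
  "(real^3 \<Rightarrow> real^3 \<Rightarrow> complex^'l^'k) \<Rightarrow> (real^3 \<Rightarrow> real^3 \<Rightarrow> complex^'m^'l) \<Rightarrow>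
   (real^3 \<Rightarrow> real^3 \<Rightarrow> complex^'n^'m) \<Rightarrow> real^3 \<Rightarrow> real^3 \<Rightarrow> complex^'n^'k" where
  "poisson3 P Q R x \<xi> =
     (\<Sum>\<alpha>\<in>UNIV. pd \<alpha> (\<lambda>y. P y \<xi>) x ** Q x \<xi> ** pd \<alpha> (\<lambda>\<eta>. R x \<eta>) \<xi>
             - pd \<alpha> (\<lambda>\<eta>. P x \<eta>) \<xi> ** Q x \<xi> ** pd \<alpha> (\<lambda>y. R y \<xi>) x)"

definition hplus :: "'a chart set \<Rightarrow> 'a hd_op \<Rightarrow> 'a chart \<Rightarrow> real^3 \<Rightarrow> real^3 \<Rightarrow> real" where
  "hplus \<A> A c x \<xi> =
     (THE h. h > 0 \<and> (\<exists>v. v \<noteq> 0 \<and> sym1 \<A> A c x \<xi> *v v = complex_of_real h *s v))"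

text \<open>
  There need not be a smooth choice of \<open>v\<^sup>+\<close> on all of \<open>T'M\<close>, even over a single point \<open>x\<close>, so the
  smooth normalised eigenvector is chosen locally, near each given \<open>(x,\<xi>)\<close>. The quantity below
  does not depend on that choice (a phase).
\<close>

definition local_vplus ::
  "'a chart set \<Rightarrow> 'a hd_op \<Rightarrow> 'a chart \<Rightarrow> real^3 \<Rightarrow> real^3 \<Rightarrow> (real^3 \<Rightarrow> real^3 \<Rightarrow> complex^2) \<Rightarrow> bool" where
  "local_vplus \<A> A c x \<xi> v \<longleftrightarrow>
     (\<exists>N. open N \<and> (x, \<xi>) \<in> N \<and> N \<subseteq> coords c \<times> (UNIV - {0}) \<and>
        smooth_on N (\<lambda>(y, \<eta>). v y \<eta>) \<and>
        (\<forall>(y, \<eta>)\<in>N. norm (v y \<eta>) = 1 \<and>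
           sym1 \<A> A c y \<eta> *v v y \<eta> = complex_of_real (hplus \<A> A c y \<eta>) *s v y \<eta>))"

definition b_integrand :: "'a chart set \<Rightarrow> 'a hd_op \<Rightarrow> 'a chart \<Rightarrow> real^3 \<Rightarrow> real^3 \<Rightarrow> complex" where
  "b_integrand \<A> A c x \<xi> =
     (let v = (SOME v. local_vplus \<A> A c x \<xi> v);
          V = (\<lambda>y \<eta>. columnvector (v y \<eta>) :: complex^1^2);
          Vs = (\<lambda>y \<eta>. herm_adj (V y \<eta>));
          h = (\<lambda>y \<eta>. complex_of_real (hplus \<A> A c y \<eta>))
      in (Vs x \<xi> ** subprincipal \<A> A c x ** V x \<xi>) $ 1 $ 1
         - \<i> / 2 * poisson3 Vs (\<lambda>y \<eta>. sym1 \<A> A c y \<eta> - mat (h y \<eta>)) V x \<xi> $ 1 $ 1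
         + \<i> / (3 - 1) * h x \<xi> * poisson Vs V x \<xi> $ 1 $ 1)"

definition b_coeff :: "'a chart set \<Rightarrow> 'a hd_op \<Rightarrow> 'a chart \<Rightarrow> real^3 \<Rightarrow> complex" where
  "b_coeff \<A> A c x =
     - 3 * (LINT \<xi> : {\<xi>. \<xi> \<noteq> 0 \<and> hplus \<A> A c x \<xi> < 1} | lborel.
              b_integrand \<A> A c x \<xi> / complex_of_real ((2 * pi) ^ 3))"


section \<open>The massless Dirac operator\<close>

text \<open>In this section \<open>g\<close> and \<open>V\<close> are the components of the metric and of the frame in one chart.\<close>

definition pauli :: "3 \<Rightarrow> complex^2^2" where
  "pauli j =
     (if j = 1 then vector [vector [0, 1], vector [1, 0]]
      else if j = 2 then vector [vector [0, - \<i>], vector [\<i>, 0]]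
      else vector [vector [1, 0], vector [0, - 1]])"

definition sigma_up :: "(3 \<Rightarrow> real^3 \<Rightarrow> real^3) \<Rightarrow> 3 \<Rightarrow> real^3 \<Rightarrow> complex^2^2" where
  "sigma_up V \<alpha> x = (\<Sum>j\<in>UNIV. (V j x $ \<alpha>) *\<^sub>R pauli j)"

definition sigma_down ::
  "(real^3 \<Rightarrow> real^3^3) \<Rightarrow> (3 \<Rightarrow> real^3 \<Rightarrow> real^3) \<Rightarrow> 3 \<Rightarrow> real^3 \<Rightarrow> complex^2^2" where
  "sigma_down g V \<beta> x = (\<Sum>\<alpha>\<in>UNIV. (g x $ \<beta> $ \<alpha>) *\<^sub>R sigma_up V \<alpha> x)"

definition christoffel :: "(real^3 \<Rightarrow> real^3^3) \<Rightarrow> 3 \<Rightarrow> 3 \<Rightarrow> 3 \<Rightarrow> real^3 \<Rightarrow> real" where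
  "christoffel g \<beta> \<alpha> \<gamma> x =
     (1/2) * (\<Sum>\<delta>\<in>UNIV. matrix_inv (g x) $ \<beta> $ \<delta> *
        (pd \<alpha> (\<lambda>y. g y $ \<gamma> $ \<delta>) x + pd \<gamma> (\<lambda>y. g y $ \<alpha> $ \<delta>) x - pd \<delta> (\<lambda>y. g y $ \<alpha> $ \<gamma>) x))"

definition dirac_W ::
  "(real^3 \<Rightarrow> real^3^3) \<Rightarrow> (3 \<Rightarrow> real^3 \<Rightarrow> real^3) \<Rightarrow> (real^3 \<Rightarrow> complex^2) \<Rightarrow> real^3 \<Rightarrow> complex^2" where
  "dirac_W g V u x =
     (- \<i>) *s (\<Sum>\<alpha>\<in>UNIV. sigma_up V \<alpha> x *v
        (pd \<alpha> u x +
         ((1/4) *\<^sub>R (\<Sum>\<beta>\<in>UNIV. sigma_down g V \<beta> x **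
            (pd \<alpha> (sigma_up V \<beta>) x +
             (\<Sum>\<gamma>\<in>UNIV. christoffel g \<beta> \<alpha> \<gamma> x *\<^sub>R sigma_up V \<gamma> x)))) *v u x))"

definition dirac_W_half ::
  "(real^3 \<Rightarrow> real^3^3) \<Rightarrow> (3 \<Rightarrow> real^3 \<Rightarrow> real^3) \<Rightarrow> (real^3 \<Rightarrow> complex^2) \<Rightarrow> real^3 \<Rightarrow> complex^2" where
  "dirac_W_half g V u x =
     (det (g x) powr (1/4)) *\<^sub>R dirac_W g V (\<lambda>y. (det (g y) powr (- 1/4)) *\<^sub>R u y) x"

definition massless_dirac_half :: "'a chart set \<Rightarrow> 'a hd_op \<Rightarrow> bool" where
  "massless_dirac_half \<A> A \<longleftrightarrow>
     (\<exists>g V. riemannian_metric \<A> g \<and> orthonormal_frame \<A> g V \<and>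
        (\<forall>v. half_density \<A> v \<longrightarrow> (\<forall>c\<in>\<A>. \<forall>x\<in>coords c.
           A v c x = dirac_W_half (g c) (\<lambda>j. V j c) (v c) x)))"

end

theory Submission
  imports Defs
begin

text \<open>
  Write \<open>A\<^sub>1(x, \<xi>) = s\<^sup>j p\<^sub>j\<close> with \<open>p\<^sub>j = V\<^sub>j\<^sup>\<alpha>(x) \<xi>\<^sub>\<alpha>\<close>. Self-adjointness, trace-freeness and ellipticity make
  the \<open>V\<^sub>j\<close> a real frame, so \<open>h\<^sup>+\<close> is the Euclidean norm of \<open>p\<close>, and the curvature terms in the integrand
  of \<open>b\<close> are \<open>- 3/4 |p|\<^sup>-\<^sup>2 p \<cdot> (p\<^sub>x \<times> p\<^sub>\<xi>)\<close>. This is a quadratic form in \<open>p\<close> divided by \<open>|p|\<^sup>2\<close>, and its mean over the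
  unit ball is a third of the trace of the form. Hence, if the subprincipal symbol is the scalar matrix \<open>k\<close>, then
  \<open>b = 0\<close> says exactly that \<open>k = T/4\<close>, where \<open>T\<close> is the axial contraction
  \<open>\<epsilon>\<^sub>j\<^sub>k\<^sub>l\<close> of the frame components of the derivatives of \<open>V\<^sub>k\<close> along \<open>V\<^sub>l\<close>. On the other hand, the subprincipal symbol of the
  massless Dirac operator of the frame is \<open>T/4\<close> times the identity: the spin connection contributes \<open>T/4\<close> and a vector
  part, and the latter is cancelled by the half-density conjugation. Since a first order operator is
  determined by its principal and subprincipal symbols, this gives both implications.

  Self-adjointness enters only through the principal symbol, so no integration by parts is needed:
  for a coordinate \<open>f\<close> the commutator of \<open>A\<close> with \<open>f\<close> is the coefficient matrix of the corresponding derivative.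
\<close>

section \<open>Calculus of smooth functions\<close>

text \<open>The constant 1/4 has two independent sources. In b the integrand carries 3/4 and the
  averaging contributes 1/3. In the Dirac operator it is the factor 1/4 in front of the spin
  connection, whose antisymmetric part becomes a scalar because s^1 s^2 s^3 = i. Two obstacles shape
  the proof. The eigenvector exists only locally and up to a phase, so its derivatives must be
  eliminated in favour of those of p; this works because the brackets retain only the components of
  these derivatives orthogonal to the eigenvector. And the integral over the manifold is tied to an
  arbitrarily chosen cutting into pieces, so self-adjointness can be tested directly only where a
  small support fits into one piece; the vector transformation law of the principal symbol carries
  the result to all other points. The frame is global at no cost, since its index j refers to the
  fixed Pauli matrices and not to coordinates. The scalar k is a complex number at the outset; it is
  the equation b = 0 that makes it real.\<close>

lemma Ck_on_cong:
  assumes "open S" "\<And>x. x \<in> S \<Longrightarrow> f x = g x" "Ck_on k S f"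
  shows "Ck_on k S g"
  using assms(2,3)
proof (induction k arbitrary: f g)
  case 0
  then show ?case by (metis Ck_on.simps(1) continuous_on_cong)
next
  case (Suc k)
  have d: "f differentiable (at x)" if "x \<in> S" for x using Suc.prems that by simp
  have e: "frechet_derivative f (at x) = frechet_derivative g (at x)" if "x \<in> S" for x
    using frechet_derivative_transform_within_open[OF d[OF that] assms(1) that] Suc.prems(1) by blast
  have g: "g differentiable (at x)" if "x \<in> S" for x
    using has_derivative_transform_within_open[OF _ assms(1) that, of f _ UNIV g] Suc.prems(1) d[OF that]
    unfolding differentiable_def by blast
  have "Ck_on k S (\<lambda>x. frechet_derivative g (at x) b)" if "b \<in> Basis" for b
  proof (rule Suc.IH)
    show "frechet_derivative f (at x) b = frechet_derivative g (at x) b" if "x \<in> S" for x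
      using e[OF that] by simp
    show "Ck_on k S (\<lambda>x. frechet_derivative f (at x) b)"
      using Suc.prems(2) that by simp
  qed
  with g show ?case by simp
qed

lemma Ck_on_subset: "Ck_on k S f \<Longrightarrow> T \<subseteq> S \<Longrightarrow> Ck_on k T f"
  by (induction k arbitrary: f) (auto intro: continuous_on_subset)

lemma Ck_on_SucD: "Ck_on (Suc k) S f \<Longrightarrow> Ck_on k S f"
proof (induction k arbitrary: f)
  case 0
  then show ?case
    by (auto intro!: continuous_at_imp_continuous_on differentiable_imp_continuous_within)
next
  case (Suc k)
  have "Ck_on k S (\<lambda>x. frechet_derivative f (at x) b)" if "b \<in> Basis" for b
    using Suc.prems that by (intro Suc.IH) simp
  with Suc.prems show ?case by simp
qed

text \<open>Serves functions given by a formula on one open set and by zero elsewhere, such as the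
  extension of a test function beyond its chart.\<close>

lemma Ck_on_local:
  assumes "\<And>x. x \<in> S \<Longrightarrow> \<exists>T. open T \<and> x \<in> T \<and> Ck_on k T f"
  shows "Ck_on k S f"
  using assms
proof (induction k arbitrary: f)
  case 0
  show ?case unfolding Ck_on.simps
    by (rule continuous_at_imp_continuous_on) (metis 0 Ck_on.simps(1) continuous_on_eq_continuous_at)
next
  case (Suc k)
  have 1: "f differentiable at x" if "x \<in> S" for x using Suc.prems[OF that] by auto
  have "Ck_on k S (\<lambda>x. frechet_derivative f (at x) b)" if b: "b \<in> Basis" for b
  proof (rule Suc.IH)
    fix x assume "x \<in> S"
    then obtain T where "open T" "x \<in> T" "Ck_on (Suc k) T f" using Suc.prems by blast
    then show "\<exists>T. open T \<and> x \<in> T \<and> Ck_on k T (\<lambda>x. frechet_derivative f (at x) b)"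
      using b by auto
  qed
  with 1 show ?case by simp
qed

lemma Ck_on_const: "Ck_on k S (\<lambda>x. c)"
  by (induction k arbitrary: c) auto

lemma Ck_on_add:
  assumes "open S" "Ck_on k S f" "Ck_on k S g"
  shows "Ck_on k S (\<lambda>x. f x + g x)"
  using assms(2,3)
proof (induction k arbitrary: f g)
  case 0
  then show ?case by (auto intro: continuous_intros)
next
  case (Suc k)
  have e: "frechet_derivative f (at x) b + frechet_derivative g (at x) b = frechet_derivative (\<lambda>x. f x + g x) (at x) b"
    if "x \<in> S" for x b
  proof -
    have "((\<lambda>x. f x + g x) has_derivative (\<lambda>b. frechet_derivative f (at x) b + frechet_derivative g (at x) b)) (at x)"
      using Suc.prems that by (intro has_derivative_add) (auto simp: frechet_derivative_works[symmetric])
    from frechet_derivative_at[OF this, symmetric] show ?thesis by simp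
  qed
  have "Ck_on k S (\<lambda>x. frechet_derivative (\<lambda>x. f x + g x) (at x) b)" if "b \<in> Basis" for b
    by (rule Ck_on_cong[OF assms(1) e Suc.IH]) (use Suc.prems that in auto)
  with Suc.prems show ?case by auto
qed

lemma (in bounded_bilinear) Ck_on_prod:
  assumes "open S" "Ck_on k S f" "Ck_on k S g"
  shows "Ck_on k S (\<lambda>x. prod (f x) (g x))"
  using assms(2,3)
proof (induction k arbitrary: f g)
  case 0
  then show ?case by (auto intro: continuous_on)
next
  case (Suc k)
  have d: "((\<lambda>x. prod (f x) (g x)) has_derivative
      (\<lambda>b. prod (f x) (frechet_derivative g (at x) b) + prod (frechet_derivative f (at x) b) (g x))) (at x)"
    if "x \<in> S" for x
    using Suc.prems that by (intro FDERIV) (auto simp: frechet_derivative_works[symmetric])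
  have "Ck_on k S (\<lambda>x. frechet_derivative (\<lambda>x. prod (f x) (g x)) (at x) b)" if "b \<in> Basis" for b
  proof (rule Ck_on_cong[OF assms(1)])
    show "prod (f x) (frechet_derivative g (at x) b) + prod (frechet_derivative f (at x) b) (g x) =
        frechet_derivative (\<lambda>x. prod (f x) (g x)) (at x) b" if "x \<in> S" for x
      by (simp add: frechet_derivative_at[OF d[OF that], symmetric])
    show "Ck_on k S (\<lambda>x. prod (f x) (frechet_derivative g (at x) b) + prod (frechet_derivative f (at x) b) (g x))"
      using Suc.prems that Ck_on_SucD[of k S f] Ck_on_SucD[of k S g]
      by (intro Ck_on_add assms(1) Suc.IH) auto
  qed
  moreover have "(\<lambda>x. prod (f x) (g x)) differentiable (at x)" if "x \<in> S" for x
    using d[OF that] unfolding differentiable_def by blast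
  ultimately show ?case by simp
qed

lemma (in bounded_linear) Ck_on_comp:
  assumes "open S" "Ck_on k S g"
  shows "Ck_on k S (\<lambda>x. f (g x))"
  using assms(2)
proof (induction k arbitrary: g)
  case 0
  then show ?case by (auto intro: continuous_on)
next
  case (Suc k)
  have d: "((\<lambda>x. f (g x)) has_derivative (\<lambda>b. f (frechet_derivative g (at x) b))) (at x)"
    if "x \<in> S" for x
    using Suc.prems that by (intro has_derivative) (auto simp: frechet_derivative_works[symmetric])
  have "Ck_on k S (\<lambda>x. frechet_derivative (\<lambda>x. f (g x)) (at x) b)" if "b \<in> Basis" for b
  proof (rule Ck_on_cong[OF assms(1)])
    show "f (frechet_derivative g (at x) b) = frechet_derivative (\<lambda>x. f (g x)) (at x) b" if "x \<in> S" for x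
      by (simp add: frechet_derivative_at[OF d[OF that], symmetric])
    show "Ck_on k S (\<lambda>x. f (frechet_derivative g (at x) b))"
      using Suc.prems that by (intro Suc.IH) auto
  qed
  moreover have "(\<lambda>x. f (g x)) differentiable (at x)" if "x \<in> S" for x
    using d[OF that] unfolding differentiable_def by blast
  ultimately show ?case by simp
qed

lemma Ck_on_bounded_linear:
  assumes "bounded_linear f"
  shows "Ck_on k S f"
proof (cases k)
  case 0
  with assms show ?thesis by (simp add: linear_continuous_on)
next
  case (Suc m)
  have d: "(f has_derivative f) (at x)" for x by (rule bounded_linear_imp_has_derivative[OF assms])
  then have "frechet_derivative f (at x) = f" for x by (rule frechet_derivative_at[symmetric])
  with d show ?thesis unfolding Suc by (auto simp: Ck_on_const differentiable_def)
qed

lemma Ck_on_sum: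
  assumes "open S" "finite I" "\<And>i. i \<in> I \<Longrightarrow> Ck_on k S (f i)"
  shows "Ck_on k S (\<lambda>x. \<Sum>i\<in>I. f i x)"
  using assms(2,3) by (induction I) (auto simp: Ck_on_const intro!: Ck_on_add assms(1))

text \<open>\<open>Ck_on\<close> controls derivatives in basis directions only, so the chain rule is
  expanded over \<open>Basis\<close>: the partial derivatives of \<open>f\<close> composed with
  \<open>\<phi>\<close> fall under the induction hypothesis, and their coefficients are components
  of the derivative of \<open>\<phi>\<close>.\<close>

lemma Ck_on_compose:
  assumes "open S" "open T" "\<And>x. x \<in> S \<Longrightarrow> \<phi> x \<in> T" "Ck_on k T f" "Ck_on k S \<phi>"
  shows "Ck_on k S (\<lambda>x. f (\<phi> x))"
  using assms(4,5)
proof (induction k arbitrary: f)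
  case 0
  then show ?case using assms(3) continuous_on_compose2[of T f S \<phi>] by auto
next
  case (Suc k)
  have df: "(f has_derivative frechet_derivative f (at (\<phi> x))) (at (\<phi> x))" if "x \<in> S" for x
    using Suc.prems(1) assms(3)[OF that] by (simp add: frechet_derivative_works[symmetric])
  have dp: "(\<phi> has_derivative frechet_derivative \<phi> (at x)) (at x)" if "x \<in> S" for x
    using Suc.prems that by (auto simp: frechet_derivative_works[symmetric])
  have d: "((\<lambda>x. f (\<phi> x)) has_derivative (\<lambda>b. frechet_derivative f (at (\<phi> x)) (frechet_derivative \<phi> (at x) b))) (at x)"
    if "x \<in> S" for x
    using diff_chain_at[OF dp df, OF that that] by (simp add: o_def)
  have "Ck_on k S (\<lambda>x. frechet_derivative (\<lambda>x. f (\<phi> x)) (at x) b)" if b: "b \<in> Basis" for b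
  proof (rule Ck_on_cong[OF assms(1)])
    show "(\<Sum>e\<in>Basis. (frechet_derivative \<phi> (at x) b \<bullet> e) *\<^sub>R frechet_derivative f (at (\<phi> x)) e)
        = frechet_derivative (\<lambda>x. f (\<phi> x)) (at x) b" (is "?l = _") if "x \<in> S" for x
    proof -
      have l: "linear (frechet_derivative f (at (\<phi> x)))" using df[OF that] has_derivative_linear by blast
      have "?l = frechet_derivative f (at (\<phi> x)) (\<Sum>e\<in>Basis. (frechet_derivative \<phi> (at x) b \<bullet> e) *\<^sub>R e)"
        by (simp add: linear_sum[OF l] linear_cmul[OF l])
      also have "\<dots> = frechet_derivative (\<lambda>x. f (\<phi> x)) (at x) b"
        unfolding euclidean_representation frechet_derivative_at[OF d[OF that], symmetric] ..
      finally show ?thesis .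
    qed
    have "Ck_on k S (\<lambda>x. frechet_derivative \<phi> (at x) b \<bullet> e)" for e
      using Suc.prems b by (intro bounded_linear.Ck_on_comp[OF bounded_linear_inner_left assms(1)]) auto
    moreover have "Ck_on k S (\<lambda>x. frechet_derivative f (at (\<phi> x)) e)" if "e \<in> Basis" for e
      by (rule Suc.IH[OF _ Ck_on_SucD[OF Suc.prems(2)]]) (use Suc.prems(1) that in simp)
    ultimately
    show "Ck_on k S (\<lambda>x. \<Sum>e\<in>Basis. (frechet_derivative \<phi> (at x) b \<bullet> e) *\<^sub>R frechet_derivative f (at (\<phi> x)) e)"
      by (intro Ck_on_sum[OF assms(1) finite_Basis] bounded_bilinear.Ck_on_prod[OF bounded_bilinear_scaleR assms(1)])
  qed
  moreover have "(\<lambda>x. f (\<phi> x)) differentiable (at x)" if "x \<in> S" for x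
    using d[OF that] unfolding differentiable_def by blast
  ultimately show ?case by simp
qed

text \<open>Turns a differential equation into smoothness: when the derivative is an expression in
  the function itself, or in its family as for \<open>flat\<close>, \<open>Ck_on k\<close> of the
  function yields \<open>Ck_on k\<close> of the derivative and hence \<open>Ck_on (Suc k)\<close> of
  the function.\<close>

lemma Ck_on_real_deriv:
  fixes f :: "real \<Rightarrow> real"
  assumes "open S" "\<And>x. x \<in> S \<Longrightarrow> (f has_real_derivative f' x) (at x)" "Ck_on k S f'"
  shows "Ck_on (Suc k) S f"
proof -
  have d: "(f has_derivative (\<lambda>b. f' x * b)) (at x)" if "x \<in> S" for x
    using assms(2)[OF that] by (simp add: has_field_derivative_def)
  have "Ck_on k S (\<lambda>x. frechet_derivative f (at x) 1)"
  proof (rule Ck_on_cong[OF assms(1) _ assms(3)])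
    show "f' x = frechet_derivative f (at x) 1" if "x \<in> S" for x
      by (simp add: frechet_derivative_at[OF d[OF that], symmetric])
  qed
  moreover have "f differentiable (at x)" if "x \<in> S" for x
    using d[OF that] unfolding differentiable_def by blast
  ultimately show ?thesis by simp
qed

lemma smooth_on_cong:
  "open S \<Longrightarrow> (\<And>x. x \<in> S \<Longrightarrow> f x = g x) \<Longrightarrow> smooth_on S f \<Longrightarrow> smooth_on S g"
  unfolding smooth_on_def using Ck_on_cong[of S f g] by simp

lemma smooth_on_subset: "smooth_on S f \<Longrightarrow> T \<subseteq> S \<Longrightarrow> smooth_on T f"
  unfolding smooth_on_def using Ck_on_subset by blast

lemma smooth_on_local: "(\<And>x. x \<in> S \<Longrightarrow> \<exists>T. open T \<and> x \<in> T \<and> smooth_on T f) \<Longrightarrow> smooth_on S f"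
  unfolding smooth_on_def by (intro allI Ck_on_local) blast

lemma smooth_on_const: "smooth_on S (\<lambda>x. c)"
  unfolding smooth_on_def by (simp add: Ck_on_const)

lemma smooth_on_add: "open S \<Longrightarrow> smooth_on S f \<Longrightarrow> smooth_on S g \<Longrightarrow> smooth_on S (\<lambda>x. f x + g x)"
  unfolding smooth_on_def by (simp add: Ck_on_add)

lemma smooth_on_sum:
  "open S \<Longrightarrow> finite I \<Longrightarrow> (\<And>i. i \<in> I \<Longrightarrow> smooth_on S (f i)) \<Longrightarrow> smooth_on S (\<lambda>x. \<Sum>i\<in>I. f i x)"
  unfolding smooth_on_def by (simp add: Ck_on_sum)

lemma (in bounded_bilinear) smooth_on_prod:
  "open S \<Longrightarrow> smooth_on S f \<Longrightarrow> smooth_on S g \<Longrightarrow> smooth_on S (\<lambda>x. prod (f x) (g x))"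
  unfolding smooth_on_def by (simp add: Ck_on_prod)

lemma (in bounded_linear) smooth_on_comp:
  "open S \<Longrightarrow> smooth_on S g \<Longrightarrow> smooth_on S (\<lambda>x. f (g x))"
  unfolding smooth_on_def by (simp add: Ck_on_comp)

lemma smooth_on_bounded_linear: "bounded_linear f \<Longrightarrow> smooth_on S f"
  unfolding smooth_on_def by (simp add: Ck_on_bounded_linear)

lemma smooth_on_compose:
  "\<lbrakk>open S; open T; \<And>x. x \<in> S \<Longrightarrow> \<phi> x \<in> T; smooth_on T f; smooth_on S \<phi>\<rbrakk>
   \<Longrightarrow> smooth_on S (\<lambda>x. f (\<phi> x))"
  unfolding smooth_on_def using Ck_on_compose[of S T \<phi> _ f] by simp

lemma smooth_on_differentiable:
  assumes "smooth_on S f" "x \<in> S"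
  shows "f differentiable (at x)"
proof -
  have "Ck_on (Suc 0) S f" using assms(1) by (simp only: smooth_on_def)
  with assms(2) show ?thesis by simp
qed

lemma smooth_on_continuous:
  assumes "smooth_on S f"
  shows "continuous_on S f"
proof -
  have "Ck_on 0 S f" using assms by (simp only: smooth_on_def)
  then show ?thesis by simp
qed

lemma smooth_on_frechet_derivative:
  assumes "smooth_on S f" "e \<in> Basis"
  shows "smooth_on S (\<lambda>x. frechet_derivative f (at x) e)"
  unfolding smooth_on_def
proof
  fix k
  have "Ck_on (Suc k) S f" using assms(1) by (simp only: smooth_on_def)
  with assms(2) show "Ck_on k S (\<lambda>x. frechet_derivative f (at x) e)" by simp
qed

lemmas smooth_on_scaleR = bounded_bilinear.smooth_on_prod[OF bounded_bilinear_scaleR]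
lemmas smooth_on_mult = bounded_bilinear.smooth_on_prod[OF bounded_bilinear_mult]
lemmas smooth_on_ident = smooth_on_bounded_linear[OF bounded_linear_ident]

lemma smooth_on_minus: "open S \<Longrightarrow> smooth_on S f \<Longrightarrow> smooth_on S (\<lambda>x. - f x)"
  by (rule bounded_linear.smooth_on_comp[OF bounded_linear_minus[OF bounded_linear_ident]])

lemma smooth_on_diff: "open S \<Longrightarrow> smooth_on S f \<Longrightarrow> smooth_on S g \<Longrightarrow> smooth_on S (\<lambda>x. f x - g x)"
  using smooth_on_add[of S f "\<lambda>x. - g x"] smooth_on_minus[of S g] by auto

lemma smooth_on_nth: "open S \<Longrightarrow> smooth_on S f \<Longrightarrow> smooth_on S (\<lambda>x. f x $ i)"
  by (rule bounded_linear.smooth_on_comp[OF bounded_linear_vec_nth])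

lemma bounded_linear_axis: "bounded_linear (axis i :: 'b::euclidean_space \<Rightarrow> 'b^'n)"
  by (intro linear_conv_bounded_linear[THEN iffD1] linearI) (auto simp: vec_eq_iff axis_def)

lemma smooth_on_vec_lambda:
  fixes f :: "'n::finite \<Rightarrow> 'a::euclidean_space \<Rightarrow> 'b::euclidean_space"
  assumes "open S" "\<And>i. smooth_on S (f i)"
  shows "smooth_on S (\<lambda>x. \<chi> i. f i x)"
proof -
  have "(\<chi> i. f i x) = (\<Sum>i\<in>UNIV. axis i (f i x))" for x
    by (simp add: vec_eq_iff axis_def if_distrib cong: if_cong)
  then show ?thesis
    using assms by (auto intro!: smooth_on_sum bounded_linear.smooth_on_comp[OF bounded_linear_axis])
qed

section \<open>Smoothness of the inverse, the square root and bump functions\<close>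

lemma smooth_on_inverse_real: "smooth_on (-{0::real}) inverse"
proof -
  have "Ck_on k (-{0::real}) inverse" for k
  proof (induction k)
    case (Suc k)
    show ?case
    proof (rule Ck_on_real_deriv)
      show "(inverse has_real_derivative - (inverse x * inverse x)) (at x)" if "x \<in> - {0}" for x :: real
        using that by (auto intro!: derivative_eq_intros)
      show "Ck_on k (- {0}) (\<lambda>x::real. - (inverse x * inverse x))"
        using Suc by (intro bounded_linear.Ck_on_comp[OF bounded_linear_minus[OF bounded_linear_ident]]
            bounded_bilinear.Ck_on_prod[OF bounded_bilinear_mult]) auto
    qed auto
  qed (auto intro!: continuous_intros)
  then show ?thesis by (simp add: smooth_on_def)
qed

lemma smooth_on_sqrt_real: "smooth_on {0<..} sqrt"
proof -
  have "Ck_on k {0<..} sqrt" for k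
  proof (induction k)
    case (Suc k)
    show ?case
    proof (rule Ck_on_real_deriv)
      show "(sqrt has_real_derivative inverse (sqrt x) * (1/2)) (at x)" if "x \<in> {0<..}" for x :: real
        using that by (auto intro!: derivative_eq_intros simp: field_simps)
      show "Ck_on k {0<..} (\<lambda>x::real. inverse (sqrt x) * (1/2))"
        using smooth_on_inverse_real
        by (intro bounded_bilinear.Ck_on_prod[OF bounded_bilinear_mult] Ck_on_const
            Ck_on_compose[OF _ _ _ _ Suc, of "-{0}" inverse]) (auto simp: smooth_on_def)
    qed auto
  qed (auto intro!: continuous_intros)
  then show ?thesis by (simp add: smooth_on_def)
qed

lemma smooth_on_inverse:
  fixes f :: "'a::euclidean_space \<Rightarrow> real"
  assumes "open S" "smooth_on S f" "\<And>x. x \<in> S \<Longrightarrow> f x \<noteq> 0"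
  shows "smooth_on S (\<lambda>x. inverse (f x))"
  using assms by (intro smooth_on_compose[OF _ _ _ smooth_on_inverse_real]) auto

lemma smooth_on_sqrt:
  fixes f :: "'a::euclidean_space \<Rightarrow> real"
  assumes "open S" "smooth_on S f" "\<And>x. x \<in> S \<Longrightarrow> f x > 0"
  shows "smooth_on S (\<lambda>x. sqrt (f x))"
  using assms by (intro smooth_on_compose[OF _ _ _ smooth_on_sqrt_real]) auto

text \<open>The derivatives of \<open>exp (- 1 / t)\<close> are combinations of the functions \<open>flat n\<close>.\<close>

definition flat :: "nat \<Rightarrow> real \<Rightarrow> real" where
  "flat n t = (if t > 0 then inverse t ^ n * exp (- inverse t) else 0)"

lemma flat_tendsto_0: "(flat n \<longlongrightarrow> 0) (at 0)"
proof -
  have "((\<lambda>t. (inverse t)^n * exp (- inverse t)) \<longlongrightarrow> 0) (at_right (0::real))"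
  proof -
    have "((\<lambda>s::real. s ^ n / exp s) \<longlongrightarrow> 0) at_top" by (rule tendsto_power_div_exp_0)
    then have "((\<lambda>t::real. inverse t ^ n / exp (inverse t)) \<longlongrightarrow> 0) (at_right 0)"
      by (rule filterlim_compose[OF _ filterlim_inverse_at_top_right])
    then show ?thesis by (simp add: exp_minus field_simps)
  qed
  then have r: "(flat n \<longlongrightarrow> 0) (at_right 0)"
    by (rule tendsto_cong[THEN iffD1, rotated])
       (rule eventually_mono[OF eventually_at_right_less], simp add: flat_def)
  have l: "(flat n \<longlongrightarrow> 0) (at_left 0)"
    by (rule tendsto_eventually) (auto simp: flat_def eventually_at_filter)
  from l r show ?thesis by (simp add: filterlim_split_at)
qed

lemma flat_deriv:
  "(flat n has_real_derivative (- real n * flat (Suc n) t + flat (Suc (Suc n)) t)) (at t)"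
proof -
  consider "t > 0" | "t < 0" | "t = 0" by linarith
  then show ?thesis
  proof cases
    case 1
    have "((\<lambda>t. inverse t ^ n * exp (- inverse t)) has_real_derivative
       (- real n * flat (Suc n) t + flat (Suc (Suc n)) t)) (at t)"
    proof -
      have "((\<lambda>t. inverse t ^ n * exp (- inverse t)) has_real_derivative
          (real n * (- (inverse t * inverse t) * inverse t ^ (n - Suc 0))) * exp (- inverse t) +
          exp (- inverse t) * (inverse t * inverse t) * inverse t ^ n) (at t)"
        using 1 by (intro DERIV_mult DERIV_power) (auto intro!: derivative_eq_intros)
      moreover have "(real n * (- (inverse t * inverse t) * inverse t ^ (n - Suc 0))) * exp (- inverse t) +
          exp (- inverse t) * (inverse t * inverse t) * inverse t ^ n
          = - real n * flat (Suc n) t + flat (Suc (Suc n)) t"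
        using 1 by (cases n) (simp_all add: flat_def algebra_simps)
      ultimately show ?thesis by (simp only:)
    qed
    then show ?thesis
      by (rule has_field_derivative_transform_within_open[where S = "{0<..}"])
         (use 1 in \<open>auto simp: flat_def\<close>)
  next
    case 2
    have "((\<lambda>t. 0) has_real_derivative (- real n * flat (Suc n) t + flat (Suc (Suc n)) t)) (at t)"
      using 2 by (auto simp: flat_def)
    then show ?thesis
      by (rule has_field_derivative_transform_within_open[where S = "{..<0}"])
         (use 2 in \<open>auto simp: flat_def\<close>)
  next
    case 3
    \<comment> \<open>At 0 the difference quotient of \<open>flat n\<close> is
      \<open>flat (Suc n)\<close> itself.\<close>
    have "((\<lambda>h. (flat n (0 + h) - flat n 0) / h) \<longlongrightarrow> 0) (at 0)"
      using flat_tendsto_0[of "Suc n"]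
      by (rule tendsto_cong[THEN iffD1, rotated])
         (auto simp: flat_def eventually_at_filter field_simps)
    then show ?thesis using 3 by (simp add: DERIV_def flat_def)
  qed
qed

lemma smooth_on_flat: "smooth_on UNIV (flat n)"
proof -
  have "Ck_on k UNIV (flat n)" for k
  proof (induction k arbitrary: n)
    case 0
    show ?case by (simp add: continuous_at_imp_continuous_on DERIV_isCont[OF flat_deriv])
  next
    case (Suc k)
    have "Ck_on k UNIV (\<lambda>t. - real n * flat (Suc n) t)"
      by (rule bounded_bilinear.Ck_on_prod[OF bounded_bilinear_mult open_UNIV Ck_on_const Suc])
    then show ?case
      by (intro Ck_on_real_deriv[OF _ flat_deriv] Ck_on_add Suc) simp_all
  qed
  then show ?thesis by (simp add: smooth_on_def)
qed

text \<open>Not normalised to 1 near the centre. Positivity on the open ball suffices: the value at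
  the point of interest is cancelled, or the square serves as a positive weight.\<close>

definition bump :: "'a::euclidean_space \<Rightarrow> real \<Rightarrow> 'a \<Rightarrow> real" where
  "bump a r x = flat 0 (r\<^sup>2 - (x - a) \<bullet> (x - a))"

lemma smooth_on_bump: "smooth_on UNIV (bump a r)"
proof -
  have "smooth_on UNIV (\<lambda>x::'a. r\<^sup>2 - (x - a) \<bullet> (x - a))"
    by (intro smooth_on_diff smooth_on_const bounded_bilinear.smooth_on_prod[OF bounded_bilinear_inner]
        smooth_on_ident) auto
  then show ?thesis
    unfolding bump_def by (rule smooth_on_compose[OF _ _ _ smooth_on_flat, rotated -1]) auto
qed

lemma bump_pos: "r > 0 \<Longrightarrow> x \<in> ball a r \<Longrightarrow> bump a r x > 0"
  by (auto simp: bump_def flat_def dist_norm norm_minus_commute power2_norm_eq_inner[symmetric] power_strict_mono)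

lemma bump_eq_0: "r > 0 \<Longrightarrow> x \<notin> ball a r \<Longrightarrow> bump a r x = 0"
  by (auto simp: bump_def flat_def dist_norm norm_minus_commute power2_norm_eq_inner[symmetric] not_less power_mono)

section \<open>Test half-densities supported in a chart\<close>

lemma pd_eqI: "(f has_derivative f') (at x) \<Longrightarrow> pd \<alpha> f x = f' (axis \<alpha> 1)"
  unfolding pd_def using frechet_derivative_at[of f f' x] by simp

lemma pd_cong_open:
  assumes "open S" "x \<in> S" "\<And>y. y \<in> S \<Longrightarrow> f y = g y" "f differentiable (at x)"
  shows "pd \<alpha> f x = pd \<alpha> g x"
  unfolding pd_def using frechet_derivative_transform_within_open[OF assms(4,1,2,3)] by simp

lemma pd_has_derivative: "f differentiable (at x) \<Longrightarrow> (f has_derivative frechet_derivative f (at x)) (at x)"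
  by (simp add: frechet_derivative_works[symmetric])

lemma frechet_derivative_eq_pd:
  assumes "f differentiable (at x)"
  shows "frechet_derivative f (at x) h = (\<Sum>\<alpha>\<in>UNIV. h $ \<alpha> *\<^sub>R pd \<alpha> f x)"
proof -
  have l: "linear (frechet_derivative f (at x))" using assms linear_frechet_derivative by blast
  have "frechet_derivative f (at x) (\<Sum>\<alpha>\<in>UNIV. h $ \<alpha> *\<^sub>R axis \<alpha> 1) = (\<Sum>\<alpha>\<in>UNIV. h $ \<alpha> *\<^sub>R pd \<alpha> f x)"
    by (simp add: linear_sum[OF l] linear_cmul[OF l] pd_def)
  moreover have "(\<Sum>\<alpha>\<in>UNIV. h $ \<alpha> *\<^sub>R axis \<alpha> 1) = h"
    by (simp add: vec_eq_iff axis_def if_distrib cong: if_cong)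
  ultimately show ?thesis by simp
qed

text \<open>Lets a bump function or the Jacobian factor of a half-density be carried through a
  derivative without computing its own derivative, provided that the other factor vanishes at the
  point.\<close>

lemma pd_scaleR_zero:
  assumes "s differentiable (at x)" "w differentiable (at x)" "w x = 0"
  shows "pd \<alpha> (\<lambda>y. s y *\<^sub>R w y) x = s x *\<^sub>R pd \<alpha> w x"
proof -
  have "((\<lambda>y. s y *\<^sub>R w y) has_derivative
      (\<lambda>h. s x *\<^sub>R frechet_derivative w (at x) h + frechet_derivative s (at x) h *\<^sub>R w x)) (at x)"
    by (intro has_derivative_scaleR pd_has_derivative assms)
  from pd_eqI[OF this] show ?thesis by (simp add: assms(3) pd_def)
qed

section \<open>Changes of coordinates in an atlas\<close>

locale atlas =
  fixes \<A> :: "'a::t2_space chart set"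
  assumes atlas: "smooth_atlas \<A>"
begin

lemma
  assumes "c \<in> \<A>"
  shows open_dom: "open (fst c)" and open_coords: "open (coords c)"
    and homeo: "homeomorphism (fst c) (coords c) (snd c) (pt c)"
  using atlas assms unfolding smooth_atlas_def by auto

lemma cover: "\<exists>c\<in>\<A>. p \<in> fst c"
  using atlas unfolding smooth_atlas_def by auto

lemma
  assumes "c \<in> \<A>"
  shows pt_coord: "p \<in> fst c \<Longrightarrow> pt c (snd c p) = p"
    and coord_pt: "x \<in> coords c \<Longrightarrow> snd c (pt c x) = x"
    and pt_dom: "x \<in> coords c \<Longrightarrow> pt c x \<in> fst c"
    and coord_in: "p \<in> fst c \<Longrightarrow> snd c p \<in> coords c"
  using homeo[OF assms] unfolding homeomorphism_def by auto

lemma overlap_iff: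
  assumes "c \<in> \<A>"
  shows "x \<in> overlap c d \<longleftrightarrow> x \<in> coords c \<and> pt c x \<in> fst d"
proof -
  have "x \<in> coords c \<Longrightarrow> pt c x \<in> fst d \<Longrightarrow> x \<in> snd c ` (fst c \<inter> fst d)"
    using coord_pt[OF assms, of x] pt_dom[OF assms, of x] by force
  then show ?thesis unfolding overlap_def
    using assms by (auto simp: pt_coord coord_in)
qed

lemma open_coord_image:
  assumes "c \<in> \<A>" "open U" "U \<subseteq> fst c"
  shows "open (snd c ` U)"
proof -
  have "openin (top_of_set (fst c)) U"
    using assms(2,3) open_dom[OF assms(1)] by (simp add: openin_open_eq)
  then have "openin (top_of_set (coords c)) (snd c ` U)"
    using homeomorphism_imp_open_map[OF homeo[OF assms(1)]] by blast
  then show ?thesis using open_coords[OF assms(1)] by (simp add: openin_open_eq)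
qed

lemma open_pt_image:
  assumes "c \<in> \<A>" "open U" "U \<subseteq> coords c"
  shows "open (pt c ` U)"
proof -
  have "openin (top_of_set (coords c)) U"
    using assms(2,3) open_coords[OF assms(1)] by (simp add: openin_open_eq)
  then have "openin (top_of_set (fst c)) (pt c ` U)"
    using homeomorphism_imp_open_map[OF homeomorphism_symD[OF homeo[OF assms(1)]]] by blast
  then show ?thesis using open_dom[OF assms(1)] by (simp add: openin_open_eq)
qed

lemma open_overlap: "c \<in> \<A> \<Longrightarrow> d \<in> \<A> \<Longrightarrow> open (overlap c d)"
  unfolding overlap_def by (intro open_coord_image open_Int open_dom) auto

lemma overlap_self: "c \<in> \<A> \<Longrightarrow> overlap c c = coords c"
  by (simp add: overlap_def coords_def)

lemma overlap_subset: "c \<in> \<A> \<Longrightarrow> overlap c d \<subseteq> coords c"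
  by (auto simp: overlap_iff)

lemma
  assumes "c \<in> \<A>" "d \<in> \<A>" "x \<in> overlap c d"
  shows transition_in: "transition c d x \<in> overlap d c"
    and pt_transition: "pt d (transition c d x) = pt c x"
  using assms by (auto simp: overlap_iff transition_def coord_in pt_coord pt_dom)

lemma transition_trans:
  "c \<in> \<A> \<Longrightarrow> d \<in> \<A> \<Longrightarrow> x \<in> overlap c d \<Longrightarrow> transition d e (transition c d x) = transition c e x"
  using pt_transition by (simp add: transition_def)

lemma transition_self: "c \<in> \<A> \<Longrightarrow> x \<in> coords c \<Longrightarrow> transition c c x = x"
  by (simp add: transition_def coord_pt)

lemma transition_inverse:
  "c \<in> \<A> \<Longrightarrow> d \<in> \<A> \<Longrightarrow> x \<in> overlap c d \<Longrightarrow> transition d c (transition c d x) = x"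
  using overlap_subset[of c d] by (simp add: transition_trans transition_self subset_iff)

lemma smooth_transition: "c \<in> \<A> \<Longrightarrow> d \<in> \<A> \<Longrightarrow> smooth_on (overlap c d) (transition c d)"
  using atlas unfolding smooth_atlas_def by auto

lemma has_derivative_transition:
  assumes "c \<in> \<A>" "d \<in> \<A>" "x \<in> overlap c d"
  shows "(transition c d has_derivative (\<lambda>h. jac c d x *v h)) (at x)"
  using smooth_on_differentiable[OF smooth_transition[OF assms(1,2)] assms(3)]
  unfolding jac_def jacobian_works .

lemma jac_trans:
  assumes "c \<in> \<A>" "d \<in> \<A>" "e \<in> \<A>" "x \<in> overlap c d" "x \<in> overlap c e"
  shows "jac c e x = jac d e (transition c d x) ** jac c d x"
proof -
  have m: "transition c d x \<in> overlap d e"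
    using assms by (auto simp: overlap_iff transition_def coord_in pt_coord pt_dom)
  have "((\<lambda>y. transition d e (transition c d y)) has_derivative
      (\<lambda>h. jac d e (transition c d x) *v (jac c d x *v h))) (at x)"
    using diff_chain_at[OF has_derivative_transition[OF assms(1,2,4)] has_derivative_transition[OF assms(2,3) m]]
    by (simp add: o_def)
  then have "(transition c e has_derivative (\<lambda>h. jac d e (transition c d x) *v (jac c d x *v h))) (at x)"
    by (rule has_derivative_transform_within_open[OF _ open_overlap[OF assms(1,2)] assms(4)])
       (rule transition_trans[OF assms(1,2)])
  from has_derivative_unique[OF this has_derivative_transition[OF assms(1,3,5)]]
  have "\<And>h. jac c e x *v h = (jac d e (transition c d x) ** jac c d x) *v h"
    by (simp add: fun_eq_iff matrix_vector_mul_assoc)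
  then show ?thesis by (simp add: matrix_eq)
qed

lemma jac_self:
  assumes "c \<in> \<A>" "x \<in> coords c"
  shows "jac c c x = mat 1"
proof -
  have o: "x \<in> overlap c c" using assms overlap_self by simp
  have "(transition c c has_derivative (\<lambda>h. h)) (at x)"
    by (rule has_derivative_transform_within_open[OF has_derivative_ident open_coords[OF assms(1)] assms(2)])
       (simp add: transition_self[OF assms(1)])
  from has_derivative_unique[OF this has_derivative_transition[OF assms(1,1) o]]
  have "\<And>h. jac c c x *v h = mat 1 *v h"
    by (simp add: fun_eq_iff)
  then show ?thesis by (simp add: matrix_eq)
qed

lemma jac_inverse:
  assumes "c \<in> \<A>" "d \<in> \<A>" "x \<in> overlap c d"
  shows "jac d c (transition c d x) ** jac c d x = mat 1"
proof -
  have "x \<in> coords c" using overlap_subset[OF assms(1)] assms(3) by blast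
  then show ?thesis
    using jac_trans[OF assms(1,2,1,3)] jac_self[OF assms(1)] overlap_self[OF assms(1)] by simp
qed

lemma det_jac_inverse:
  assumes "c \<in> \<A>" "d \<in> \<A>" "x \<in> overlap c d"
  shows "det (jac d c (transition c d x)) * det (jac c d x) = 1"
  using arg_cong[OF jac_inverse[OF assms], of det] by (simp add: det_mul)

lemma det_jac_nonzero: "c \<in> \<A> \<Longrightarrow> d \<in> \<A> \<Longrightarrow> x \<in> overlap c d \<Longrightarrow> det (jac c d x) \<noteq> 0"
  using det_jac_inverse[of c d x] by auto

lemma smooth_sqrt_det_jac:
  assumes "c \<in> \<A>" "d \<in> \<A>"
  shows "smooth_on (overlap c d) (\<lambda>x. sqrt \<bar>det (jac c d x)\<bar>)"
proof -
  let ?S = "overlap c d"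
  have o: "open ?S" by (rule open_overlap[OF assms])
  have j: "smooth_on ?S (\<lambda>x. jac c d x $ i $ j)" for i j
  proof -
    have "smooth_on ?S (\<lambda>x. frechet_derivative (transition c d) (at x) (axis j 1) $ i)"
      by (intro smooth_on_nth[OF o] smooth_on_frechet_derivative smooth_transition assms)
         (simp add: axis_in_Basis_iff)
    then show ?thesis by (simp add: jac_def jacobian_def matrix_def)
  qed
  have d: "smooth_on ?S (\<lambda>x. det (jac c d x))"
    unfolding det_3 by (intro smooth_on_add[OF o] smooth_on_diff[OF o] smooth_on_mult[OF o] j)
  \<comment> \<open>The absolute value is avoided by writing sqrt |d| as the fourth root of d^2,
    which is positive whatever the sign of d.\<close>
  have "smooth_on ?S (\<lambda>x. sqrt (sqrt (det (jac c d x) * det (jac c d x))))"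
    using det_jac_nonzero[OF assms]
    by (intro smooth_on_sqrt[OF o] smooth_on_mult[OF o] d) (simp_all add: zero_less_mult_iff not_less less_le linear)
  then show ?thesis by simp
qed

end

text \<open>The value in a chart \<open>d\<close> is forced by the transformation law on the overlap
  with \<open>c\<close>. The result is smooth across the boundary of the chart domain only if
  \<open>u\<close> has compact support inside \<open>coords c\<close>.\<close>

definition extend_half_dens :: "'a chart \<Rightarrow> (real^3 \<Rightarrow> complex^2) \<Rightarrow> 'a half_dens" where
  "extend_half_dens c u d y =
     (if y \<in> overlap d c then sqrt \<bar>det (jac d c y)\<bar> *\<^sub>R u (transition d c y) else 0)"

context atlas
begin

lemma half_density_extend:
  assumes c: "c \<in> \<A>" and u: "smooth_on UNIV u" and K: "compact K" "K \<subseteq> coords c"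
    and u0: "\<And>x. x \<notin> K \<Longrightarrow> u x = 0"
  shows "half_density \<A> (extend_half_dens c u)"
  unfolding half_density_def
proof (intro conjI ballI)
  fix d assume d: "d \<in> \<A>"
  show "smooth_on (coords d) (extend_half_dens c u d)"
  proof (rule smooth_on_local)
    fix y assume y: "y \<in> coords d"
    show "\<exists>T. open T \<and> y \<in> T \<and> smooth_on T (extend_half_dens c u d)"
    proof (cases "y \<in> overlap d c")
      case True
      have o: "open (overlap d c)" using c d open_overlap by blast
      have "smooth_on (overlap d c) (\<lambda>y. sqrt \<bar>det (jac d c y)\<bar> *\<^sub>R u (transition d c y))"
        by (intro smooth_on_scaleR[OF o] smooth_sqrt_det_jac d c
            smooth_on_compose[OF o open_UNIV _ u smooth_transition]) auto
      then have "smooth_on (overlap d c) (extend_half_dens c u d)"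
        by (rule smooth_on_cong[OF o, rotated]) (simp add: extend_half_dens_def)
      with o True show ?thesis by (intro exI[of _ "overlap d c"]) simp
    next
      case False
      \<comment> \<open>In a Hausdorff space the compact image of \<open>K\<close> is closed. A
        point outside the domain of \<open>c\<close> therefore has a neighbourhood that misses the
        image, and the extension vanishes there.\<close>
      have "continuous_on K (pt c)"
        using homeomorphism_cont2[OF homeo[OF c]] continuous_on_subset K(2) by metis
      then have cl: "closed (pt c ` K)"
        using K(1) compact_continuous_image compact_imp_closed by blast
      let ?T = "snd d ` (fst d - pt c ` K)"
      have o: "open ?T" by (rule open_coord_image[OF d open_Diff[OF open_dom[OF d] cl]]) simp
      have "pt d y \<notin> fst c" using False y d by (simp add: overlap_iff)
      moreover have "pt c ` K \<subseteq> fst c" using K(2) pt_dom[OF c] by blast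
      ultimately have "pt d y \<in> fst d - pt c ` K" using pt_dom[OF d y] by blast
      then have yT: "y \<in> ?T" using coord_pt[OF d y] by force
      have "extend_half_dens c u d z = 0" if "z \<in> ?T" for z
      proof (cases "z \<in> overlap d c")
        case True
        then have zc: "pt d z \<in> fst c" and zd: "z \<in> coords d" using d by (auto simp: overlap_iff)
        obtain p where "p \<in> fst d" "p \<notin> pt c ` K" "z = snd d p" using \<open>z \<in> ?T\<close> by blast
        then have "pt d z \<notin> pt c ` K" using pt_coord[OF d, of p] by simp
        then have "transition d c z \<notin> K"
          using pt_coord[OF c zc] unfolding transition_def by force
        then show ?thesis by (simp add: u0 extend_half_dens_def)
      qed (simp add: extend_half_dens_def)
      then have "smooth_on ?T (extend_half_dens c u d)"
        by (intro smooth_on_cong[OF o _ smooth_on_const[of _ 0]]) simp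
      with o yT show ?thesis by (intro exI[of _ ?T]) simp
    qed
  qed
next
  fix d e x assume d: "d \<in> \<A>" and e: "e \<in> \<A>" and x: "x \<in> overlap d e"
  have iff: "transition d e x \<in> overlap e c \<longleftrightarrow> x \<in> overlap d c"
    using transition_in[OF d e x] pt_transition[OF d e x] x d e by (auto simp: overlap_iff)
  show "extend_half_dens c u d x =
      sqrt \<bar>det (jac d e x)\<bar> *\<^sub>R extend_half_dens c u e (transition d e x)"
  proof (cases "x \<in> overlap d c")
    case True
    then show ?thesis
      using iff jac_trans[OF d e c x True]
      by (simp add: extend_half_dens_def transition_trans[OF d e x] det_mul abs_mult real_sqrt_mult)
  next
    case False
    then show ?thesis using iff by (simp add: extend_half_dens_def)
  qed
qed

lemma extend_half_dens_self:
  "c \<in> \<A> \<Longrightarrow> x \<in> coords c \<Longrightarrow> extend_half_dens c u c x = u x"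
  by (simp add: extend_half_dens_def overlap_self jac_self transition_self)

lemma pd_extend_half_dens_self:
  assumes "c \<in> \<A>" "x \<in> coords c" "smooth_on UNIV u"
  shows "pd \<alpha> (extend_half_dens c u c) x = pd \<alpha> u x"
  using smooth_on_differentiable[OF assms(3)] assms
  by (intro pd_cong_open[symmetric, OF open_coords[OF assms(1)] assms(2)])
     (simp_all add: extend_half_dens_self)

end

section \<open>The coefficients of the operator\<close>

lemma bounded_bilinear_matrix_vector_mult:
  "bounded_bilinear (\<lambda>(M::complex^'n::finite^'m::finite) (v::complex^'n). M *v v)"
  unfolding bilinear_conv_bounded_bilinear[symmetric] bilinear_def
  by (auto intro!: linearI simp: matrix_vector_mult_def vec_eq_iff scaleR_sum_right distrib_left distrib_right sum.distrib)

lemma bounded_bilinear_matrix_matrix_mult: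
  "bounded_bilinear (\<lambda>(M::complex^'n::finite^'m::finite) (N::complex^'l::finite^'n). M ** N)"
  unfolding bilinear_conv_bounded_bilinear[symmetric] bilinear_def
  by (auto intro!: linearI simp: matrix_matrix_mult_def vec_eq_iff scaleR_sum_right distrib_left distrib_right sum.distrib)

lemmas matrix_vector_mult_scaleR_right = bounded_bilinear.scaleR_right[OF bounded_bilinear_matrix_vector_mult]
lemmas matrix_vector_mult_scaleR_left = bounded_bilinear.scaleR_left[OF bounded_bilinear_matrix_vector_mult]

lemma smooth_on_coord: "smooth_on S (\<lambda>y::real^3. y $ \<beta>)"
  by (rule smooth_on_bounded_linear[OF bounded_linear_vec_nth])

context atlas
begin

lemma ex_cball_coords:
  assumes "open U" "x \<in> U"
  obtains r where "r > 0" "cball x r \<subseteq> U"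
  using assms open_contains_cball by blast

lemma half_density_bump:
  assumes "c \<in> \<A>" "r > 0" "cball a r \<subseteq> coords c" "smooth_on UNIV q"
  shows "half_density \<A> (extend_half_dens c (\<lambda>y. bump a r y *\<^sub>R q y))"
proof (rule half_density_extend[OF assms(1) _ compact_cball assms(3)])
  show "smooth_on UNIV (\<lambda>y. bump a r y *\<^sub>R q y)"
    by (rule smooth_on_scaleR[OF open_UNIV smooth_on_bump assms(4)])
  show "bump a r x *\<^sub>R q x = 0" if "x \<notin> cball a r" for x
    using bump_eq_0[OF assms(2), of x a] that by auto
qed

lemma smooth_bump_linear:
  "smooth_on UNIV (\<lambda>y::real^3. (y $ \<beta> - t) *\<^sub>R (\<zeta>::complex^2))"
  by (intro smooth_on_scaleR[OF open_UNIV] smooth_on_diff[OF open_UNIV] smooth_on_const smooth_on_coord)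

text \<open>This test function isolates one coefficient: it vanishes at \<open>x\<close>, which
  removes the zeroth order term, and a single partial derivative survives.\<close>

lemma pd_bump_linear:
  "pd \<alpha> (\<lambda>y. bump x r y *\<^sub>R ((y $ \<beta> - x $ \<beta>) *\<^sub>R (\<zeta>::complex^2))) x =
     (if \<alpha> = \<beta> then bump x r x *\<^sub>R \<zeta> else 0)"
proof -
  have d: "((\<lambda>y. (y $ \<beta> - x $ \<beta>) *\<^sub>R \<zeta>) has_derivative (\<lambda>h. (h $ \<beta>) *\<^sub>R \<zeta>)) (at x)"
    by (auto intro!: derivative_eq_intros bounded_linear_imp_has_derivative bounded_linear_vec_nth)
  have "pd \<alpha> (\<lambda>y. bump x r y *\<^sub>R ((y $ \<beta> - x $ \<beta>) *\<^sub>R \<zeta>)) x =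
      bump x r x *\<^sub>R pd \<alpha> (\<lambda>y. (y $ \<beta> - x $ \<beta>) *\<^sub>R \<zeta>) x"
    using smooth_on_differentiable[OF smooth_on_bump] d
    by (intro pd_scaleR_zero) (auto simp: differentiable_def)
  then show ?thesis unfolding pd_eqI[OF d] by (simp add: axis_def)
qed

text \<open>Tests linear in one coordinate read off each matrix of \<open>P\<close>. Once these
  agree, the derivative terms cancel, and tests equal to a constant vector times a bump read off
  \<open>Q\<close>. This makes the choice in \<open>coeffs\<close> harmless.\<close>

lemma coeffs_unique:
  fixes P P' :: "complex^2^2^3" and Q Q' :: "complex^2^2"
  assumes c: "c \<in> \<A>" and x: "x \<in> coords c"
    and eq: "\<And>v. half_density \<A> v \<Longrightarrow>
      (\<Sum>\<alpha>\<in>UNIV. P $ \<alpha> *v pd \<alpha> (v c) x) + Q *v v c x =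
      (\<Sum>\<alpha>\<in>UNIV. P' $ \<alpha> *v pd \<alpha> (v c) x) + Q' *v v c x"
  shows "P = P' \<and> Q = Q'"
proof -
  obtain r where r: "r > 0" "cball x r \<subseteq> coords c"
    using ex_cball_coords[OF open_coords[OF c] x] by blast
  have b: "bump x r x > 0" using bump_pos[OF r(1), of x x] r(1) by simp
  have "P $ \<beta> *v \<zeta> = P' $ \<beta> *v \<zeta>" for \<beta> and \<zeta> :: "complex^2"
  proof -
    let ?u = "\<lambda>y. bump x r y *\<^sub>R ((y $ \<beta> - x $ \<beta>) *\<^sub>R \<zeta>)"
    have s: "smooth_on UNIV ?u" by (intro smooth_on_scaleR[OF open_UNIV] smooth_on_bump smooth_bump_linear)
    have p: "pd \<alpha> (extend_half_dens c ?u c) x = (if \<alpha> = \<beta> then bump x r x *\<^sub>R \<zeta> else 0)" for \<alpha>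
      using pd_extend_half_dens_self[OF c x s] pd_bump_linear[of \<alpha> x r \<beta> \<zeta>] by simp
    from eq[OF half_density_bump[OF c r smooth_bump_linear[of \<beta> "x $ \<beta>" \<zeta>]]]
    have "bump x r x *\<^sub>R (P $ \<beta> *v \<zeta>) = bump x r x *\<^sub>R (P' $ \<beta> *v \<zeta>)"
      unfolding p by (simp add: extend_half_dens_self[OF c x] if_distrib matrix_vector_mult_scaleR_right cong: if_cong)
    then show ?thesis using b by simp
  qed
  then have P: "P $ \<beta> = P' $ \<beta>" for \<beta> by (simp add: matrix_eq)
  have "Q *v \<zeta> = Q' *v \<zeta>" for \<zeta> :: "complex^2"
  proof -
    have "bump x r x *\<^sub>R (Q *v \<zeta>) = bump x r x *\<^sub>R (Q' *v \<zeta>)"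
      using eq[OF half_density_bump[OF c r smooth_on_const[of _ \<zeta>]]]
      by (simp add: extend_half_dens_self[OF c x] P matrix_vector_mult_scaleR_right)
    then show ?thesis using b by simp
  qed
  then have "Q = Q'" by (simp add: matrix_eq)
  with P show ?thesis by (simp add: vec_eq_iff)
qed

end

locale diff_op = atlas \<A> for \<A> :: "'a::t2_space chart set" +
  fixes A :: "'a hd_op"
  assumes fo: "first_order_diff_op \<A> A"
begin

abbreviation "P c \<equiv> fst (coeffs \<A> A c)"
abbreviation "Q c \<equiv> snd (coeffs \<A> A c)"

lemma local_expr_coeffs: "c \<in> \<A> \<Longrightarrow> local_expr \<A> A c (P c) (Q c)"
proof -
  assume "c \<in> \<A>"
  then obtain P' Q' where "local_expr \<A> A c P' Q'" using fo unfolding first_order_diff_op_def by blast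
  then have "(\<lambda>(P, Q). local_expr \<A> A c P Q) (coeffs \<A> A c)"
    unfolding coeffs_def by (rule someI[of "\<lambda>(P, Q). local_expr \<A> A c P Q" "(P', Q')", OF case_prodI])
  then show ?thesis by (simp add: case_prod_beta)
qed

lemma smooth_P: "c \<in> \<A> \<Longrightarrow> smooth_on (coords c) (P c)"
  and op_eq: "c \<in> \<A> \<Longrightarrow> half_density \<A> v \<Longrightarrow> x \<in> coords c \<Longrightarrow>
     A v c x = (\<Sum>\<alpha>\<in>UNIV. P c x $ \<alpha> *v pd \<alpha> (v c) x) + Q c x *v v c x"
  and half_density_op: "half_density \<A> v \<Longrightarrow> half_density \<A> (A v)"
  using local_expr_coeffs[of c] fo unfolding local_expr_def first_order_diff_op_def by simp_all

lemma coeffs_eqI: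
  assumes "c \<in> \<A>" "x \<in> coords c"
    and "\<And>v. half_density \<A> v \<Longrightarrow> A v c x = (\<Sum>\<alpha>\<in>UNIV. P' $ \<alpha> *v pd \<alpha> (v c) x) + Q' *v v c x"
  shows "P c x = P' \<and> Q c x = Q'"
  by (rule coeffs_unique[OF assms(1,2)]) (use assms op_eq in simp)

text \<open>The principal symbol transforms as a vector without any density weight: the test
  vanishes at the point, so the Jacobian factor is not differentiated, and the factors of the two
  directions multiply to 1.\<close>

lemma principal_transform:
  assumes c: "c \<in> \<A>" and d: "d \<in> \<A>" and x: "x \<in> overlap c d"
  shows "P c x $ \<beta> = (\<Sum>\<alpha>\<in>UNIV. (jac d c (transition c d x) $ \<beta> $ \<alpha>) *\<^sub>R P d (transition c d x) $ \<alpha>)"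
proof -
  let ?z = "transition c d x"
  have xc: "x \<in> coords c" using overlap_subset[OF c] x by blast
  have z: "?z \<in> overlap d c" by (rule transition_in[OF c d x])
  then have zd: "?z \<in> coords d" using overlap_subset[OF d] by blast
  obtain r where r: "r > 0" "cball x r \<subseteq> coords c"
    using ex_cball_coords[OF open_coords[OF c] xc] by blast
  have b: "bump x r x > 0" using bump_pos[OF r(1), of x x] r(1) by simp
  have "P c x $ \<beta> *v \<zeta> = (\<Sum>\<alpha>\<in>UNIV. (jac d c ?z $ \<beta> $ \<alpha>) *\<^sub>R P d ?z $ \<alpha>) *v \<zeta>" for \<zeta> :: "complex^2"
  proof -
    let ?u = "\<lambda>y. bump x r y *\<^sub>R ((y $ \<beta> - x $ \<beta>) *\<^sub>R \<zeta>)"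
    let ?v = "extend_half_dens c ?u"
    let ?s = "\<lambda>y. sqrt \<bar>det (jac d c y)\<bar>"
    have s: "smooth_on UNIV ?u" by (intro smooth_on_scaleR[OF open_UNIV] smooth_on_bump smooth_bump_linear)
    have hd: "half_density \<A> ?v" by (rule half_density_bump[OF c r smooth_bump_linear])
    have pc: "pd \<alpha> (?v c) x = (if \<alpha> = \<beta> then bump x r x *\<^sub>R \<zeta> else 0)" for \<alpha>
      using pd_extend_half_dens_self[OF c xc s] pd_bump_linear[of \<alpha> x r \<beta> \<zeta>] by simp
    have zx: "transition d c ?z = x" by (rule transition_inverse[OF c d x])
    have ds: "?s differentiable (at ?z)"
      by (rule smooth_on_differentiable[OF smooth_sqrt_det_jac[OF d c] z])
    have du: "?u differentiable (at x)" by (rule smooth_on_differentiable[OF s]) simp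
    have dc: "((\<lambda>y. ?u (transition d c y)) has_derivative
        (\<lambda>h. frechet_derivative ?u (at x) (jac d c ?z *v h))) (at ?z)"
      using diff_chain_at[OF has_derivative_transition[OF d c z], of ?u] pd_has_derivative[OF du]
      unfolding zx by (simp add: o_def)
    have m: "(jac d c ?z *v axis \<alpha> 1) $ \<gamma> = jac d c ?z $ \<gamma> $ \<alpha>" for \<alpha> \<gamma>
      by (simp add: matrix_vector_mult_def axis_def if_distrib cong: if_cong)
    have pu: "pd \<alpha> (\<lambda>y. ?u (transition d c y)) ?z = (jac d c ?z $ \<beta> $ \<alpha> * bump x r x) *\<^sub>R \<zeta>" for \<alpha>
      unfolding pd_eqI[OF dc] frechet_derivative_eq_pd[OF du] pd_bump_linear m
      by (simp add: if_distrib cong: if_cong)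
    have dsu: "(\<lambda>y. ?s y *\<^sub>R ?u (transition d c y)) differentiable (at ?z)"
      by (rule differentiable_scaleR[OF ds]) (use dc in \<open>unfold differentiable_def, blast\<close>)
    have pd': "pd \<alpha> (?v d) ?z = (?s ?z * (jac d c ?z $ \<beta> $ \<alpha> * bump x r x)) *\<^sub>R \<zeta>" for \<alpha>
    proof -
      have "pd \<alpha> (\<lambda>y. ?s y *\<^sub>R ?u (transition d c y)) ?z = pd \<alpha> (?v d) ?z"
        by (rule pd_cong_open[OF open_overlap[OF d c] z _ dsu]) (simp add: extend_half_dens_def)
      moreover have "pd \<alpha> (\<lambda>y. ?s y *\<^sub>R ?u (transition d c y)) ?z =
          ?s ?z *\<^sub>R pd \<alpha> (\<lambda>y. ?u (transition d c y)) ?z"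
        by (rule pd_scaleR_zero[OF ds]) (use dc in \<open>unfold differentiable_def, blast\<close>, simp add: zx)
      ultimately show ?thesis unfolding pu by simp
    qed
    have v0: "?v c x = 0" "?v d ?z = 0"
      by (simp add: extend_half_dens_self[OF c xc]) (simp add: extend_half_dens_def zx)
    have "A ?v c x = sqrt \<bar>det (jac c d x)\<bar> *\<^sub>R A ?v d ?z"
      using half_density_op[OF hd] c d x unfolding half_density_def by blast
    then have "bump x r x *\<^sub>R (P c x $ \<beta> *v \<zeta>) =
        sqrt \<bar>det (jac c d x)\<bar> *\<^sub>R (\<Sum>\<alpha>\<in>UNIV. (?s ?z * (jac d c ?z $ \<beta> $ \<alpha> * bump x r x)) *\<^sub>R (P d ?z $ \<alpha> *v \<zeta>))"
      unfolding op_eq[OF c hd xc] op_eq[OF d hd zd] pc pd' v0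
      by (simp add: if_distrib matrix_vector_mult_scaleR_right cong: if_cong)
    also have "\<dots> = (sqrt \<bar>det (jac c d x)\<bar> * ?s ?z) *\<^sub>R bump x r x *\<^sub>R
        (\<Sum>\<alpha>\<in>UNIV. (jac d c ?z $ \<beta> $ \<alpha>) *\<^sub>R (P d ?z $ \<alpha> *v \<zeta>))"
      by (simp add: scaleR_sum_right mult_ac)
    also have "sqrt \<bar>det (jac c d x)\<bar> * ?s ?z = 1"
      using det_jac_inverse[OF c d x] by (simp add: real_sqrt_mult[symmetric] abs_mult[symmetric] mult.commute)
    finally have "P c x $ \<beta> *v \<zeta> = (\<Sum>\<alpha>\<in>UNIV. (jac d c ?z $ \<beta> $ \<alpha>) *\<^sub>R (P d ?z $ \<alpha> *v \<zeta>))"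
      using b by simp
    then show ?thesis
      by (simp add: bounded_bilinear.sum_left[OF bounded_bilinear_matrix_vector_mult] matrix_vector_mult_scaleR_left)
  qed
  then show ?thesis by (simp add: matrix_eq)
qed

end

section \<open>Self-adjointness tested inside one chart\<close>

lemma open_not_null_lborel:
  fixes U :: "(real^3) set"
  assumes "open U" "U \<noteq> {}"
  shows "U \<notin> null_sets lborel"
  using open_not_negligible[OF assms] null_sets_completionI[of U lborel] by (auto simp: negligible_iff_null_sets)

context atlas
begin

lemma finite_cover:
  assumes "compact (UNIV :: 'a set)"
  shows "\<exists>cs. set cs \<subseteq> \<A> \<and> (\<Union>c\<in>set cs. fst c) = UNIV"
proof -
  obtain F where "F \<subseteq> fst ` \<A>" "finite F" "UNIV \<subseteq> \<Union>F"
  proof (rule compactE[OF assms, of "fst ` \<A>"])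
    show "UNIV \<subseteq> \<Union> (fst ` \<A>)" using cover by blast
  qed (use open_dom in auto)
  moreover then obtain C where "C \<subseteq> \<A>" "finite C" "F = fst ` C" using finite_subset_image by metis
  moreover then obtain cs where "set cs = C" using finite_list by blast
  ultimately show ?thesis by (intro exI[of _ cs]) auto
qed

definition charts :: "'a chart list" where
  "charts = (SOME cs. set cs \<subseteq> \<A> \<and> (\<Union>c\<in>set cs. fst c) = UNIV)"

lemma charts:
  assumes "compact (UNIV :: 'a set)"
  shows "set charts \<subseteq> \<A>" "(\<Union>c\<in>set charts. fst c) = UNIV"
  using someI_ex[OF finite_cover[OF assms]] unfolding charts_def by auto

text \<open>When the support lies in one of the pieces into which \<open>density_integral\<close> cuts the manifold,
  no change of variables is needed.\<close>

lemma density_integral_single_chart: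
  assumes comp: "compact (UNIV :: 'a set)"
    and k: "k < length charts" and K: "K \<subseteq> coords (charts ! k)"
    and disj: "\<And>j. j < k \<Longrightarrow> pt (charts ! k) ` K \<inter> fst (charts ! j) = {}"
    and zero: "\<And>c x. c \<in> \<A> \<Longrightarrow> x \<in> coords c \<Longrightarrow> pt c x \<notin> pt (charts ! k) ` K \<Longrightarrow> \<rho> c x = 0"
  shows "density_integral \<A> \<rho> = (LINT x : K | lborel. \<rho> (charts ! k) x)"
proof -
  let ?S = "\<lambda>k. snd (charts!k) ` (fst (charts!k) - (\<Union>j<k. fst (charts!j)))"
  have inA: "charts ! j \<in> \<A>" if "j < length charts" for j using charts(1)[OF comp] that by auto
  let ?e = "charts ! k"
  have e: "?e \<in> \<A>" using inA k by blast
  have z: "(LINT x : ?S j | lborel. \<rho> (charts!j) x) = 0" if j: "j < length charts" "j \<noteq> k" for j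
  proof -
    have "indicat_real (?S j) x *\<^sub>R \<rho> (charts!j) x = 0" for x
    proof (cases "x \<in> ?S j")
      case True
      then obtain p where p: "p \<in> fst (charts!j)" "x = snd (charts!j) p" "\<And>i. i < j \<Longrightarrow> p \<notin> fst (charts ! i)" by auto
      \<comment> \<open>For \<open>j < k\<close> the support avoids chart \<open>j\<close> by
        \<open>disj\<close>. For \<open>j > k\<close> the piece has had chart \<open>k\<close>,
        which contains the support, removed from it.\<close>
      have "p \<notin> pt ?e ` K"
      proof
        assume "p \<in> pt ?e ` K"
        moreover then have "p \<in> fst ?e" using K pt_dom[OF e] by auto
        ultimately show False using p(1,3) disj[of j] j(2) by (cases "j < k") auto
      qed
      then show ?thesis using zero[OF inA[OF j(1)], of x] p coord_in[OF inA[OF j(1)]] pt_coord[OF inA[OF j(1)]] by simp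
    qed simp
    then show ?thesis unfolding set_lebesgue_integral_def by (simp only: Bochner_Integration.integral_zero)
  qed
  have "indicat_real (?S k) x *\<^sub>R \<rho> ?e x = indicat_real K x *\<^sub>R \<rho> ?e x" for x
  proof (cases "x \<in> K")
    case True
    then have "x \<in> coords ?e" using K by blast
    then have "x = snd ?e (pt ?e x)" "pt ?e x \<in> fst ?e" using coord_pt[OF e] pt_dom[OF e] by auto
    moreover have "pt ?e x \<notin> fst (charts ! j)" if "j < k" for j using disj[OF that] True by blast
    ultimately have "x \<in> ?S k" by blast
    with True show ?thesis by simp
  next
    case F: False
    have "\<rho> ?e x = 0" if "x \<in> ?S k"
    proof (rule zero[OF e])
      show xc: "x \<in> coords ?e" using that coord_in[OF e] by auto
      show "pt ?e x \<notin> pt ?e ` K"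
        using F K coord_pt[OF e] xc by (metis (no_types, lifting) imageE subsetD)
    qed
    with F show ?thesis by (simp add: indicator_def)
  qed
  then have "(LINT x : ?S k | lborel. \<rho> ?e x) = (LINT x : K | lborel. \<rho> ?e x)"
    unfolding set_lebesgue_integral_def by (simp only:)
  moreover have "density_integral \<A> \<rho> = (\<Sum>j<length charts. (LINT x : ?S j | lborel. \<rho> (charts!j) x))"
    unfolding density_integral_def Let_def charts_def ..
  moreover have "\<dots> = (\<Sum>j<length charts. if j = k then (LINT x : ?S k | lborel. \<rho> (charts!k) x) else 0)"
    by (rule sum.cong) (use z in auto)
  ultimately show ?thesis using k by simp
qed

end

context diff_op
begin

lemma op_mult_coord:
  assumes c: "c \<in> \<A>" and x: "x \<in> coords c" and u: "smooth_on UNIV u"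
    and hd: "half_density \<A> (extend_half_dens c u)"
    and hd': "half_density \<A> (extend_half_dens c (\<lambda>y. (y $ \<beta>) *\<^sub>R u y))"
  shows "A (extend_half_dens c (\<lambda>y. (y $ \<beta>) *\<^sub>R u y)) c x =
    (x $ \<beta>) *\<^sub>R A (extend_half_dens c u) c x + P c x $ \<beta> *v u x"
proof -
  have s: "smooth_on UNIV (\<lambda>y::real^3. (y $ \<beta>) *\<^sub>R u y)" by (intro smooth_on_scaleR[OF open_UNIV] smooth_on_coord u)
  have "((\<lambda>y. (y $ \<beta>) *\<^sub>R u y) has_derivative (\<lambda>h. (x $ \<beta>) *\<^sub>R frechet_derivative u (at x) h + (h $ \<beta>) *\<^sub>R u x)) (at x)"
    using smooth_on_differentiable[OF u]
    by (intro has_derivative_scaleR pd_has_derivative bounded_linear_imp_has_derivative bounded_linear_vec_nth) simp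
  from pd_eqI[OF this] have p: "pd \<alpha> (\<lambda>y. (y $ \<beta>) *\<^sub>R u y) x = (x $ \<beta>) *\<^sub>R pd \<alpha> u x + (if \<alpha> = \<beta> then u x else 0)" for \<alpha>
    by (simp add: pd_def axis_def)
  have q: "P c x $ \<alpha> *v ((x $ \<beta>) *\<^sub>R pd \<alpha> u x + (if \<alpha> = \<beta> then u x else 0)) =
      (x $ \<beta>) *\<^sub>R (P c x $ \<alpha> *v pd \<alpha> u x) + (if \<alpha> = \<beta> then P c x $ \<beta> *v u x else 0)" for \<alpha>
    by (simp add: matrix_vector_mult_scaleR_right bounded_bilinear.add_right[OF bounded_bilinear_matrix_vector_mult])
  show ?thesis
    unfolding op_eq[OF c hd x] op_eq[OF c hd' x] pd_extend_half_dens_self[OF c x u] pd_extend_half_dens_self[OF c x s]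
      extend_half_dens_self[OF c x] p q sum.distrib
    by (simp add: matrix_vector_mult_scaleR_right scaleR_sum_right scaleR_add_right)
qed

text \<open>The identity for self-adjointness is applied to the pairs \<open>(x\<^sub>\<beta> v, w)\<close> and \<open>(v, x\<^sub>\<beta> w)\<close> with bump functions
  \<open>v\<close>, \<open>w\<close>. In the difference only the commutator of \<open>A\<close> with \<open>x\<^sub>\<beta>\<close> survives.\<close>

lemma antihermitian_in_piece:
  assumes comp: "compact (UNIV :: 'a set)" and sa: "formally_self_adjoint \<A> A"
    and k: "k < length charts" and U: "open U" "U \<subseteq> coords (charts ! k)" "z \<in> U"
    and disj: "\<And>j. j < k \<Longrightarrow> pt (charts ! k) ` U \<inter> fst (charts ! j) = {}"
  shows "P (charts ! k) z $ \<beta> $ i $ j + cnj (P (charts ! k) z $ \<beta> $ j $ i) = 0"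
proof (rule ccontr)
  define e where "e = charts ! k"
  have e: "e \<in> \<A>" using charts(1)[OF comp] k by (auto simp: e_def)
  define H where "H = (\<lambda>x. P e x $ \<beta> $ i $ j + cnj (P e x $ \<beta> $ j $ i))"
  \<comment> \<open>Rotating the complex function \<open>H\<close> by its value at \<open>z\<close>
    makes its real part positive near \<open>z\<close>, so that a vanishing weighted integral
    becomes contradictory.\<close>
  define R where "R = (\<lambda>x. Re (cnj (H z) * H x))"
  assume "\<not> ?thesis"
  then have Hz: "H z \<noteq> 0" by (simp add: H_def e_def)
  have cH: "continuous_on (coords e) H"
    unfolding H_def using smooth_on_continuous[OF smooth_P[OF e]] by (intro continuous_intros)
  have cR: "continuous_on (coords e) R" unfolding R_def using cH by (intro continuous_intros)
  have Rz: "R z > 0" using Hz by (auto simp: R_def complex_eq_iff sum_squares_gt_zero_iff)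
  have oe: "open U" and Ue: "U \<subseteq> coords e" using U by (auto simp: e_def)
  have "continuous_on U R" using cR Ue continuous_on_subset by blast
  then have "open (U \<inter> R -` {0<..})" using oe by (intro continuous_open_preimage) auto
  then obtain r where r: "r > 0" and rU: "cball z r \<subseteq> U \<inter> R -` {0<..}"
    using ex_cball_coords[of "U \<inter> R -` {0<..}" z] U(3) Rz by auto
  let ?K = "cball z r"
  have K: "?K \<subseteq> coords e" "\<And>x. x \<in> ?K \<Longrightarrow> R x > 0" using rU Ue by auto
  define ul where "ul = (\<lambda>l y. bump z r y *\<^sub>R (axis l 1 :: complex^2))"
  have sul: "smooth_on UNIV (ul l)" for l
    unfolding ul_def by (intro smooth_on_scaleR[OF open_UNIV] smooth_on_bump smooth_on_const)
  define w where "w = (\<lambda>l. extend_half_dens e (ul l))"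
  define w' where "w' = (\<lambda>l. extend_half_dens e (\<lambda>y. (y $ \<beta>) *\<^sub>R ul l y))"
  have hw: "half_density \<A> (w l)" for l
    unfolding w_def ul_def by (intro half_density_bump e r K smooth_on_const)
  have hw': "half_density \<A> (w' l)" for l
  proof -
    have "half_density \<A> (extend_half_dens e (\<lambda>y. bump z r y *\<^sub>R ((y $ \<beta>) *\<^sub>R (axis l 1))))"
      by (intro half_density_bump e r K smooth_on_scaleR[OF open_UNIV] smooth_on_coord smooth_on_const)
    then show ?thesis unfolding w'_def ul_def by (simp add: mult.commute)
  qed
  have u0: "ul l y = 0" if "y \<notin> ?K" for l y
    using bump_eq_0[OF r, of y z] that by (auto simp: ul_def)
  have w0: "w l c x = 0 \<and> w' l c x = 0" if "c \<in> \<A>" "x \<in> coords c" "pt c x \<notin> pt e ` ?K" for l c x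
  proof (cases "x \<in> overlap c e")
    case True
    then have "pt c x \<in> fst e" using overlap_iff[OF that(1)] by blast
    then have "transition c e x \<notin> ?K"
      using that(3) pt_coord[OF e, of "pt c x"] unfolding transition_def by (metis comp_apply imageI)
    then show ?thesis by (simp add: w_def w'_def extend_half_dens_def u0)
  qed (simp add: w_def w'_def extend_half_dens_def)
  define \<rho> where "\<rho> = (\<lambda>(v::'a half_dens) (v'::'a half_dens) c x. \<Sum>i\<in>UNIV. cnj (v c x $ i) * (v' c x $ i))"
  have DI: "density_integral \<A> (\<rho> v v') = (LINT x : ?K | lborel. \<rho> v v' e x)"
    if z: "\<And>c x. c \<in> \<A> \<Longrightarrow> x \<in> coords c \<Longrightarrow> pt c x \<notin> pt e ` ?K \<Longrightarrow> v c x = 0 \<or> v' c x = 0" for v v'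
    unfolding e_def
  proof (rule density_integral_single_chart[OF comp k])
    show "pt (charts ! k) ` cball z r \<inter> fst (charts ! j) = {}" if "j < k" for j
      using disj[OF that] rU by auto
    show "\<rho> v v' c x = 0" if cx: "c \<in> \<A>" "x \<in> coords c" "pt c x \<notin> pt (charts ! k) ` ?K" for c x
      using z[OF cx[folded e_def]] by (auto simp: \<rho>_def)
  qed (use K in \<open>simp add: e_def\<close>)
  have int: "set_integrable lborel ?K (\<rho> v v' e)" if "half_density \<A> v" "half_density \<A> v'" for v v'
  proof -
    have "continuous_on ?K (v e)" "continuous_on ?K (v' e)"
      using that e smooth_on_continuous continuous_on_subset[OF _ K(1)] unfolding half_density_def by metis+
    then have "continuous_on ?K (\<rho> v v' e)" unfolding \<rho>_def by (intro continuous_intros)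
    then show ?thesis unfolding set_integrable_def by (intro borel_integrable_compact compact_cball)
  qed
  have sym: "density_integral \<A> (\<rho> v' (A v)) = density_integral \<A> (\<rho> (A v') v)"
    if "half_density \<A> v" "half_density \<A> v'" for v v'
    using sa that unfolding formally_self_adjoint_def \<rho>_def by blast
  have E1: "(LINT x : ?K | lborel. \<rho> (w i) (A (w' j)) e x) = (LINT x : ?K | lborel. \<rho> (A (w i)) (w' j) e x)"
    using sym[OF hw' hw] DI[of "w i" "A (w' j)"] DI[of "A (w i)" "w' j"] w0 by simp
  have E2: "(LINT x : ?K | lborel. \<rho> (w' i) (A (w j)) e x) = (LINT x : ?K | lborel. \<rho> (A (w' i)) (w j) e x)"
    using sym[OF hw hw'] DI[of "w' i" "A (w j)"] DI[of "A (w' i)" "w j"] w0 by simp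
  note hA = half_density_op[OF hw] half_density_op[OF hw']
  let ?T = "\<lambda>x. \<rho> (w i) (A (w' j)) e x - \<rho> (A (w i)) (w' j) e x - (\<rho> (w' i) (A (w j)) e x - \<rho> (A (w' i)) (w j) e x)"
  have I: "set_integrable lborel ?K ?T" "(LINT x : ?K | lborel. ?T x) = 0"
    using E1 E2 by (simp_all add: set_integral_diff int hw hw' hA)
  \<comment> \<open>Multiplication by the real coordinate is symmetric, so all terms with
    \<open>A w\<close> cancel. What remains is \<open>P\<close> paired with the basis vectors
    \<open>i\<close> and \<open>j\<close>, once on either side, which is the entry
    \<open>H\<close>.\<close>
  have T: "?T x = (bump z r x)\<^sup>2 *\<^sub>R H x" if "x \<in> ?K" for x
  proof -
    have x: "x \<in> coords e" using that K by blast
    have m: "A (w' l) e x = (x $ \<beta>) *\<^sub>R A (w l) e x + P e x $ \<beta> *v ul l x" for l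
      unfolding w'_def w_def
      by (rule op_mult_coord[OF e x sul hw[unfolded w_def] hw'[unfolded w'_def]])
    have s: "w l e x = ul l x" "w' l e x = (x $ \<beta>) *\<^sub>R ul l x" for l
      unfolding w_def w'_def by (simp_all add: extend_half_dens_self[OF e x])
    have ulc: "ul i x $ l = (if l = i then complex_of_real (bump z r x) else 0)" for i l
      by (simp only: ul_def vector_scaleR_component axis_def vec_lambda_beta) (simp add: scaleR_conv_of_real)
    have Pul: "(P e x $ \<beta> *v ul j x) $ l = complex_of_real (bump z r x) * P e x $ \<beta> $ l $ j" for j l
      by (simp add: matrix_vector_mult_def ulc if_distrib mult.commute cong: if_cong)
    have "?T x = (\<Sum>l\<in>UNIV. cnj (ul i x $ l) * ((P e x $ \<beta> *v ul j x) $ l) + cnj ((P e x $ \<beta> *v ul i x) $ l) * (ul j x $ l))"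
      unfolding \<rho>_def m s sum_subtractf[symmetric]
      by (intro sum.cong refl)
        (simp only: vector_add_component vector_scaleR_component, simp add: algebra_simps scaleR_conv_of_real)
    also have "\<dots> = (\<Sum>l\<in>UNIV. (if l = i then (bump z r x)\<^sup>2 *\<^sub>R P e x $ \<beta> $ i $ j else 0) +
        (if l = j then (bump z r x)\<^sup>2 *\<^sub>R cnj (P e x $ \<beta> $ j $ i) else 0))"
      unfolding ulc Pul
      by (intro sum.cong refl) (simp add: power2_eq_square scaleR_conv_of_real)
    also have "\<dots> = (bump z r x)\<^sup>2 *\<^sub>R H x"
      by (simp add: H_def sum.distrib scaleR_add_right)
    finally show ?thesis .
  qed
  let ?g = "\<lambda>x. indicat_real ?K x * ((bump z r x)\<^sup>2 * R x)"
  have gT: "?g x = Re (cnj (H z) * (indicat_real ?K x *\<^sub>R ?T x))" for x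
    by (cases "x \<in> ?K") (simp_all add: T R_def)
  let ?F = "\<lambda>x. cnj (H z) * (indicat_real ?K x *\<^sub>R ?T x)"
  have Fi: "integrable lborel ?F"
    using I(1) unfolding set_integrable_def by (rule integrable_mult_right)
  then have gi: "integrable lborel ?g" unfolding gT by (rule integrable_Re)
  have "integral\<^sup>L lborel ?g = Re (integral\<^sup>L lborel ?F)"
    unfolding gT by (rule integral_Re[OF Fi])
  also have "integral\<^sup>L lborel ?F = 0"
    using I(2) unfolding set_lebesgue_integral_def integral_mult_right_zero by (simp only: mult_zero_right)
  finally have g0: "integral\<^sup>L lborel ?g = 0" by (simp only: zero_complex.sel)
  have nn: "AE x in lborel. 0 \<le> ?g x"
    by (rule AE_I2) (use K(2) in \<open>simp add: indicator_def less_imp_le\<close>)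
  have "AE x in lborel. ?g x = 0"
    using integral_nonneg_eq_0_iff_AE[OF gi nn] g0 by blast
  then have "AE x in lborel. x \<notin> ball z r"
  proof eventually_elim
    case (elim x)
    show ?case
    proof
      assume "x \<in> ball z r"
      then have "x \<in> ?K" "bump z r x > 0" using bump_pos[OF r] by auto
      with elim K(2)[of x] show False by simp
    qed
  qed
  then have "ball z r \<in> null_sets lborel" by (subst AE_iff_null_sets) auto
  then show False using open_not_null_lborel[of "ball z r"] r by auto
qed

text \<open>A point of the set where the claim fails is moved into the first chart of the list \<open>charts\<close> that meets
  this set, because there \<open>antihermitian_in_piece\<close> applies.\<close>

lemma principal_antihermitian:
  assumes comp: "compact (UNIV :: 'a set)" and sa: "formally_self_adjoint \<A> A"
    and c: "c \<in> \<A>" and x: "x \<in> coords c"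
  shows "P c x $ \<beta> $ i $ j + cnj (P c x $ \<beta> $ j $ i) = 0"
proof (rule ccontr)
  assume ne: "\<not> ?thesis"
  let ?H = "\<lambda>x. P c x $ \<beta> $ i $ j + cnj (P c x $ \<beta> $ j $ i)"
  define U where "U = coords c \<inter> ?H -` (-{0})"
  have "continuous_on (coords c) ?H"
    using smooth_on_continuous[OF smooth_P[OF c]] by (intro continuous_intros)
  then have oU: "open U" unfolding U_def using open_coords[OF c] by (intro continuous_open_preimage) auto
  have xU: "x \<in> U" using x ne by (simp add: U_def)
  let ?M = "pt c ` U"
  have oM: "open ?M" by (rule open_pt_image[OF c oU]) (simp add: U_def)
  let ?p = "\<lambda>k. k < length charts \<and> ?M \<inter> fst (charts ! k) \<noteq> {}"
  obtain d where "d \<in> set charts" "pt c x \<in> fst d" using charts(2)[OF comp] by blast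
  then obtain k0 where "?p k0" using xU unfolding in_set_conv_nth by blast
  define k where "k = (LEAST k. ?p k)"
  have k: "?p k" unfolding k_def using LeastI[of ?p, OF \<open>?p k0\<close>] .
  have kmin: "?M \<inter> fst (charts ! l) = {}" if "l < k" for l
    using not_less_Least[of l ?p] that k unfolding k_def by auto
  have klt: "k < length charts" using k by blast
  define e where "e = charts ! k"
  have e: "e \<in> \<A>" using charts(1)[OF comp] klt by (auto simp: e_def)
  obtain y where y: "y \<in> U" "pt c y \<in> fst e" using k by (auto simp: e_def)
  have yo: "y \<in> overlap c e" using y c by (simp add: overlap_iff U_def)
  let ?z = "transition c e y"
  let ?V = "snd e ` (?M \<inter> fst e)"
  have oV: "open ?V" by (rule open_coord_image[OF e open_Int[OF oM open_dom[OF e]]]) simp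
  have V: "?V \<subseteq> coords e" using coord_in[OF e] by auto
  have zV: "?z \<in> ?V" using y by (simp add: transition_def)
  have "pt e ` ?V \<subseteq> ?M" using pt_coord[OF e] by auto
  then have dj: "pt e ` ?V \<inter> fst (charts ! l) = {}" if "l < k" for l using kmin[OF that] by blast
  have ah: "P e ?z $ \<alpha> $ i $ j + cnj (P e ?z $ \<alpha> $ j $ i) = 0" for \<alpha>
    by (rule antihermitian_in_piece[OF comp sa klt, folded e_def, OF oV V zV dj])
  \<comment> \<open>The Jacobi matrix is real, so the transformation law commutes with taking the
    adjoint.\<close>
  have "?H y = (\<Sum>\<alpha>\<in>UNIV. jac e c ?z $ \<beta> $ \<alpha> *\<^sub>R (P e ?z $ \<alpha> $ i $ j + cnj (P e ?z $ \<alpha> $ j $ i)))"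
    unfolding principal_transform[OF c e yo] by (simp add: scaleR_add_right sum.distrib)
  then have "?H y = 0" unfolding ah by simp
  with y(1) show False by (simp add: U_def)
qed

end

section \<open>The eigenvector of the principal symbol and the integrand of \<open>b\<close>\<close>

definition pauli_vec :: "real^3 \<Rightarrow> complex^2^2" where
  "pauli_vec p = (\<Sum>j\<in>UNIV. (p $ j) *\<^sub>R pauli j)"

lemma pauli_entries:
  "pauli 1 $ 1 $ 1 = 0" "pauli 1 $ 1 $ 2 = 1" "pauli 1 $ 2 $ 1 = 1" "pauli 1 $ 2 $ 2 = 0"
  "pauli 2 $ 1 $ 1 = 0" "pauli 2 $ 1 $ 2 = - \<i>" "pauli 2 $ 2 $ 1 = \<i>" "pauli 2 $ 2 $ 2 = 0"
  "pauli 3 $ 1 $ 1 = 1" "pauli 3 $ 1 $ 2 = 0" "pauli 3 $ 2 $ 1 = 0" "pauli 3 $ 2 $ 2 = - 1"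
  by (simp_all add: pauli_def)

lemma pauli_vec_entries:
  "pauli_vec p $ 1 $ 1 = complex_of_real (p $ 3)"
  "pauli_vec p $ 1 $ 2 = complex_of_real (p $ 1) - \<i> * complex_of_real (p $ 2)"
  "pauli_vec p $ 2 $ 1 = complex_of_real (p $ 1) + \<i> * complex_of_real (p $ 2)"
  "pauli_vec p $ 2 $ 2 = - complex_of_real (p $ 3)"
  by (simp_all add: pauli_vec_def sum_3 pauli_entries complex_eq_iff)

lemma bounded_linear_pauli_vec: "bounded_linear pauli_vec"
  unfolding linear_conv_bounded_linear[symmetric]
  by (rule linearI) (simp_all add: pauli_vec_def scaleR_left.add scaleR_left_distrib sum.distrib scaleR_sum_right)

lemma norm_real3: "(norm (p::real^3))\<^sup>2 = (p$1)\<^sup>2 + (p$2)\<^sup>2 + (p$3)\<^sup>2"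
  by (simp add: norm_vec_def L2_set_def sum_3 sum_nonneg)

lemma norm_complex2: "(norm (v::complex^2))\<^sup>2 = (cmod (v$1))\<^sup>2 + (cmod (v$2))\<^sup>2"
  by (simp add: norm_vec_def L2_set_def sum_2 sum_nonneg)

lemma pauli_vec_square_mult: "pauli_vec p *v (pauli_vec p *v v) = ((norm p)\<^sup>2) *\<^sub>R v"
  unfolding norm_real3
  by (simp add: vec_eq_iff forall_2 matrix_vector_mult_def sum_2 pauli_vec_entries complex_eq_iff)
     (simp add: algebra_simps power2_eq_square)

text \<open>The Bloch vector n of a unit eigenvector, whose components are its expectation values of
  the Pauli matrices, equals p/h. Indeed |n| = 1 and p . n = h, hence |p - h n|^2 = 0. The
  eigenvector need not be solved for, and no component has to be nonzero.\<close>

lemma bloch_vector: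
  fixes v1 v2 :: complex and p1 p2 p3 h :: real
  assumes n: "(cmod v1)\<^sup>2 + (cmod v2)\<^sup>2 = 1" and h: "p1\<^sup>2 + p2\<^sup>2 + p3\<^sup>2 = h\<^sup>2"
    and e1: "complex_of_real p3 * v1 + (complex_of_real p1 - \<i> * complex_of_real p2) * v2 = complex_of_real h * v1"
    and e2: "(complex_of_real p1 + \<i> * complex_of_real p2) * v1 - complex_of_real p3 * v2 = complex_of_real h * v2"
  shows "p1 = 2 * h * Re (cnj v1 * v2) \<and> p2 = 2 * h * Im (cnj v1 * v2) \<and> p3 = h * ((cmod v1)\<^sup>2 - (cmod v2)\<^sup>2)"
proof -
  obtain a b c d where v: "v1 = Complex a b" "v2 = Complex c d" by (metis complex.exhaust_sel)
  let ?n1 = "2 * (a*c + b*d)" and ?n2 = "2 * (a*d - b*c)" and ?n3 = "a\<^sup>2 + b\<^sup>2 - c\<^sup>2 - d\<^sup>2"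
  have N: "a\<^sup>2 + b\<^sup>2 + c\<^sup>2 + d\<^sup>2 = 1" using n by (simp add: v cmod_power2)
  have "?n1\<^sup>2 + ?n2\<^sup>2 + ?n3\<^sup>2 = (a\<^sup>2 + b\<^sup>2 + c\<^sup>2 + d\<^sup>2)\<^sup>2" by algebra
  then have N1: "?n1\<^sup>2 + ?n2\<^sup>2 + ?n3\<^sup>2 = 1" by (simp add: N)
  have eqs: "p3*a + p1*c + p2*d = h*a" "p3*b + p1*d - p2*c = h*b" "p1*a - p2*b - p3*c = h*c" "p1*b + p2*a - p3*d = h*d"
    using e1 e2 by (simp_all add: v complex_eq_iff)
  have "p1 * ?n1 + p2 * ?n2 + p3 * ?n3 =
      a * (p3*a + p1*c + p2*d) + b * (p3*b + p1*d - p2*c) + c * (p1*a - p2*b - p3*c) + d * (p1*b + p2*a - p3*d)"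
    by (simp add: algebra_simps power2_eq_square)
  also have "\<dots> = h * (a\<^sup>2 + b\<^sup>2 + c\<^sup>2 + d\<^sup>2)" unfolding eqs by (simp add: algebra_simps power2_eq_square)
  finally have pn: "p1 * ?n1 + p2 * ?n2 + p3 * ?n3 = h" by (simp add: N)
  have "(p1 - h * ?n1)\<^sup>2 + (p2 - h * ?n2)\<^sup>2 + (p3 - h * ?n3)\<^sup>2 =
      (p1\<^sup>2 + p2\<^sup>2 + p3\<^sup>2) - 2 * h * (p1 * ?n1 + p2 * ?n2 + p3 * ?n3) + h\<^sup>2 * (?n1\<^sup>2 + ?n2\<^sup>2 + ?n3\<^sup>2)"
    by algebra
  also have "\<dots> = 0" unfolding pn N1 h by (simp add: power2_eq_square)
  finally have "p1 - h * ?n1 = 0 \<and> p2 - h * ?n2 = 0 \<and> p3 - h * ?n3 = 0"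
    by (smt (verit) zero_le_power2 zero_eq_power2)
  then show ?thesis by (simp add: v cmod_power2 algebra_simps)
qed

text \<open>Here \<open>a\<close>, \<open>b\<close> are the derivatives of the eigenvector \<open>v\<close> in the directions in which \<open>p\<close> has the
  derivatives \<open>q\<close>, \<open>s\<close>. Both claims follow by decomposing \<open>a\<close> and \<open>b\<close> in the orthonormal basis \<open>v\<close>,
  \<open>w = (- cnj v2, cnj v1)\<close>: the \<open>w\<close>-components are determined by the differentiated eigenvalue
  equation, the \<open>v\<close>-components are imaginary and cancel.\<close>

lemma berry_curvature:
  fixes v1 v2 a1 a2 b1 b2 :: complex and p1 p2 p3 q1 q2 q3 r1 r2 r3 h hx hs :: real
  assumes n: "(cmod v1)\<^sup>2 + (cmod v2)\<^sup>2 = 1" and h: "p1\<^sup>2 + p2\<^sup>2 + p3\<^sup>2 = h\<^sup>2" and h0: "h > 0"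
    and e1: "complex_of_real p3 * v1 + (complex_of_real p1 - \<i> * complex_of_real p2) * v2 = complex_of_real h * v1"
    and e2: "(complex_of_real p1 + \<i> * complex_of_real p2) * v1 - complex_of_real p3 * v2 = complex_of_real h * v2"
    and x1: "complex_of_real q3 * v1 + (complex_of_real q1 - \<i> * complex_of_real q2) * v2 +
        (complex_of_real p3 * a1 + (complex_of_real p1 - \<i> * complex_of_real p2) * a2) =
        complex_of_real hx * v1 + complex_of_real h * a1"
    and x2: "(complex_of_real q1 + \<i> * complex_of_real q2) * v1 - complex_of_real q3 * v2 +
        ((complex_of_real p1 + \<i> * complex_of_real p2) * a1 - complex_of_real p3 * a2) =
        complex_of_real hx * v2 + complex_of_real h * a2"
    and y1: "complex_of_real r3 * v1 + (complex_of_real r1 - \<i> * complex_of_real r2) * v2 +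
        (complex_of_real p3 * b1 + (complex_of_real p1 - \<i> * complex_of_real p2) * b2) =
        complex_of_real hs * v1 + complex_of_real h * b1"
    and y2: "(complex_of_real r1 + \<i> * complex_of_real r2) * v1 - complex_of_real r3 * v2 +
        ((complex_of_real p1 + \<i> * complex_of_real p2) * b1 - complex_of_real p3 * b2) =
        complex_of_real hs * v2 + complex_of_real h * b2"
    and na: "Re (cnj v1 * a1 + cnj v2 * a2) = 0" and nb: "Re (cnj v1 * b1 + cnj v2 * b2) = 0"
  defines "X \<equiv> p1 * (q2*r3 - q3*r2) + p2 * (q3*r1 - q1*r3) + p3 * (q1*r2 - q2*r1)"
  shows "cnj a1 * b1 + cnj a2 * b2 - (cnj b1 * a1 + cnj b2 * a2) = \<i> * complex_of_real (X / (2 * h^3))" (is ?A)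
    and "cnj a1 * ((complex_of_real p3 - complex_of_real h) * b1 + (complex_of_real p1 - \<i> * complex_of_real p2) * b2) +
      cnj a2 * ((complex_of_real p1 + \<i> * complex_of_real p2) * b1 + (- complex_of_real p3 - complex_of_real h) * b2) -
      (cnj b1 * ((complex_of_real p3 - complex_of_real h) * a1 + (complex_of_real p1 - \<i> * complex_of_real p2) * a2) +
      cnj b2 * ((complex_of_real p1 + \<i> * complex_of_real p2) * a1 + (- complex_of_real p3 - complex_of_real h) * a2))
      = - \<i> * complex_of_real (X / h\<^sup>2)" (is ?B)
proof -
  note bl = bloch_vector[OF n h e1 e2]
  have N: "cnj v1 * v1 + cnj v2 * v2 = 1"
    using n by (simp add: complex_eq_iff cmod_power2) (simp add: power2_eq_square algebra_simps)
  \<comment> \<open>\<open>p3m\<close> and \<open>p12\<close> list the entries of A_1 - h, which is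
    - 2 h times the projection onto \<open>w\<close>, the eigenvector for - h. This is why the
    second claim involves only \<open>w\<close>-components.\<close>
  have p3m: "complex_of_real p3 - complex_of_real h = - 2 * complex_of_real h * (v2 * cnj v2)"
    "- complex_of_real p3 - complex_of_real h = - 2 * complex_of_real h * (v1 * cnj v1)"
  proof -
    have "p3 - h = - 2 * h * (cmod v2)\<^sup>2" "- p3 - h = - 2 * h * (cmod v1)\<^sup>2"
    proof -
      have "h * ((cmod v1)\<^sup>2 + (cmod v2)\<^sup>2) = h" by (simp add: n)
      then show "p3 - h = - 2 * h * (cmod v2)\<^sup>2" "- p3 - h = - 2 * h * (cmod v1)\<^sup>2"
        using bl unfolding distrib_left right_diff_distrib by linarith+
    qed
    then show "complex_of_real p3 - complex_of_real h = - 2 * complex_of_real h * (v2 * cnj v2)"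
      "- complex_of_real p3 - complex_of_real h = - 2 * complex_of_real h * (v1 * cnj v1)"
      by (simp_all add: complex_norm_square[symmetric] complex_eq_iff)
  qed
  have p12: "complex_of_real p1 + \<i> * complex_of_real p2 = 2 * complex_of_real h * (cnj v1 * v2)"
    "complex_of_real p1 - \<i> * complex_of_real p2 = 2 * complex_of_real h * (v1 * cnj v2)"
    using bl by (simp_all add: complex_eq_iff algebra_simps)
  \<comment> \<open>\<open>wa\<close> and \<open>wb\<close> are the \<open>w\<close>-components of
    \<open>a\<close> and \<open>b\<close>.\<close>
  define wa where "wa = v1 * a2 - v2 * a1"
  define wb where "wb = v1 * b2 - v2 * b1"
  \<comment> \<open>The differentiated eigenvalue equation paired with \<open>w\<close>:
    orthogonality to \<open>v\<close> removes the derivative of h, and A_1 acting on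
    \<open>w\<close> as - h produces the factor 2 h.\<close>
  have zq: "v1 * ((complex_of_real q1 + \<i> * complex_of_real q2) * v1 - complex_of_real q3 * v2)
      - v2 * (complex_of_real q3 * v1 + (complex_of_real q1 - \<i> * complex_of_real q2) * v2) =
      2 * complex_of_real h * wa" (is "?zq = _")
  proof -
    have "?zq = v1 * (complex_of_real hx * v2 - ((complex_of_real p1 + \<i> * complex_of_real p2) * a1 + (- complex_of_real p3 - complex_of_real h) * a2))
      - v2 * (complex_of_real hx * v1 - ((complex_of_real p3 - complex_of_real h) * a1 + (complex_of_real p1 - \<i> * complex_of_real p2) * a2))"
      using x1 x2 by algebra
    also have "\<dots> = 2 * complex_of_real h * wa * (cnj v1 * v1 + cnj v2 * v2)"
      unfolding p3m p12 wa_def by algebra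
    finally show ?thesis using N by simp
  qed
  have zs: "v1 * ((complex_of_real r1 + \<i> * complex_of_real r2) * v1 - complex_of_real r3 * v2)
      - v2 * (complex_of_real r3 * v1 + (complex_of_real r1 - \<i> * complex_of_real r2) * v2) =
      2 * complex_of_real h * wb" (is "?zs = _")
  proof -
    have "?zs = v1 * (complex_of_real hs * v2 - ((complex_of_real p1 + \<i> * complex_of_real p2) * b1 + (- complex_of_real p3 - complex_of_real h) * b2))
      - v2 * (complex_of_real hs * v1 - ((complex_of_real p3 - complex_of_real h) * b1 + (complex_of_real p1 - \<i> * complex_of_real p2) * b2))"
      using y1 y2 by algebra
    also have "\<dots> = 2 * complex_of_real h * wb * (cnj v1 * v1 + cnj v2 * v2)"
      unfolding p3m p12 wb_def by algebra
    finally show ?thesis using N by simp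
  qed
  \<comment> \<open>\<open>?E\<close> is n . (q \<times> r) with n the Bloch vector, so h
    \<open>?E\<close> = \<open>X\<close>. The identity between quartic and quadratic expressions in
    \<open>v\<close> is made homogeneous by a factor |v|^2 = 1.\<close>
  have im: "Im (cnj wa * wb) = X / (4 * h^3)"
  proof -
    obtain a b c d where v: "v1 = Complex a b" "v2 = Complex c d" by (metis complex.exhaust_sel)
    let ?E = "2 * (a*c + b*d) * (q2*r3 - q3*r2) + 2 * (a*d - b*c) * (q3*r1 - q1*r3)
        + (a\<^sup>2 + b\<^sup>2 - (c\<^sup>2 + d\<^sup>2)) * (q1*r2 - q2*r1)"
    have N': "a\<^sup>2 + b\<^sup>2 + (c\<^sup>2 + d\<^sup>2) = 1" using n by (simp add: v cmod_power2)
    have "Im (cnj ?zq * ?zs) = ?E * (a\<^sup>2 + b\<^sup>2 + (c\<^sup>2 + d\<^sup>2))"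
      by (simp add: v algebra_simps power2_eq_square)
    then have "Im (cnj ?zq * ?zs) = ?E" by (simp only: N' mult_1_right)
    moreover have pe: "p1 = 2 * h * (a*c + b*d)" "p2 = 2 * h * (a*d - b*c)" "p3 = h * (a\<^sup>2 + b\<^sup>2 - (c\<^sup>2 + d\<^sup>2))"
      using bl by (simp_all add: v cmod_power2 algebra_simps)
    have "X = h * ?E" unfolding X_def pe by (simp add: algebra_simps)
    ultimately have "h * Im (cnj ?zq * ?zs) = X" by (simp only:)
    moreover have "Im (cnj ?zq * ?zs) = 4 * h\<^sup>2 * Im (cnj wa * wb)"
      unfolding zq zs by (simp add: power2_eq_square algebra_simps)
    ultimately have "X = 4 * h^3 * Im (cnj wa * wb)" by (simp only: power2_eq_square power3_eq_cube mult_ac)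
    then show ?thesis using h0 by (simp only: field_simps) simp
  qed
  have imw: "cnj wa * wb - cnj wb * wa = \<i> * complex_of_real (2 * Im (cnj wa * wb))"
    by (simp add: complex_eq_iff)
  have va: "cnj (cnj v1 * a1 + cnj v2 * a2) * (cnj v1 * b1 + cnj v2 * b2) -
    cnj (cnj v1 * b1 + cnj v2 * b2) * (cnj v1 * a1 + cnj v2 * a2) = 0"
  proof -
    have "cnj z * w - cnj w * z = 0" if "Re z = 0" "Re w = 0" for z w
      using that by (simp add: complex_eq_iff)
    then show ?thesis using na nb by blast
  qed
  have "cnj a1 * b1 + cnj a2 * b2 - (cnj b1 * a1 + cnj b2 * a2) =
      (cnj a1 * b1 + cnj a2 * b2 - (cnj b1 * a1 + cnj b2 * a2)) * (cnj v1 * v1 + cnj v2 * v2)"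
    by (simp add: N)
  also have "\<dots> = (cnj (cnj v1 * a1 + cnj v2 * a2) * (cnj v1 * b1 + cnj v2 * b2) -
      cnj (cnj v1 * b1 + cnj v2 * b2) * (cnj v1 * a1 + cnj v2 * a2)) + (cnj wa * wb - cnj wb * wa)"
    unfolding wa_def wb_def by (simp add: algebra_simps)
  finally show ?A unfolding va imw im by simp
  have "cnj a1 * ((complex_of_real p3 - complex_of_real h) * b1 + (complex_of_real p1 - \<i> * complex_of_real p2) * b2) +
      cnj a2 * ((complex_of_real p1 + \<i> * complex_of_real p2) * b1 + (- complex_of_real p3 - complex_of_real h) * b2) -
      (cnj b1 * ((complex_of_real p3 - complex_of_real h) * a1 + (complex_of_real p1 - \<i> * complex_of_real p2) * a2) +
      cnj b2 * ((complex_of_real p1 + \<i> * complex_of_real p2) * a1 + (- complex_of_real p3 - complex_of_real h) * a2))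
    = - 2 * complex_of_real h * (cnj wa * wb - cnj wb * wa)"
    unfolding p3m p12 wa_def wb_def by (simp add: algebra_simps)
  also have "\<dots> = - \<i> * complex_of_real (X / h\<^sup>2)"
    unfolding imw im using h0 by (simp add: complex_eq_iff power2_eq_square power3_eq_cube field_simps)
  finally show ?B .
qed

lemma pd_bounded_linear:
  assumes "bounded_linear L" "f differentiable (at x)"
  shows "pd \<alpha> (\<lambda>y. L (f y)) x = L (pd \<alpha> f x)"
  using pd_eqI[OF bounded_linear.has_derivative[OF assms(1) pd_has_derivative[OF assms(2)]]]
  by (simp add: pd_def)

lemma pd_bilinear:
  assumes "bounded_bilinear h" "f differentiable (at x)" "g differentiable (at x)"
  shows "pd \<alpha> (\<lambda>y. h (f y) (g y)) x = h (f x) (pd \<alpha> g x) + h (pd \<alpha> f x) (g x)"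
  using pd_eqI[OF bounded_bilinear.FDERIV[OF assms(1) pd_has_derivative[OF assms(2)] pd_has_derivative[OF assms(3)]]]
  by (simp add: pd_def)

text \<open>\<open>G\<close> is kept abstract so that the lemma serves both the x-derivatives at
  fixed \<xi> and the \<xi>-derivatives at fixed x. The number \<open>hx\<close> is the derivative
  of the eigenvalue; it drops out later, so only its existence is recorded.\<close>

lemma eigenvector_slice:
  fixes G :: "real^3 \<Rightarrow> real^3" and u :: "real^3 \<Rightarrow> complex^2"
  assumes T: "open T" "t \<in> T"
    and ev: "\<And>y. y \<in> T \<Longrightarrow> norm (u y) = 1" "\<And>y. y \<in> T \<Longrightarrow> pauli_vec (G y) *v u y = norm (G y) *\<^sub>R u y"
    and G: "G differentiable (at t)" and u: "u differentiable (at t)" and G0: "G t \<noteq> 0"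
  shows "\<exists>hx. pauli_vec (pd \<alpha> G t) *v u t + pauli_vec (G t) *v pd \<alpha> u t = hx *\<^sub>R u t + norm (G t) *\<^sub>R pd \<alpha> u t"
    and "Re (cnj (u t $ 1) * pd \<alpha> u t $ 1 + cnj (u t $ 2) * pd \<alpha> u t $ 2) = 0"
proof -
  have pG: "(\<lambda>y. pauli_vec (G y)) differentiable (at t)"
    using bounded_linear.has_derivative[OF bounded_linear_pauli_vec] G unfolding differentiable_def by blast
  have nG: "(\<lambda>y. norm (G y)) differentiable (at t)"
    using differentiable_compose[OF differentiable_norm_at[OF G0] G] by simp
  have l: "(\<lambda>y. pauli_vec (G y) *v u y) differentiable (at t)"
    using bounded_bilinear.FDERIV[OF bounded_bilinear_matrix_vector_mult] pG u unfolding differentiable_def by blast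
  have "pd \<alpha> (\<lambda>y. pauli_vec (G y) *v u y) t = pd \<alpha> (\<lambda>y. norm (G y) *\<^sub>R u y) t"
    by (rule pd_cong_open[OF T _ l]) (rule ev(2))
  then show "\<exists>hx. pauli_vec (pd \<alpha> G t) *v u t + pauli_vec (G t) *v pd \<alpha> u t = hx *\<^sub>R u t + norm (G t) *\<^sub>R pd \<alpha> u t"
    unfolding pd_bilinear[OF bounded_bilinear_matrix_vector_mult pG u] pd_bilinear[OF bounded_bilinear_scaleR nG u]
      pd_bounded_linear[OF bounded_linear_pauli_vec G]
    by (intro exI[of _ "pd \<alpha> (\<lambda>y. norm (G y)) t"]) (simp add: add.commute)
  have "pd \<alpha> (\<lambda>y. u y \<bullet> u y) t = pd \<alpha> (\<lambda>y. 1) t"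
  proof (rule pd_cong_open[OF T])
    show "u y \<bullet> u y = 1" if "y \<in> T" for y using ev(1)[OF that] by (simp add: dot_square_norm)
    show "(\<lambda>y. u y \<bullet> u y) differentiable (at t)" using u by (intro differentiable_inner)
  qed
  then have "u t \<bullet> pd \<alpha> u t + pd \<alpha> u t \<bullet> u t = 0"
    unfolding pd_bilinear[OF bounded_bilinear_inner u u] by (simp add: pd_def)
  then show "Re (cnj (u t $ 1) * pd \<alpha> u t $ 1 + cnj (u t $ 2) * pd \<alpha> u t $ 2) = 0"
    by (simp add: inner_vec_def sum_2 inner_complex_def algebra_simps)
qed

lemma pauli_vec_square: "det (pauli_vec p) = - complex_of_real ((norm p)\<^sup>2)"
  unfolding norm_real3 by (simp add: det_2 pauli_vec_entries complex_eq_iff power2_eq_square)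

text \<open>The diagonal entries of this matrix add up to 2 |p|. Since the square of
  \<open>pauli_vec p\<close> is |p|^2, every nonzero vector in its range is an eigenvector for |p|,
  and it varies smoothly with p for fixed \<open>u\<close>.\<close>

lemma pauli_vec_plus_norm_nonzero:
  assumes "p \<noteq> 0"
  shows "\<exists>u. pauli_vec p *v u + norm p *\<^sub>R u \<noteq> 0"
proof (rule ccontr)
  assume "\<not> ?thesis"
  then have z: "pauli_vec p *v u + norm p *\<^sub>R u = 0" for u by blast
  have "(pauli_vec p *v axis 1 1 + norm p *\<^sub>R axis 1 1) $ 1 = 0" "(pauli_vec p *v axis 2 1 + norm p *\<^sub>R axis 2 1) $ 2 = 0"
    unfolding z by simp_all
  then have "complex_of_real (p $ 3) + norm p = 0" "- complex_of_real (p $ 3) + norm p = 0"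
    unfolding vector_add_component vector_scaleR_component
    by (simp_all add: matrix_vector_mult_def sum_2 pauli_vec_entries axis_def)
  then have "norm p = 0" by (simp add: complex_eq_iff)
  with assms show False by simp
qed

lemma pauli_vec_plus_norm_eigenvector:
  "pauli_vec p *v (pauli_vec p *v u + norm p *\<^sub>R u) = norm p *\<^sub>R (pauli_vec p *v u + norm p *\<^sub>R u)"
  by (simp add: bounded_bilinear.add_right[OF bounded_bilinear_matrix_vector_mult] pauli_vec_square_mult
      matrix_vector_mult_scaleR_right power2_eq_square scaleR_add_right add.commute)

text \<open>Applying the matrix twice gives h^2 = |p|^2 for every eigenvalue h, and positivity
  leaves only |p|.\<close>

lemma pauli_vec_eigenvalue:
  assumes "p \<noteq> 0"
  shows "(THE h. h > 0 \<and> (\<exists>v. v \<noteq> 0 \<and> pauli_vec p *v v = complex_of_real h *s v)) = norm p"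
    (is "(THE h. ?P h) = _")
proof (rule the_equality)
  have sc: "complex_of_real h *s v = h *\<^sub>R v" for h and v :: "complex^2"
    by (simp add: vec_eq_iff scaleR_conv_of_real[symmetric])
  have un: "h = norm p" if P: "?P h" for h
  proof -
    obtain v where "v \<noteq> 0" "pauli_vec p *v v = h *\<^sub>R v" using P sc by auto
    then have "((norm p)\<^sup>2) *\<^sub>R v = h\<^sup>2 *\<^sub>R v" using pauli_vec_square_mult[of p v]
      by (simp add: matrix_vector_mult_scaleR_right power2_eq_square)
    then have "(norm p)\<^sup>2 = h\<^sup>2" using \<open>v \<noteq> 0\<close> by simp
    then show ?thesis using P by (simp add: power2_eq_iff_nonneg)
  qed
  then show "?P h \<Longrightarrow> h = norm p" for h .
  have ex: "\<exists>v. v \<noteq> 0 \<and> pauli_vec p *v v = (norm p) *\<^sub>R v"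
  proof -
    obtain u where "pauli_vec p *v u + norm p *\<^sub>R u \<noteq> 0" using pauli_vec_plus_norm_nonzero[OF assms] by blast
    then show ?thesis using pauli_vec_plus_norm_eigenvector by blast
  qed
  then show "?P (norm p)" using assms sc by auto
qed

definition triple :: "real^3 \<Rightarrow> real^3 \<Rightarrow> real^3 \<Rightarrow> real" where
  "triple p q r = p$1 * (q$2 * r$3 - q$3 * r$2) + p$2 * (q$3 * r$1 - q$1 * r$3) + p$3 * (q$1 * r$2 - q$2 * r$1)"

lemma mat_mult_nth: "(mat k ** M) $ i $ j = k * M $ i $ j" for M :: "complex^'m::finite^'n::finite"
  by (simp add: matrix_matrix_mult_def mat_def if_distrib if_distribR cong: if_cong)

section \<open>The frame encoded in the principal symbol\<close>

locale elliptic_op = diff_op \<A> A for \<A> :: "'a::t2_space chart set" and A +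
  assumes comp: "compact (UNIV :: 'a set)" and ell: "elliptic \<A> A"
    and sa: "formally_self_adjoint \<A> A" and tf: "trace_free \<A> A"
begin

text \<open>The rows of \<open>frame c x\<close> are the vectors \<open>V\<^sub>j\<close> with \<open>A\<^sub>1(x, \<xi>) = s\<^sup>j V\<^sub>j\<^sup>\<alpha> \<xi>\<^sub>\<alpha>\<close>.\<close>

definition frame :: "'a chart \<Rightarrow> real^3 \<Rightarrow> real^3^3" where
  "frame c x = (\<chi> j. \<chi> \<alpha>. if j = 1 then Re (\<i> * P c x $ \<alpha> $ 2 $ 1)
     else if j = 2 then Im (\<i> * P c x $ \<alpha> $ 2 $ 1) else Re (\<i> * P c x $ \<alpha> $ 1 $ 1))"

lemma sym1_axis: "sym1 \<A> A c x (axis \<alpha> 1) = mat \<i> ** P c x $ \<alpha>"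
proof -
  have "mat (\<i> * complex_of_real (axis \<alpha> 1 $ \<beta>)) ** P c x $ \<beta> =
      (if \<beta> = \<alpha> then mat \<i> ** P c x $ \<alpha> else 0)" for \<beta>
    by (cases "\<beta> = \<alpha>") (simp_all add: axis_def vec_eq_iff mat_mult_nth)
  then show ?thesis unfolding sym1_def by simp
qed

text \<open>A trace-free Hermitian 2 by 2 matrix is determined by its (1,1) entry, which is real,
  and its (2,1) entry; these are p_3 and p_1 + i p_2 in the Pauli basis.\<close>

lemma principal_frame:
  assumes c: "c \<in> \<A>" and x: "x \<in> coords c"
  shows "mat \<i> ** P c x $ \<alpha> = pauli_vec (frame c x *v axis \<alpha> 1)"
proof -
  have m: "(frame c x *v axis \<alpha> 1) $ j = frame c x $ j $ \<alpha>" for j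
    by (simp add: matrix_vector_mult_def axis_def if_distrib cong: if_cong)
  have ah: "P c x $ \<alpha> $ i $ j + cnj (P c x $ \<alpha> $ j $ i) = 0" for i j
    by (rule principal_antihermitian[OF comp sa c x])
  have "axis \<alpha> (1::real) \<noteq> (0 :: real^3)" by simp
  then have "trace (mat \<i> ** P c x $ \<alpha>) = 0"
    using tf c x unfolding trace_free_def sym1_axis[symmetric] by blast
  then have tr: "P c x $ \<alpha> $ 1 $ 1 + P c x $ \<alpha> $ 2 $ 2 = 0"
    by (simp add: trace_def sum_2 mat_mult_nth distrib_left[symmetric])
  show ?thesis
    unfolding vec_eq_iff forall_2 mat_mult_nth pauli_vec_entries m
    using ah[of 1 1] ah[of 1 2] ah[of 2 1] tr
    by (simp add: frame_def complex_eq_iff) 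
qed

lemma sym1_frame:
  assumes c: "c \<in> \<A>" and x: "x \<in> coords c"
  shows "sym1 \<A> A c x \<xi> = pauli_vec (frame c x *v \<xi>)"
proof -
  have "sym1 \<A> A c x \<xi> = (\<Sum>\<alpha>\<in>UNIV. \<xi> $ \<alpha> *\<^sub>R (mat \<i> ** P c x $ \<alpha>))"
    unfolding sym1_def
    by (intro sum.cong refl) (simp add: vec_eq_iff mat_mult_nth; simp add: scaleR_conv_of_real)
  also have "\<dots> = pauli_vec (\<Sum>\<alpha>\<in>UNIV. \<xi> $ \<alpha> *\<^sub>R (frame c x *v axis \<alpha> 1))"
    unfolding principal_frame[OF c x]
    using bounded_linear.linear[OF bounded_linear_pauli_vec] by (simp add: linear_sum linear_cmul)
  also have "(\<Sum>\<alpha>\<in>UNIV. \<xi> $ \<alpha> *\<^sub>R (frame c x *v axis \<alpha> 1)) = frame c x *v \<xi>"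
    by (simp add: vec_eq_iff matrix_vector_mult_def axis_def if_distrib mult.commute cong: if_cong)
  finally show ?thesis .
qed

text \<open>The determinant of \<open>pauli_vec p\<close> is - |p|^2, so ellipticity forbids p = 0
  for nonzero \<xi>. The three rows are therefore linearly independent.\<close>

lemma frame_injective:
  assumes c: "c \<in> \<A>" and x: "x \<in> coords c" and "\<xi> \<noteq> 0"
  shows "frame c x *v \<xi> \<noteq> 0"
proof
  assume "frame c x *v \<xi> = 0"
  then have "det (sym1 \<A> A c x \<xi>) = 0" unfolding sym1_frame[OF c x] pauli_vec_square by simp
  with ell assms show False unfolding elliptic_def by blast
qed

lemma hplus_frame:
  assumes c: "c \<in> \<A>" and x: "x \<in> coords c" and "\<xi> \<noteq> 0"
  shows "hplus \<A> A c x \<xi> = norm (frame c x *v \<xi>)"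
  unfolding hplus_def sym1_frame[OF c x] by (rule pauli_vec_eigenvalue[OF frame_injective[OF assms]])

lemma smooth_frame:
  assumes c: "c \<in> \<A>"
  shows "smooth_on (coords c) (frame c)"
proof -
  note o = open_coords[OF c]
  have e: "smooth_on (coords c) (\<lambda>x. \<i> * P c x $ \<alpha> $ i $ j)" for \<alpha> i j
    by (intro bounded_linear.smooth_on_comp[OF bounded_linear_mult_right o] smooth_on_nth[OF o] smooth_P c)
  have "smooth_on (coords c) (\<lambda>x. if j = 1 then Re (\<i> * P c x $ \<alpha> $ 2 $ 1)
     else if j = 2 then Im (\<i> * P c x $ \<alpha> $ 2 $ 1) else Re (\<i> * P c x $ \<alpha> $ 1 $ 1))" for j :: 3 and \<alpha>
    by (cases "j = 1"; cases "j = 2")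
       (simp_all only: if_True if_False refl bounded_linear.smooth_on_comp[OF bounded_linear_Re o e]
          bounded_linear.smooth_on_comp[OF bounded_linear_Im o e])
  then show ?thesis unfolding frame_def[abs_def] by (intro smooth_on_vec_lambda o)
qed

end

lemma bounded_bilinear_real_matrix_vector_mult:
  "bounded_bilinear (\<lambda>(M::real^'n::finite^'m::finite) (v::real^'n). M *v v)"
  unfolding bilinear_conv_bounded_bilinear[symmetric] bilinear_def
  by (auto intro!: linearI simp: matrix_vector_mult_def vec_eq_iff sum_distrib_left distrib_left distrib_right sum.distrib mult_ac)

lemma smooth_on_norm:
  fixes f :: "'a::euclidean_space \<Rightarrow> 'b::real_inner"
  assumes "open S" "smooth_on S f" "\<And>x. x \<in> S \<Longrightarrow> f x \<noteq> 0"
  shows "smooth_on S (\<lambda>x. norm (f x))"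
proof -
  have "smooth_on S (\<lambda>x. sqrt (f x \<bullet> f x))"
    using assms by (intro smooth_on_sqrt bounded_bilinear.smooth_on_prod[OF bounded_bilinear_inner]) auto
  then show ?thesis by (simp add: norm_eq_sqrt_inner)
qed

lemma open_slices:
  assumes "open N" "(x, \<xi>) \<in> N"
  shows "open {y. (y, \<xi>) \<in> N}" "open {\<eta>. (x, \<eta>) \<in> N}"
proof -
  have "{y. (y, \<xi>) \<in> N} = (\<lambda>y. (y, \<xi>)) -` N" "{\<eta>. (x, \<eta>) \<in> N} = (\<lambda>\<eta>. (x, \<eta>)) -` N" by auto
  then show "open {y. (y, \<xi>) \<in> N}" "open {\<eta>. (x, \<eta>) \<in> N}"
    using assms(1) by (simp_all add: open_vimage continuous_intros)
qed

lemma herm_adj_columnvector_nth: "herm_adj (columnvector u) $ i $ j = cnj (u $ j)"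
  by (simp add: herm_adj_def columnvector_def)

lemma columnvector_nth: "columnvector u $ i $ j = u $ i"
  by (simp add: columnvector_def)

lemma bounded_linear_columnvector: "bounded_linear (columnvector :: complex^2 \<Rightarrow> complex^1^2)"
  unfolding linear_conv_bounded_linear[symmetric]
  by (rule linearI) (simp_all add: columnvector_def vec_eq_iff)

lemma bounded_linear_herm_adj_columnvector:
  "bounded_linear (\<lambda>u. herm_adj (columnvector u :: complex^1^2) :: complex^2^1)"
  unfolding linear_conv_bounded_linear[symmetric]
  by (rule linearI) (simp_all add: vec_eq_iff herm_adj_columnvector_nth)

context elliptic_op
begin

text \<open>A vector \<open>u\<close> not annihilated by A_1 + h at the given point is fixed. Its
  image under A_1 + h is an eigenvector for h, smooth in both variables, and it is normalised on the
  open set where it does not vanish.\<close>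

lemma ex_local_vplus:
  assumes c: "c \<in> \<A>" and x: "x \<in> coords c" and \<xi>: "\<xi> \<noteq> 0"
  shows "\<exists>v. local_vplus \<A> A c x \<xi> v"
proof -
  obtain u where u: "pauli_vec (frame c x *v \<xi>) *v u + norm (frame c x *v \<xi>) *\<^sub>R u \<noteq> 0"
    using pauli_vec_plus_norm_nonzero[OF frame_injective[OF c x \<xi>]] by blast
  let ?S = "coords c \<times> (UNIV - {0 :: real^3})"
  have oS: "open ?S" using open_coords[OF c] by (intro open_Times) auto
  define G where "G = (\<lambda>z::(real^3) \<times> (real^3). frame c (fst z) *v snd z)"
  define w where "w = (\<lambda>z. pauli_vec (G z) *v u + norm (G z) *\<^sub>R u)"
  have sG: "smooth_on ?S G"
    unfolding G_def
    by (intro bounded_bilinear.smooth_on_prod[OF bounded_bilinear_real_matrix_vector_mult oS]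
        smooth_on_compose[OF oS open_coords[OF c] _ smooth_frame[OF c]] smooth_on_bounded_linear
        bounded_linear_fst bounded_linear_snd) auto
  have G0: "G z \<noteq> 0" if "z \<in> ?S" for z
    using that frame_injective[OF c] by (auto simp: G_def)
  have sw: "smooth_on ?S w"
    unfolding w_def
    by (intro smooth_on_add[OF oS] bounded_bilinear.smooth_on_prod[OF bounded_bilinear_matrix_vector_mult oS]
        bounded_linear.smooth_on_comp[OF bounded_linear_pauli_vec oS] smooth_on_const smooth_on_scaleR[OF oS]
        smooth_on_norm[OF oS sG G0] sG)
  define N where "N = ?S \<inter> w -` (- {0})"
  have oN: "open N"
    unfolding N_def by (rule continuous_open_preimage[OF smooth_on_continuous[OF sw] oS]) auto
  have xN: "(x, \<xi>) \<in> N" using x \<xi> u by (simp add: N_def w_def G_def)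
  have NS: "N \<subseteq> ?S" by (auto simp: N_def)
  let ?v = "\<lambda>y \<eta>. inverse (norm (w (y, \<eta>))) *\<^sub>R w (y, \<eta>)"
  have swN: "smooth_on N w" by (rule smooth_on_subset[OF sw NS])
  have w0: "w z \<noteq> 0" if "z \<in> N" for z using that by (auto simp: N_def)
  have "smooth_on N (\<lambda>z. inverse (norm (w z)) *\<^sub>R w z)"
    using w0 by (intro smooth_on_scaleR[OF oN] smooth_on_inverse[OF oN] smooth_on_norm[OF oN] swN) auto
  then have s: "smooth_on N (\<lambda>(y, \<eta>). ?v y \<eta>)"
    by (rule smooth_on_cong[OF oN, rotated]) auto
  have e: "norm (?v y \<eta>) = 1 \<and> sym1 \<A> A c y \<eta> *v ?v y \<eta> = complex_of_real (hplus \<A> A c y \<eta>) *s ?v y \<eta>"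
    if "(y, \<eta>) \<in> N" for y \<eta>
  proof
    show "norm (?v y \<eta>) = 1" using w0[OF that] by simp
    have y: "y \<in> coords c" "\<eta> \<noteq> 0" using that NS by auto
    show "sym1 \<A> A c y \<eta> *v ?v y \<eta> = complex_of_real (hplus \<A> A c y \<eta>) *s ?v y \<eta>"
      unfolding sym1_frame[OF c y(1)] hplus_frame[OF c y] matrix_vector_mult_scaleR_right w_def G_def fst_conv snd_conv
        pauli_vec_plus_norm_eigenvector
      by (simp add: vec_eq_iff; simp add: scaleR_conv_of_real)
  qed
  show ?thesis unfolding local_vplus_def
    by (rule exI[of _ ?v], rule exI[of _ N]) (use oN xN NS s e in auto)
qed

lemma b_integrand_frame:
  assumes c: "c \<in> \<A>" and x: "x \<in> coords c" and \<xi>: "\<xi> \<noteq> 0"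
    and sub: "subprincipal \<A> A c x = mat k"
  defines "p \<equiv> frame c x *v \<xi>"
  shows "b_integrand \<A> A c x \<xi> = k - complex_of_real
    (3 / (4 * (norm p)\<^sup>2) * (\<Sum>\<alpha>\<in>UNIV. triple p (pd \<alpha> (frame c) x *v \<xi>) (frame c x *v axis \<alpha> 1)))"
proof -
  define v where "v = (SOME v. local_vplus \<A> A c x \<xi> v)"
  have "local_vplus \<A> A c x \<xi> v" unfolding v_def by (rule someI_ex[OF ex_local_vplus[OF c x \<xi>]])
  then obtain N where N: "open N" "(x, \<xi>) \<in> N" "N \<subseteq> coords c \<times> (UNIV - {0})"
    and sv: "smooth_on N (\<lambda>(y, \<eta>). v y \<eta>)"
    and ev: "\<And>y \<eta>. (y, \<eta>) \<in> N \<Longrightarrow> norm (v y \<eta>) = 1 \<and>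
           sym1 \<A> A c y \<eta> *v v y \<eta> = complex_of_real (hplus \<A> A c y \<eta>) *s v y \<eta>"
    unfolding local_vplus_def by fast
  have sc: "complex_of_real h *s u = h *\<^sub>R u" for h and u :: "complex^2"
    by (simp add: vec_eq_iff; simp add: scaleR_conv_of_real)
  have ev': "norm (v y \<eta>) = 1" "pauli_vec (frame c y *v \<eta>) *v v y \<eta> = norm (frame c y *v \<eta>) *\<^sub>R v y \<eta>"
    if "(y, \<eta>) \<in> N" for y \<eta>
  proof -
    have "y \<in> coords c" "\<eta> \<noteq> 0" using that N(3) by auto
    then show "norm (v y \<eta>) = 1" "pauli_vec (frame c y *v \<eta>) *v v y \<eta> = norm (frame c y *v \<eta>) *\<^sub>R v y \<eta>"
      using ev[OF that] by (simp_all add: sym1_frame[OF c] hplus_frame[OF c] sc)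
  qed
  have dv: "(\<lambda>(y, \<eta>). v y \<eta>) differentiable (at (x, \<xi>))" by (rule smooth_on_differentiable[OF sv N(2)])
  have d1: "(\<lambda>y. (y, \<xi>)) differentiable (at x)" "(\<lambda>\<eta>. (x, \<eta>)) differentiable (at \<xi>)"
    unfolding differentiable_def by (auto intro!: exI derivative_eq_intros)
  have dx: "(\<lambda>y. v y \<xi>) differentiable (at x)"
    using differentiable_chain_at[OF d1(1) dv] by (simp add: o_def)
  have d\<xi>: "(\<lambda>\<eta>. v x \<eta>) differentiable (at \<xi>)"
    using differentiable_chain_at[OF d1(2) dv] by (simp add: o_def)
  have dF: "frame c differentiable (at x)" by (rule smooth_on_differentiable[OF smooth_frame[OF c] x])
  have dG: "(\<lambda>y. frame c y *v \<xi>) differentiable (at x)"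
    using bounded_bilinear.FDERIV[OF bounded_bilinear_real_matrix_vector_mult pd_has_derivative[OF dF] has_derivative_const]
    unfolding differentiable_def by blast
  have bl: "bounded_linear (\<lambda>\<eta>. frame c x *v \<eta>)" by (rule matrix_vector_mul_bounded_linear)
  have dG': "(\<lambda>\<eta>. frame c x *v \<eta>) differentiable (at \<xi>)"
    using bounded_linear_imp_differentiable[OF bl] .
  have pq: "pd \<alpha> (\<lambda>y. frame c y *v \<xi>) x = pd \<alpha> (frame c) x *v \<xi>" for \<alpha>
    using pd_bilinear[OF bounded_bilinear_real_matrix_vector_mult dF, of "\<lambda>_. \<xi>"] by (simp add: pd_def)
  have ps: "pd \<alpha> (\<lambda>\<eta>. frame c x *v \<eta>) \<xi> = frame c x *v axis \<alpha> 1" for \<alpha>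
    using pd_eqI[OF bounded_linear_imp_has_derivative[OF bl]] .
  have p0: "p \<noteq> 0" unfolding p_def by (rule frame_injective[OF c x \<xi>])
  define h where "h = norm p"
  have h0: "h > 0" using p0 by (simp add: h_def)
  define a where "a = (\<lambda>\<alpha>. pd \<alpha> (\<lambda>y. v y \<xi>) x)"
  define b where "b = (\<lambda>\<alpha>. pd \<alpha> (\<lambda>\<eta>. v x \<eta>) \<xi>)"
  define q where "q = (\<lambda>\<alpha>. pd \<alpha> (frame c) x *v \<xi>)"
  define s where "s = (\<lambda>\<alpha>. frame c x *v axis \<alpha> 1)"
  define u where "u = v x \<xi>"
  have T1: "open {y. (y, \<xi>) \<in> N}" "x \<in> {y. (y, \<xi>) \<in> N}" using open_slices[OF N(1,2)] N(2) by auto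
  have T2: "open {\<eta>. (x, \<eta>) \<in> N}" "\<xi> \<in> {\<eta>. (x, \<eta>) \<in> N}" using open_slices[OF N(1,2)] N(2) by auto
  have X: "\<exists>hx. pauli_vec (q \<alpha>) *v u + pauli_vec p *v a \<alpha> = hx *\<^sub>R u + h *\<^sub>R a \<alpha>"
    "Re (cnj (u $ 1) * a \<alpha> $ 1 + cnj (u $ 2) * a \<alpha> $ 2) = 0" for \<alpha>
    using eigenvector_slice[OF T1 _ _ dG dx p0[unfolded p_def], of \<alpha>] ev'
    by (simp_all add: q_def a_def u_def p_def h_def pq)
  have Y: "\<exists>hx. pauli_vec (s \<alpha>) *v u + pauli_vec p *v b \<alpha> = hx *\<^sub>R u + h *\<^sub>R b \<alpha>"
    "Re (cnj (u $ 1) * b \<alpha> $ 1 + cnj (u $ 2) * b \<alpha> $ 2) = 0" for \<alpha>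
    using eigenvector_slice[OF T2 _ _ dG' d\<xi> p0[unfolded p_def], of \<alpha>] ev'
    by (simp_all add: s_def b_def u_def p_def h_def ps)
  have U: "pauli_vec p *v u = h *\<^sub>R u" "norm u = 1"
    using ev'[OF N(2)] by (simp_all add: u_def p_def h_def)
  have n: "(cmod (u $ 1))\<^sup>2 + (cmod (u $ 2))\<^sup>2 = 1" using U(2) norm_complex2[of u] by simp
  have hh: "(p $ 1)\<^sup>2 + (p $ 2)\<^sup>2 + (p $ 3)\<^sup>2 = h\<^sup>2" by (simp add: h_def norm_real3)
  have comps: "(pauli_vec r *v w) $ 1 = complex_of_real (r $ 3) * w $ 1 + (complex_of_real (r $ 1) - \<i> * complex_of_real (r $ 2)) * w $ 2"
    "(pauli_vec r *v w) $ 2 = (complex_of_real (r $ 1) + \<i> * complex_of_real (r $ 2)) * w $ 1 - complex_of_real (r $ 3) * w $ 2"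
    for r w by (simp_all add: matrix_vector_mult_def sum_2 pauli_vec_entries)
  have eqn: "M = N \<longleftrightarrow> M $ 1 = N $ 1 \<and> M $ 2 = N $ 2" for M N :: "complex^2" by (simp add: vec_eq_iff forall_2)
  have sR: "(r *\<^sub>R w) $ i = complex_of_real r * w $ i" for r i and w :: "complex^2"
    unfolding vector_scaleR_component by (rule scaleR_conv_of_real)
  have curv: "cnj (a \<alpha> $ 1) * b \<alpha> $ 1 + cnj (a \<alpha> $ 2) * b \<alpha> $ 2 - (cnj (b \<alpha> $ 1) * a \<alpha> $ 1 + cnj (b \<alpha> $ 2) * a \<alpha> $ 2)
      = \<i> * complex_of_real (triple p (q \<alpha>) (s \<alpha>) / (2 * h^3))"
    "cnj (a \<alpha> $ 1) * ((complex_of_real (p $ 3) - complex_of_real h) * b \<alpha> $ 1 + (complex_of_real (p $ 1) - \<i> * complex_of_real (p $ 2)) * b \<alpha> $ 2) +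
      cnj (a \<alpha> $ 2) * ((complex_of_real (p $ 1) + \<i> * complex_of_real (p $ 2)) * b \<alpha> $ 1 + (- complex_of_real (p $ 3) - complex_of_real h) * b \<alpha> $ 2) -
      (cnj (b \<alpha> $ 1) * ((complex_of_real (p $ 3) - complex_of_real h) * a \<alpha> $ 1 + (complex_of_real (p $ 1) - \<i> * complex_of_real (p $ 2)) * a \<alpha> $ 2) +
      cnj (b \<alpha> $ 2) * ((complex_of_real (p $ 1) + \<i> * complex_of_real (p $ 2)) * a \<alpha> $ 1 + (- complex_of_real (p $ 3) - complex_of_real h) * a \<alpha> $ 2))
      = - \<i> * complex_of_real (triple p (q \<alpha>) (s \<alpha>) / h\<^sup>2)" for \<alpha>
  proof -
    obtain hx where hx: "pauli_vec (q \<alpha>) *v u + pauli_vec p *v a \<alpha> = hx *\<^sub>R u + h *\<^sub>R a \<alpha>" using X by blast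
    obtain hs where hs: "pauli_vec (s \<alpha>) *v u + pauli_vec p *v b \<alpha> = hs *\<^sub>R u + h *\<^sub>R b \<alpha>" using Y by blast
    note e = U(1)[unfolded eqn comps sR]
    note ex = hx[unfolded eqn vector_add_component comps sR]
    note es = hs[unfolded eqn vector_add_component comps sR]
    note bc = berry_curvature[OF n hh h0 conjunct1[OF e] conjunct2[OF e] conjunct1[OF ex] conjunct2[OF ex]
        conjunct1[OF es] conjunct2[OF es] X(2)[of \<alpha>] Y(2)[of \<alpha>], folded triple_def]
    show "cnj (a \<alpha> $ 1) * b \<alpha> $ 1 + cnj (a \<alpha> $ 2) * b \<alpha> $ 2 - (cnj (b \<alpha> $ 1) * a \<alpha> $ 1 + cnj (b \<alpha> $ 2) * a \<alpha> $ 2)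
      = \<i> * complex_of_real (triple p (q \<alpha>) (s \<alpha>) / (2 * h^3))" by (rule bc(1))
    show "cnj (a \<alpha> $ 1) * ((complex_of_real (p $ 3) - complex_of_real h) * b \<alpha> $ 1 + (complex_of_real (p $ 1) - \<i> * complex_of_real (p $ 2)) * b \<alpha> $ 2) +
      cnj (a \<alpha> $ 2) * ((complex_of_real (p $ 1) + \<i> * complex_of_real (p $ 2)) * b \<alpha> $ 1 + (- complex_of_real (p $ 3) - complex_of_real h) * b \<alpha> $ 2) -
      (cnj (b \<alpha> $ 1) * ((complex_of_real (p $ 3) - complex_of_real h) * a \<alpha> $ 1 + (complex_of_real (p $ 1) - \<i> * complex_of_real (p $ 2)) * a \<alpha> $ 2) +
      cnj (b \<alpha> $ 2) * ((complex_of_real (p $ 1) + \<i> * complex_of_real (p $ 2)) * a \<alpha> $ 1 + (- complex_of_real (p $ 3) - complex_of_real h) * a \<alpha> $ 2))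
      = - \<i> * complex_of_real (triple p (q \<alpha>) (s \<alpha>) / h\<^sup>2)" by (rule bc(2))
  qed
  let ?V = "\<lambda>y \<eta>. columnvector (v y \<eta>) :: complex^1^2"
  let ?Vs = "\<lambda>y \<eta>. herm_adj (?V y \<eta>)"
  let ?Q = "\<lambda>y \<eta>. sym1 \<A> A c y \<eta> - mat (complex_of_real (hplus \<A> A c y \<eta>))"
  have pV: "pd \<alpha> (\<lambda>y. ?V y \<xi>) x = columnvector (a \<alpha>)" "pd \<alpha> (\<lambda>\<eta>. ?V x \<eta>) \<xi> = columnvector (b \<alpha>)"
    "pd \<alpha> (\<lambda>y. ?Vs y \<xi>) x = herm_adj (columnvector (a \<alpha>))" "pd \<alpha> (\<lambda>\<eta>. ?Vs x \<eta>) \<xi> = herm_adj (columnvector (b \<alpha>))" for \<alpha>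
    unfolding a_def b_def
    by (rule pd_bounded_linear[OF bounded_linear_columnvector dx] pd_bounded_linear[OF bounded_linear_columnvector d\<xi>]
        pd_bounded_linear[OF bounded_linear_herm_adj_columnvector dx] pd_bounded_linear[OF bounded_linear_herm_adj_columnvector d\<xi>])+
  have Q: "?Q x \<xi> = pauli_vec p - mat (complex_of_real h)"
    by (simp add: sym1_frame[OF c x] hplus_frame[OF c x \<xi>] p_def h_def)
  have P2: "poisson ?Vs ?V x \<xi> $ 1 $ 1 = (\<Sum>\<alpha>\<in>UNIV. \<i> * complex_of_real (triple p (q \<alpha>) (s \<alpha>) / (2 * h^3)))"
    unfolding poisson_def pV sum_component curv(1)[symmetric]
    by (intro sum.cong refl) (simp add: matrix_matrix_mult_def sum_2 herm_adj_columnvector_nth columnvector_nth)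
  have P3: "poisson3 ?Vs ?Q ?V x \<xi> $ 1 $ 1 = (\<Sum>\<alpha>\<in>UNIV. - \<i> * complex_of_real (triple p (q \<alpha>) (s \<alpha>) / h\<^sup>2))"
    unfolding poisson3_def pV Q sum_component curv(2)[symmetric]
    by (intro sum.cong refl)
      (simp add: matrix_matrix_mult_def sum_2 herm_adj_columnvector_nth columnvector_nth pauli_vec_entries mat_def algebra_simps)
  have "(?Vs x \<xi> ** subprincipal \<A> A c x ** ?V x \<xi>) $ 1 $ 1 =
      k * complex_of_real ((cmod (u $ 1))\<^sup>2 + (cmod (u $ 2))\<^sup>2)"
    unfolding sub u_def of_real_add complex_norm_square
    by (simp add: matrix_matrix_mult_def sum_2 herm_adj_columnvector_nth columnvector_nth mat_def algebra_simps)
  then have S: "(?Vs x \<xi> ** subprincipal \<A> A c x ** ?V x \<xi>) $ 1 $ 1 = k" unfolding n by simp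
  have "b_integrand \<A> A c x \<xi> = k - \<i> / 2 * (\<Sum>\<alpha>\<in>UNIV. - \<i> * complex_of_real (triple p (q \<alpha>) (s \<alpha>) / h\<^sup>2))
     + \<i> / (3 - 1) * complex_of_real h * (\<Sum>\<alpha>\<in>UNIV. \<i> * complex_of_real (triple p (q \<alpha>) (s \<alpha>) / (2 * h^3)))"
    unfolding b_integrand_def Let_def v_def[symmetric] S P2 P3 hplus_frame[OF c x \<xi>] p_def[symmetric] h_def[symmetric] ..
  \<comment> \<open>The triple bracket contributes - 1/(2 h^2) and the double bracket - 1/(4 h^2)
    times the triple product.\<close>
  also have "\<dots> = k - complex_of_real (3 / (4 * h\<^sup>2) * (\<Sum>\<alpha>\<in>UNIV. triple p (q \<alpha>) (s \<alpha>)))"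
    unfolding sum_distrib_left[symmetric] of_real_sum[symmetric] sum_divide_distrib[symmetric]
    using h0 by (simp add: complex_eq_iff power2_eq_square power3_eq_cube field_simps)
  finally show ?thesis by (simp add: q_def s_def h_def)
qed

end

section \<open>Averages of quadratic forms\<close>

lemma integral_linear_symmetry:
  fixes f :: "real^3 \<Rightarrow> real" and g :: "real^3 \<Rightarrow> real^3"
  assumes "linear g" "\<bar>det (matrix g)\<bar> = 1" "g ` S = S" "f absolutely_integrable_on S"
  shows "integral S (\<lambda>x. f (g x)) = integral S f"
proof -
  \<comment> \<open>\<open>f\<close> is wrapped as a vector with one component to fit the
    vector-valued change of variables theorem.\<close>
  let ?F = "\<lambda>x. (\<chi> i::1. f x)"
  have i: "?F absolutely_integrable_on S"
    using assms(4) by (subst absolutely_integrable_componentwise_iff) (auto simp: Basis_vec_def inner_axis)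
  have "(\<lambda>x. ?F (g x)) absolutely_integrable_on S \<and> integral S (\<lambda>x. ?F (g x)) = integral S ?F"
    using has_absolute_integral_change_of_variables_linear[OF assms(1), where f = ?F and S = S and b = "integral S ?F"]
      i assms(2,3) by simp
  then have eq: "integral S (\<lambda>x. ?F (g x)) = integral S ?F" and i2: "(\<lambda>x. ?F (g x)) absolutely_integrable_on S"
    by blast+
  have "integral S ?F $ 1 = integral S f"
    using integral_component_eq_cart[OF set_lebesgue_integral_eq_integral(1)[OF i], of 1] by simp
  moreover have "integral S (\<lambda>x. ?F (g x)) $ 1 = integral S (\<lambda>x. f (g x))"
    using integral_component_eq_cart[OF set_lebesgue_integral_eq_integral(1)[OF i2], of 1] by simp
  ultimately show ?thesis using eq by simp
qed

definition quad_ratio :: "real^3^3 \<Rightarrow> 3 \<Rightarrow> 3 \<Rightarrow> real^3 \<Rightarrow> real" where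
  "quad_ratio L j m \<xi> = (L *v \<xi>) $ j * (L *v \<xi>) $ m / (norm (L *v \<xi>))\<^sup>2"

context
  fixes L L' :: "real^3^3" and S :: "(real^3) set"
  assumes L': "L' ** L = mat 1" "L ** L' = mat 1"
  defines "S \<equiv> {\<xi>. \<xi> \<noteq> 0 \<and> norm (L *v \<xi>) < 1}"
begin

lemma inverse_matrix_apply: "L' *v (L *v \<xi>) = \<xi>" "L *v (L' *v p) = p"
  by (simp_all add: matrix_vector_mul_assoc L')

lemma invertible_matrix_nonzero: "\<xi> \<noteq> 0 \<Longrightarrow> L *v \<xi> \<noteq> 0"
  using inverse_matrix_apply(1)[of \<xi>] by (metis matrix_vector_mult_0_right)

lemma open_ellipsoid: "open S"
proof -
  have "S = (- {0}) \<inter> {\<xi>. norm (L *v \<xi>) < 1}" by (auto simp: S_def)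
  moreover have "open {\<xi>. norm (L *v \<xi>) < 1}"
    by (intro open_Collect_less continuous_intros matrix_vector_mult_linear_continuous_on)
  ultimately show ?thesis by auto
qed

lemma bounded_ellipsoid: "bounded S"
proof -
  obtain B where B: "\<And>p. norm (L' *v p) \<le> norm p * B"
    using bounded_linear.bounded[OF matrix_vector_mul_bounded_linear[of L']] by blast
  have "norm \<xi> \<le> \<bar>B\<bar>" if "\<xi> \<in> S" for \<xi>
  proof -
    have "norm \<xi> \<le> norm (L *v \<xi>) * B" using B[of "L *v \<xi>"] by (simp add: inverse_matrix_apply)
    also have "\<dots> \<le> norm (L *v \<xi>) * \<bar>B\<bar>" by (intro mult_left_mono) auto
    also have "\<dots> \<le> 1 * \<bar>B\<bar>" using that by (intro mult_right_mono) (auto simp: S_def)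
    finally show ?thesis by simp
  qed
  then show ?thesis by (auto simp: bounded_iff)
qed

lemma ellipsoid_borel: "S \<in> sets lborel"
  using open_ellipsoid by simp

lemma emeasure_ellipsoid_finite: "emeasure lborel S < \<infinity>"
  by (rule emeasure_bounded_finite[OF bounded_ellipsoid])

lemma measure_ellipsoid_pos: "measure lborel S > 0"
proof -
  have "S \<noteq> {}"
  proof -
    let ?p = "(1/2) *\<^sub>R axis 1 1 :: real^3"
    have "L' *v ?p \<noteq> 0"
    proof
      assume "L' *v ?p = 0"
      then have "?p = 0" using inverse_matrix_apply(2)[of ?p] by simp
      then show False by simp
    qed
    then have "L' *v ?p \<in> S" by (simp add: S_def inverse_matrix_apply)
    then show ?thesis by blast
  qed
  then have "S \<notin> null_sets lborel" using open_not_null_lborel[OF open_ellipsoid] by blast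
  then have "emeasure lborel S \<noteq> 0" using ellipsoid_borel by (auto simp: null_sets_def)
  then show ?thesis using emeasure_ellipsoid_finite by (simp add: measure_def enn2real_positive_iff zero_less_iff_neq_zero)
qed

abbreviation "ratio \<equiv> quad_ratio L"

lemma ratio_set_integrable: "set_integrable lborel S (ratio j m)"
  unfolding set_integrable_def
proof (rule integrableI_bounded_set_indicator[OF ellipsoid_borel _ emeasure_ellipsoid_finite])
  have c: "continuous_on UNIV (\<lambda>\<xi>. L *v \<xi>)" by (rule matrix_vector_mult_linear_continuous_on)
  have m: "(\<lambda>\<xi>. L *v \<xi>) \<in> borel_measurable borel"
    by (rule borel_measurable_continuous_onI[OF c])
  have mc: "(\<lambda>\<xi>. (L *v \<xi>) $ i) \<in> borel_measurable borel" for i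
    by (intro borel_measurable_continuous_onI continuous_intros c)
  show "ratio j m \<in> borel_measurable lborel"
    unfolding quad_ratio_def[abs_def] using m mc by measurable
  show "AE \<xi> \<in> S in lborel. norm (ratio j m \<xi>) \<le> 1"
  proof (rule AE_I2, rule impI)
    fix \<xi>
    have "\<bar>(L *v \<xi>) $ j\<bar> * \<bar>(L *v \<xi>) $ m\<bar> \<le> norm (L *v \<xi>) * norm (L *v \<xi>)"
      by (intro mult_mono component_le_norm_cart) auto
    then show "norm (ratio j m \<xi>) \<le> 1"
      by (cases "L *v \<xi> = 0") (simp_all add: quad_ratio_def abs_mult power2_eq_square divide_le_eq_1)
  qed
qed

lemma ratio_integral: "(LINT \<xi> : S | lborel. ratio j m \<xi>) = integral S (ratio j m)"
  by (rule set_borel_integral_eq_integral(2)[OF ratio_set_integrable])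

lemma ratio_absolutely_integrable: "ratio j m absolutely_integrable_on S"
  using ratio_set_integrable[of j m] ellipsoid_borel unfolding set_integrable_def
  by (intro integrable_completion[THEN iffD2]) (auto dest: borel_measurable_integrable)

text \<open>The symmetries of the unit ball are conjugated by \<open>L\<close> instead of
  transporting the integral to the ball. The conjugated map has determinant 1 or - 1 and preserves
  the ellipsoid, so neither spherical coordinates nor the determinant of \<open>L\<close>
  enter.\<close>

lemma orthogonal_symmetry:
  assumes R: "orthogonal_transformation (R :: real^3 \<Rightarrow> real^3)"
  shows "integral S (\<lambda>\<xi>. ratio j m (L' *v R (L *v \<xi>))) = integral S (ratio j m)"
proof (rule integral_linear_symmetry[OF _ _ _ ratio_absolutely_integrable])
  have lR: "linear R" using R by (rule orthogonal_transformation_linear)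
  have nR: "norm (R p) = norm p" for p using R by (rule orthogonal_transformation_norm)
  show l: "linear (\<lambda>\<xi>. L' *v R (L *v \<xi>))"
    using linear_compose[OF linear_compose[OF matrix_vector_mul_linear[of L] lR] matrix_vector_mul_linear[of L']]
    by (simp add: o_def)
  have "matrix (\<lambda>\<xi>. L' *v R (L *v \<xi>)) = L' ** (matrix R ** L)"
    using matrix_compose[OF linear_compose[OF matrix_vector_mul_linear[of L] lR] matrix_vector_mul_linear[of L']]
      matrix_compose[OF matrix_vector_mul_linear[of L] lR] by (simp add: o_def)
  then have "det (matrix (\<lambda>\<xi>. L' *v R (L *v \<xi>))) = det (matrix R) * (det L' * det L)" by (simp add: det_mul)
  also have "det L' * det L = 1" using arg_cong[OF L'(1), of det] by (simp add: det_mul)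
  finally have "det (matrix (\<lambda>\<xi>. L' *v R (L *v \<xi>))) = det (matrix R)" by simp
  moreover have "\<bar>det (matrix R)\<bar> = 1"
    using R det_orthogonal_matrix unfolding orthogonal_transformation_matrix by fastforce
  ultimately show "\<bar>det (matrix (\<lambda>\<xi>. L' *v R (L *v \<xi>)))\<bar> = 1" by simp
  have into: "L' *v R' (L *v \<xi>) \<in> S" if "\<xi> \<in> S" "orthogonal_transformation R'" for \<xi> and R' :: "real^3 \<Rightarrow> real^3"
  proof -
    have n: "norm (R' p) = norm p" for p using that(2) by (rule orthogonal_transformation_norm)
    have "R' (L *v \<xi>) \<noteq> 0" using invertible_matrix_nonzero[of \<xi>] that(1) n[of "L *v \<xi>"] by (auto simp: S_def)
    then have "L' *v R' (L *v \<xi>) \<noteq> 0" using inverse_matrix_apply(2)[of "R' (L *v \<xi>)"] by auto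
    then show ?thesis using that(1) by (simp add: S_def inverse_matrix_apply n)
  qed
  show "(\<lambda>\<xi>. L' *v R (L *v \<xi>)) ` S = S"
  proof
    show "(\<lambda>\<xi>. L' *v R (L *v \<xi>)) ` S \<subseteq> S" using into[OF _ R] by blast
    show "S \<subseteq> (\<lambda>\<xi>. L' *v R (L *v \<xi>)) ` S"
    proof
      fix \<xi> assume \<xi>: "\<xi> \<in> S"
      have "orthogonal_transformation (inv R)" by (rule orthogonal_transformation_inv[OF R])
      from into[OF \<xi> this] have "L' *v inv R (L *v \<xi>) \<in> S" .
      moreover have "\<xi> = L' *v R (L *v (L' *v inv R (L *v \<xi>)))"
        using surj_f_inv_f[OF orthogonal_transformation_surj[OF R]] by (simp add: inverse_matrix_apply)
      ultimately show "\<xi> \<in> (\<lambda>\<xi>. L' *v R (L *v \<xi>)) ` S" by blast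
    qed
  qed
qed

lemma ratio_off_diagonal:
  assumes "j \<noteq> m"
  shows "integral S (ratio j m) = 0"
proof -
  \<comment> \<open>Reflection in the \<open>j\<close>-th coordinate changes the sign of p_j
    p_m.\<close>
  let ?R = "\<lambda>p::real^3. \<chi> i. if i = j then - p $ i else p $ i"
  have "orthogonal_transformation ?R"
    unfolding orthogonal_transformation_def
    by (auto intro!: linearI simp: vec_eq_iff inner_vec_def intro: sum.cong)
  note R = this
  from orthogonal_symmetry[OF this, of j m]
  have "integral S (\<lambda>\<xi>. ratio j m (L' *v ?R (L *v \<xi>))) = integral S (ratio j m)" .
  moreover have "norm (?R p) = norm p" for p by (rule orthogonal_transformation_norm[OF R])
  then have "ratio j m (L' *v ?R (L *v \<xi>)) = - ratio j m \<xi>" for \<xi>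
    using assms by (simp add: quad_ratio_def inverse_matrix_apply)
  ultimately show ?thesis by simp
qed

lemma ratio_diagonal_eq: "integral S (ratio j j) = integral S (ratio m m)"
proof -
  let ?R = "\<lambda>p::real^3. \<chi> i. p $ Transposition.transpose j m i"
  have s: "(\<Sum>i\<in>UNIV. f (Transposition.transpose j m i)) = (\<Sum>i\<in>UNIV. f i)" for f :: "3 \<Rightarrow> real"
    by (rule sum.reindex_bij_betw[OF bij_transpose])
  have "orthogonal_transformation ?R"
    unfolding orthogonal_transformation_def
    by (auto intro!: linearI simp: vec_eq_iff inner_vec_def s[of "\<lambda>i. _ $ i * _ $ i"])
  note R = this
  from orthogonal_symmetry[OF this, of j j]
  have "integral S (\<lambda>\<xi>. ratio j j (L' *v ?R (L *v \<xi>))) = integral S (ratio j j)" .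
  moreover have "norm (?R p) = norm p" for p by (rule orthogonal_transformation_norm[OF R])
  then have "ratio j j (L' *v ?R (L *v \<xi>)) = ratio m m \<xi>" for \<xi>
    by (simp add: quad_ratio_def inverse_matrix_apply)
  ultimately show ?thesis by simp
qed

text \<open>The three diagonal ratios add up to 1 on \<open>S\<close> and have equal integrals, so
  each accounts for a third of the volume.\<close>

lemma integral_ratio:
  "(LINT \<xi> : S | lborel. ratio j m \<xi>) = (if j = m then measure lborel S / 3 else 0)"
proof -
  have "(\<Sum>i\<in>UNIV. LINT \<xi> : S | lborel. ratio i i \<xi>) = (LINT \<xi> : S | lborel. \<Sum>i\<in>UNIV. ratio i i \<xi>)"
    unfolding set_lebesgue_integral_def scaleR_sum_right
    by (subst Bochner_Integration.integral_sum) (use ratio_set_integrable in \<open>auto simp: set_integrable_def\<close>)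
  also have "\<dots> = (LINT \<xi> : S | lborel. 1)"
  proof (rule set_lebesgue_integral_cong[OF ellipsoid_borel], rule allI, rule impI)
    fix \<xi> assume "\<xi> \<in> S"
    then have n: "norm (L *v \<xi>) \<noteq> 0" using invertible_matrix_nonzero by (simp add: S_def)
    have "(\<Sum>i\<in>UNIV. ratio i i \<xi>) = ((L *v \<xi>) $ 1 ^ 2 + (L *v \<xi>) $ 2 ^ 2 + (L *v \<xi>) $ 3 ^ 2) / (norm (L *v \<xi>))\<^sup>2"
      by (simp add: quad_ratio_def sum_3 power2_eq_square add_divide_distrib)
    then show "(\<Sum>i\<in>UNIV. ratio i i \<xi>) = 1" using n unfolding norm_real3[symmetric] by simp
  qed
  also have "\<dots> = measure lborel S"
    using ellipsoid_borel emeasure_ellipsoid_finite by (simp add: set_lebesgue_integral_def)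
  finally have "(\<Sum>i\<in>UNIV. integral S (ratio i i)) = measure lborel S" unfolding ratio_integral .
  moreover have "(\<Sum>i\<in>UNIV. integral S (ratio i i)) = (\<Sum>i\<in>(UNIV :: 3 set). integral S (ratio j j))"
    by (intro sum.cong refl ratio_diagonal_eq)
  ultimately have "3 * integral S (ratio j j) = measure lborel S" by simp
  then show ?thesis using ratio_off_diagonal unfolding ratio_integral by auto
qed

lemma
  shows set_integrable_ratio_combination: "set_integrable lborel S (\<lambda>\<xi>. \<Sum>j\<in>UNIV. \<Sum>m\<in>UNIV. C j m * ratio j m \<xi>)"
    and integral_ratio_combination: "(LINT \<xi> : S | lborel. \<Sum>j\<in>UNIV. \<Sum>m\<in>UNIV. C j m * ratio j m \<xi>) =
      (\<Sum>j\<in>UNIV. C j j) * (measure lborel S / 3)"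
proof -
  let ?f = "\<lambda>j m \<xi>. C j m * (indicat_real S \<xi> * ratio j m \<xi>)"
  have i: "integrable lborel (?f j m)" for j m
    using ratio_set_integrable[of j m] unfolding set_integrable_def by simp
  have e: "indicat_real S \<xi> *\<^sub>R (\<Sum>j\<in>UNIV. \<Sum>m\<in>UNIV. C j m * ratio j m \<xi>) = (\<Sum>j\<in>UNIV. \<Sum>m\<in>UNIV. ?f j m \<xi>)" for \<xi>
    by (simp add: sum_distrib_left mult.left_commute)
  have i': "integrable lborel (\<lambda>\<xi>. \<Sum>m\<in>UNIV. ?f j m \<xi>)" for j
    by (rule Bochner_Integration.integrable_sum) (rule i)
  show "set_integrable lborel S (\<lambda>\<xi>. \<Sum>j\<in>UNIV. \<Sum>m\<in>UNIV. C j m * ratio j m \<xi>)"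
    unfolding set_integrable_def e by (rule Bochner_Integration.integrable_sum) (rule i')
  have "(LINT \<xi> : S | lborel. \<Sum>j\<in>UNIV. \<Sum>m\<in>UNIV. C j m * ratio j m \<xi>) = (\<Sum>j\<in>UNIV. integral\<^sup>L lborel (\<lambda>\<xi>. \<Sum>m\<in>UNIV. ?f j m \<xi>))"
    unfolding set_lebesgue_integral_def e by (rule Bochner_Integration.integral_sum) (rule i')
  also have "\<dots> = (\<Sum>j\<in>UNIV. \<Sum>m\<in>UNIV. integral\<^sup>L lborel (?f j m))"
    by (intro sum.cong refl Bochner_Integration.integral_sum i)
  also have "\<dots> = (\<Sum>j\<in>UNIV. \<Sum>m\<in>UNIV. C j m * (LINT \<xi> : S | lborel. ratio j m \<xi>))"
    by (simp add: set_lebesgue_integral_def)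
  also have "\<dots> = (\<Sum>j\<in>UNIV. C j j * (measure lborel S / 3))"
    unfolding integral_ratio by (simp add: if_distrib cong: if_cong)
  finally show "(LINT \<xi> : S | lborel. \<Sum>j\<in>UNIV. \<Sum>m\<in>UNIV. C j m * ratio j m \<xi>) =
      (\<Sum>j\<in>UNIV. C j j) * (measure lborel S / 3)" by (simp only: sum_distrib_right)
qed

end

text \<open>With the rows \<open>V\<^sub>j\<close> of \<open>L\<close> as frame, their derivatives \<open>dF \<alpha>\<close> and the inverse matrix \<open>W\<close>,
  \<open>frame_deriv L dF W l k j\<close> is the \<open>j\<close>-th frame component of the derivative of \<open>V\<^sub>k\<close> along \<open>V\<^sub>l\<close>, and
  \<open>axial L dF W\<close> is \<open>\<epsilon>\<^sub>j\<^sub>k\<^sub>l\<close> contracted with it.\<close>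

definition frame_deriv :: "real^3^3 \<Rightarrow> (3 \<Rightarrow> real^3^3) \<Rightarrow> real^3^3 \<Rightarrow> 3 \<Rightarrow> 3 \<Rightarrow> 3 \<Rightarrow> real" where
  "frame_deriv L dF W l k j = (\<Sum>\<alpha>\<in>UNIV. L $ l $ \<alpha> * (dF \<alpha> ** W) $ k $ j)"

definition axial :: "real^3^3 \<Rightarrow> (3 \<Rightarrow> real^3^3) \<Rightarrow> real^3^3 \<Rightarrow> real" where
  "axial L dF W = (let D = frame_deriv L dF W in
     D 3 2 1 - D 2 3 1 + D 1 3 2 - D 3 1 2 + D 2 1 3 - D 1 2 3)"

lemma triple_quadratic:
  "triple p (E *v p) s = (\<Sum>j\<in>UNIV. \<Sum>m\<in>UNIV. triple (axis j 1) (column m E) s * (p $ j * p $ m))"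
  by (simp add: triple_def sum_3 matrix_vector_mult_def column_def axis_def algebra_simps)

text \<open>By \<open>triple_quadratic\<close> the left side is the trace of the quadratic form in
  the integrand of b, the only part of the form that survives averaging.\<close>

lemma axial_trace:
  "(\<Sum>j\<in>UNIV. \<Sum>\<alpha>\<in>UNIV. triple (axis j 1) (column j (dF \<alpha> ** W)) (L *v axis \<alpha> 1)) = axial L dF W"
proof -
  have "(L *v axis \<alpha> 1) $ l = L $ l $ \<alpha>" for l \<alpha>
    by (simp add: matrix_vector_mult_def axis_def if_distrib cong: if_cong)
  then show ?thesis
    by (simp add: triple_def axial_def frame_deriv_def Let_def sum_3 column_def axis_def algebra_simps)
qed

lemma matrix_inv_inverse:
  assumes "invertible A"
  shows "matrix_inv A ** A = mat 1" "A ** matrix_inv A = mat 1"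
  using someI_ex[OF assms[unfolded invertible_def]] unfolding matrix_inv_def by blast+

section \<open>The vanishing of b in terms of the frame\<close>

context elliptic_op
begin

lemma frame_inverse:
  assumes "c \<in> \<A>" "x \<in> coords c"
  shows "matrix_inv (frame c x) ** frame c x = mat 1" "frame c x ** matrix_inv (frame c x) = mat 1"
proof -
  have "inj ((*v) (frame c x))"
    using frame_injective[OF assms] matrix_left_invertible_injective[of "frame c x"]
    by (metis (no_types, lifting) injI matrix_vector_mult_diff_distrib right_minus_eq)
  then have "invertible (frame c x)"
    by (metis invertible_left_inverse matrix_left_invertible_injective)
  then show "matrix_inv (frame c x) ** frame c x = mat 1" "frame c x ** matrix_inv (frame c x) = mat 1"
    by (rule matrix_inv_inverse)+
qed

definition axial_at :: "'a chart \<Rightarrow> real^3 \<Rightarrow> real" where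
  "axial_at c x = axial (frame c x) (\<lambda>\<alpha>. pd \<alpha> (frame c) x) (matrix_inv (frame c x))"

text \<open>Integration gives b = - 3 vol (k - T/4) / (2 pi)^3, where T is
  \<open>axial_at c x\<close> and vol is the positive volume of the ellipsoid h < 1. The quarter is
  3/4 from the integrand times 1/3 from the averaging.\<close>

lemma b_coeff_frame:
  assumes c: "c \<in> \<A>" and x: "x \<in> coords c" and sub: "subprincipal \<A> A c x = mat k"
  shows "b_coeff \<A> A c x = 0 \<longleftrightarrow> k = complex_of_real (axial_at c x / 4)"
proof -
  let ?L = "frame c x" and ?W = "matrix_inv (frame c x)"
  let ?S = "{\<xi>. \<xi> \<noteq> 0 \<and> norm (?L *v \<xi>) < 1}"
  let ?E = "\<lambda>\<alpha>. pd \<alpha> (frame c) x ** ?W"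
  let ?C = "\<lambda>j m. \<Sum>\<alpha>\<in>UNIV. triple (axis j 1) (column m (?E \<alpha>)) (?L *v axis \<alpha> 1)"
  note inv = frame_inverse[OF c x]
  let ?r = "\<lambda>\<xi>. \<Sum>j\<in>UNIV. \<Sum>m\<in>UNIV. ?C j m * quad_ratio ?L j m \<xi>"
  have S: "{\<xi>. \<xi> \<noteq> 0 \<and> hplus \<A> A c x \<xi> < 1} = ?S"
    using hplus_frame[OF c x] by auto
  have bi: "b_integrand \<A> A c x \<xi> = k - complex_of_real (3 / 4 * ?r \<xi>)" if "\<xi> \<in> ?S" for \<xi>
  proof -
    have \<xi>: "\<xi> \<noteq> 0" using that by simp
    define p where "p = ?L *v \<xi>"
    \<comment> \<open>Writing \<xi> through p turns the derivative of p along x into a linear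
      function of p, so the numerator becomes a quadratic form in p alone.\<close>
    have w: "\<xi> = ?W *v p" by (simp add: p_def matrix_vector_mul_assoc inv)
    have p0: "p \<noteq> 0" unfolding p_def by (rule frame_injective[OF c x \<xi>])
    have "(\<Sum>\<alpha>\<in>UNIV. triple p (pd \<alpha> (frame c) x *v \<xi>) (?L *v axis \<alpha> 1)) =
        (\<Sum>\<alpha>\<in>UNIV. triple p (?E \<alpha> *v p) (?L *v axis \<alpha> 1))"
      by (simp add: w matrix_vector_mul_assoc)
    also have "\<dots> = (\<Sum>j\<in>UNIV. \<Sum>m\<in>UNIV. ?C j m * (p $ j * p $ m))"
      unfolding triple_quadratic sum_distrib_right
      by (rule trans[OF sum.swap]) (intro sum.cong refl sum.swap)
    also have "\<dots> = (norm p)\<^sup>2 * ?r \<xi>"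
      unfolding quad_ratio_def p_def[symmetric] sum_distrib_left using p0 by (intro sum.cong refl) simp
    finally have q: "(\<Sum>\<alpha>\<in>UNIV. triple p (pd \<alpha> (frame c) x *v \<xi>) (?L *v axis \<alpha> 1)) = (norm p)\<^sup>2 * ?r \<xi>" .
    show ?thesis
      unfolding b_integrand_frame[OF c x \<xi> sub] p_def[symmetric] q using p0 by simp
  qed
  have Sb: "?S \<in> sets lborel" by (rule ellipsoid_borel[OF inv])
  have fin: "emeasure lborel ?S < \<infinity>" by (rule emeasure_ellipsoid_finite[OF inv])
  have r_int: "set_integrable lborel ?S ?r" by (rule set_integrable_ratio_combination[OF inv])
  have R: "(LINT \<xi> : ?S | lborel. ?r \<xi>) = axial_at c x * (measure lborel ?S / 3)"
    unfolding integral_ratio_combination[OF inv] axial_trace axial_at_def ..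
  have ci: "set_integrable lborel ?S (\<lambda>\<xi>. complex_of_real (3 / 4 * ?r \<xi>))"
  proof -
    have "integrable lborel (\<lambda>\<xi>. complex_of_real (3 / 4 * (indicat_real ?S \<xi> *\<^sub>R ?r \<xi>)))"
      by (rule integrable_of_real, rule integrable_mult_right) (rule r_int[unfolded set_integrable_def])
    moreover have "indicat_real A \<xi> *\<^sub>R complex_of_real (3 / 4 * t) = complex_of_real (3 / 4 * (indicat_real A \<xi> *\<^sub>R t))" for A :: "(real^3) set" and \<xi> t
      by (simp add: scaleR_conv_of_real)
    ultimately show ?thesis unfolding set_integrable_def by (simp only:)
  qed
  have ki: "set_integrable lborel ?S (\<lambda>\<xi>. k)"
    unfolding set_integrable_def using Sb fin by simp
  have "(LINT \<xi> : ?S | lborel. b_integrand \<A> A c x \<xi> / complex_of_real ((2 * pi) ^ 3)) =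
      (LINT \<xi> : ?S | lborel. (k - complex_of_real (3 / 4 * ?r \<xi>)) / complex_of_real ((2 * pi) ^ 3))"
    by (rule set_lebesgue_integral_cong[OF Sb]) (use bi in simp)
  also have "\<dots> = (LINT \<xi> : ?S | lborel. k - complex_of_real (3 / 4 * ?r \<xi>)) / complex_of_real ((2 * pi) ^ 3)"
    by (rule set_integral_divide_zero)
  also have "(LINT \<xi> : ?S | lborel. k - complex_of_real (3 / 4 * ?r \<xi>)) =
      (LINT \<xi> : ?S | lborel. k) - (LINT \<xi> : ?S | lborel. complex_of_real (3 / 4 * ?r \<xi>))"
    by (rule set_integral_diff(2)[OF ki ci])
  also have "(LINT \<xi> : ?S | lborel. k) = measure lborel ?S *\<^sub>R k"
    using Sb fin by (simp add: set_lebesgue_integral_def)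
  also have "(LINT \<xi> : ?S | lborel. complex_of_real (3 / 4 * ?r \<xi>)) = complex_of_real (3 / 4 * (LINT \<xi> : ?S | lborel. ?r \<xi>))"
    unfolding set_integral_complex_of_real by (simp only: set_integral_mult_right)
  finally have I: "(LINT \<xi> : ?S | lborel. b_integrand \<A> A c x \<xi> / complex_of_real ((2 * pi) ^ 3)) =
      complex_of_real (measure lborel ?S) * (k - complex_of_real (axial_at c x / 4)) / complex_of_real ((2 * pi) ^ 3)"
    unfolding R by (simp add: scaleR_conv_of_real algebra_simps)
  have "measure lborel ?S > 0" by (rule measure_ellipsoid_pos[OF inv])
  then show ?thesis unfolding b_coeff_def S I by simp
qed

end

section \<open>The massless Dirac operator in a chart\<close>

lemma pd_nth: "f differentiable (at x) \<Longrightarrow> pd \<alpha> (\<lambda>y. f y $ i) x = pd \<alpha> f x $ i"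
  by (rule pd_bounded_linear[OF bounded_linear_vec_nth])

lemma pd_nth2:
  assumes "f differentiable (at x)"
  shows "pd \<alpha> (\<lambda>y. f y $ i $ j) x = pd \<alpha> f x $ i $ j"
proof -
  have "(\<lambda>y. f y $ i) differentiable (at x)"
    using bounded_linear.has_derivative[OF bounded_linear_vec_nth] assms unfolding differentiable_def by blast
  then show ?thesis by (simp add: pd_nth assms)
qed

definition adjugate3 :: "real^3^3 \<Rightarrow> real^3^3" where
  "adjugate3 m = vector [vector [m$2$2 * m$3$3 - m$2$3 * m$3$2, m$1$3 * m$3$2 - m$1$2 * m$3$3, m$1$2 * m$2$3 - m$1$3 * m$2$2],
     vector [m$2$3 * m$3$1 - m$2$1 * m$3$3, m$1$1 * m$3$3 - m$1$3 * m$3$1, m$1$3 * m$2$1 - m$1$1 * m$2$3],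
     vector [m$2$1 * m$3$2 - m$2$2 * m$3$1, m$1$2 * m$3$1 - m$1$1 * m$3$2, m$1$1 * m$2$2 - m$1$2 * m$2$1]]"

lemma mult_adjugate3: "m ** adjugate3 m = det m *\<^sub>R mat 1"
  by (simp add: adjugate3_def vec_eq_iff forall_3 matrix_matrix_mult_def sum_3 mat_def det_3 algebra_simps)

text \<open>Jacobi's formula. The derivative of the cubic polynomial \<open>det\<close> is the trace
  against the adjugate, which equals det g times the inverse \<open>H\<close>.\<close>

lemma pd_det:
  fixes g :: "real^3 \<Rightarrow> real^3^3"
  assumes g: "g differentiable (at x)" and H: "H ** g x = mat 1"
  shows "(\<lambda>y. det (g y)) differentiable (at x)"
    and "pd \<alpha> (\<lambda>y. det (g y)) x = det (g x) * trace (H ** pd \<alpha> g x)"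
proof -
  let ?G = "\<lambda>h. frechet_derivative g (at x) h"
  have e: "((\<lambda>y. g y $ i $ j) has_derivative (\<lambda>h. ?G h $ i $ j)) (at x)" for i j
    by (intro bounded_linear.has_derivative[OF bounded_linear_vec_nth] pd_has_derivative g)
  let ?m = "g x" and ?adj = "adjugate3 (g x)"
  have "?m ** ?adj = det ?m *\<^sub>R mat 1" by (rule mult_adjugate3)
  then have "(H ** ?m) ** ?adj = H ** (det ?m *\<^sub>R mat 1)" by (simp only: matrix_mul_assoc[symmetric])
  also have "H ** (det ?m *\<^sub>R mat 1) = det ?m *\<^sub>R H"
    by (simp add: vec_eq_iff matrix_matrix_mult_def mat_def if_distrib cong: if_cong)
  finally have adj: "?adj = det ?m *\<^sub>R H" by (simp only: H matrix_mul_lid)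
  have "((\<lambda>y. det (g y)) has_derivative (\<lambda>h. trace (?adj ** ?G h))) (at x)"
    unfolding det_3 adjugate3_def
    by (rule has_derivative_eq_rhs,
        (rule has_derivative_add has_derivative_diff has_derivative_mult e)+)
       (simp add: fun_eq_iff trace_def matrix_matrix_mult_def sum_3 algebra_simps)
  note d = this[unfolded adj]
  show "(\<lambda>y. det (g y)) differentiable (at x)" using d unfolding differentiable_def by blast
  show "pd \<alpha> (\<lambda>y. det (g y)) x = det (g x) * trace (H ** pd \<alpha> g x)"
    unfolding pd_eqI[OF d]
    by (simp add: pd_def trace_def matrix_matrix_mult_def sum_3 algebra_simps)
qed

text \<open>\<open>\<omega> l j k\<close> are the connection coefficients of an orthonormal frame expressed through \<open>D = frame_deriv\<close>.\<close>

lemma spin_connection_contraction: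
  fixes D :: "3 \<Rightarrow> 3 \<Rightarrow> 3 \<Rightarrow> real"
  defines "\<omega> \<equiv> \<lambda>l j k. (D l k j - D l j k - D k l j - D k j l + D j l k + D j k l) / 2"
  shows "(\<Sum>l\<in>UNIV. \<Sum>j\<in>UNIV. \<Sum>k\<in>UNIV. \<omega> l j k *\<^sub>R (pauli l ** (pauli j ** pauli k))) +
      (\<Sum>l\<in>UNIV. (2 * (\<Sum>m\<in>UNIV. D l m m)) *\<^sub>R pauli l) =
    mat (\<i> * complex_of_real (D 3 2 1 - D 2 3 1 + D 1 3 2 - D 3 1 2 + D 2 1 3 - D 1 2 3)) +
    2 *\<^sub>R (\<Sum>k\<in>UNIV. (\<Sum>l\<in>UNIV. D l k l) *\<^sub>R pauli k)"
proof -
  have p: "pauli l ** (pauli j ** pauli k) = (\<chi> a b. \<Sum>c\<in>UNIV. \<Sum>d\<in>UNIV. pauli l $ a $ c * (pauli j $ c $ d * pauli k $ d $ b))" for l j k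
    by (simp add: vec_eq_iff matrix_matrix_mult_def sum_distrib_left)
  have s: "(r *\<^sub>R M) $ a $ b = complex_of_real r * M $ a $ b" for r a b and M :: "complex^2^2"
    by (simp only: vector_scaleR_component) (simp only: scaleR_conv_of_real)
  \<comment> \<open>Behind the entrywise check: the totally antisymmetric part of
    \<open>\<omega>\<close> gives the scalar, as s^1 s^2 s^3 = i. The trace part gives twice the sum
    of \<open>D l k l - D k l l\<close>, and the second sum on the left removes its second
    half.\<close>
  show ?thesis
    unfolding vec_eq_iff forall_2 vector_add_component sum_component s p vec_lambda_beta \<omega>_def
    by (simp add: sum_2 sum_3 pauli_entries mat_def complex_eq_iff field_simps)
qed

lemma bounded_bilinear_real_matrix_matrix_mult:
  "bounded_bilinear (\<lambda>(M::real^'n::finite^'m::finite) (N::real^'l::finite^'n). M ** N)"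
  unfolding bilinear_conv_bounded_bilinear[symmetric] bilinear_def
  by (auto intro!: linearI simp: matrix_matrix_mult_def vec_eq_iff sum_distrib_left distrib_left distrib_right sum.distrib mult_ac)

lemma bounded_linear_transpose: "bounded_linear (transpose :: real^'n::finite^'m::finite \<Rightarrow> real^'m^'n)"
  unfolding linear_conv_bounded_linear[symmetric]
  by (rule linearI) (simp_all add: transpose_def vec_eq_iff)

lemma matrix_inv_eqI:
  fixes M :: "real^'n::finite^'n"
  assumes "H ** M = mat 1"
  shows "matrix_inv M = H"
proof -
  have "M ** H = mat 1" using assms by (simp add: matrix_left_right_inverse)
  moreover then have "invertible M" using assms unfolding invertible_def by blast
  then have "matrix_inv M ** M = mat 1" by (rule matrix_inv_inverse)
  then have "(matrix_inv M ** M) ** H = H" by simp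
  ultimately show ?thesis by (simp add: matrix_mul_assoc[symmetric])
qed

lemma smult_matrix_vector: "z *s (M *v v) = (mat z ** M) *v v" for M :: "complex^2^2"
  by (simp add: vec_eq_iff matrix_vector_mult_def mat_mult_nth sum_distrib_left mult.assoc)

lemma matrix_mult_combination:
  fixes M N :: "'i::finite \<Rightarrow> complex^2^2"
  shows "(\<Sum>j\<in>UNIV. a j *\<^sub>R M j) ** (\<Sum>k\<in>UNIV. b k *\<^sub>R N k) =
    (\<Sum>j\<in>UNIV. \<Sum>k\<in>UNIV. (a j * b k) *\<^sub>R (M j ** N k))"
proof -
  note mm = bounded_bilinear_matrix_matrix_mult
  have "(\<Sum>j\<in>UNIV. a j *\<^sub>R M j) ** (\<Sum>k\<in>UNIV. b k *\<^sub>R N k) =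
      (\<Sum>j\<in>UNIV. (a j *\<^sub>R M j) ** (\<Sum>k\<in>UNIV. b k *\<^sub>R N k))"
    by (rule bounded_bilinear.sum_left[OF mm])
  also have "\<dots> = (\<Sum>j\<in>UNIV. \<Sum>k\<in>UNIV. (a j *\<^sub>R M j) ** (b k *\<^sub>R N k))"
    by (intro sum.cong refl bounded_bilinear.sum_right[OF mm])
  finally show ?thesis
    by (simp add: bounded_bilinear.scaleR_left[OF mm] bounded_bilinear.scaleR_right[OF mm] mult.commute)
qed

text \<open>Pointwise setting common to both implications: the frame may come with a given Dirac
  operator or be read off from the symbol. Orthonormality is required on a neighbourhood because it
  is going to be differentiated.\<close>

locale orthonormal_frame_at =
  fixes F g :: "real^3 \<Rightarrow> real^3^3" and U :: "(real^3) set" and x :: "real^3"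
  assumes U: "open U" "x \<in> U"
    and orth: "\<And>y. y \<in> U \<Longrightarrow> F y ** g y ** transpose (F y) = mat 1"
    and sym: "\<And>y. y \<in> U \<Longrightarrow> transpose (g y) = g y"
    and dF: "F differentiable (at x)" and dg: "g differentiable (at x)"
begin

abbreviation "L \<equiv> F x"
abbreviation "W \<equiv> g x ** transpose L"
abbreviation "H \<equiv> transpose L ** L"
abbreviation "E \<alpha> \<equiv> pd \<alpha> F x ** W"
abbreviation "V \<equiv> \<lambda>j y. F y $ j"
abbreviation "D \<equiv> frame_deriv L (\<lambda>\<alpha>. pd \<alpha> F x) W"

lemma LW: "L ** W = mat 1"
  using orth[OF U(2)] by (simp add: matrix_mul_assoc)

lemma WL: "W ** L = mat 1"
  using LW matrix_left_right_inverse[of L W] by blast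

lemma H_inverse: "H ** g x = mat 1"
proof -
  have "transpose L ** (L ** g x) = mat 1"
    using orth[OF U(2)] by (simp add: matrix_left_right_inverse)
  then show ?thesis by (simp add: matrix_mul_assoc)
qed

lemma transpose_W_H: "transpose W ** H = L"
proof -
  have "transpose W = L ** g x" by (simp add: matrix_transpose_mul sym[OF U(2)])
  then show ?thesis
    using orth[OF U(2)] by (simp add: matrix_mul_assoc)
qed

text \<open>Obtained by differentiating the orthonormality relation. It expresses the derivatives of
  the metric through those of the frame, so that the Christoffel symbols too can be written in terms
  of \<open>D\<close>.\<close>

lemma metric_compatible:
  "(L ** pd \<alpha> g x ** transpose L) $ j $ k = - (E \<alpha> $ j $ k + E \<alpha> $ k $ j)"
proof -
  note bb = bounded_bilinear_real_matrix_matrix_mult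
  have dt: "(\<lambda>y. transpose (F y)) differentiable (at x)"
    using bounded_linear.has_derivative[OF bounded_linear_transpose] dF unfolding differentiable_def by blast
  have dFg: "(\<lambda>y. F y ** g y) differentiable (at x)"
    using bounded_bilinear.FDERIV[OF bb] dF dg unfolding differentiable_def by blast
  have dd: "(\<lambda>y. F y ** g y ** transpose (F y)) differentiable (at x)"
    using bounded_bilinear.FDERIV[OF bb] dFg dt unfolding differentiable_def by blast
  have "pd \<alpha> (\<lambda>y. F y ** g y ** transpose (F y)) x = pd \<alpha> (\<lambda>y. mat 1) x"
    by (rule pd_cong_open[OF U orth dd])
  then have z: "L ** g x ** transpose (pd \<alpha> F x) + (L ** pd \<alpha> g x + pd \<alpha> F x ** g x) ** transpose L = 0"
    unfolding pd_bilinear[OF bb dFg dt] pd_bilinear[OF bb dF dg] pd_bounded_linear[OF bounded_linear_transpose dF]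
    by (simp add: pd_def)
  have "transpose (E \<alpha>) = L ** g x ** transpose (pd \<alpha> F x)"
    by (simp add: matrix_transpose_mul sym[OF U(2)] matrix_mul_assoc)
  with z have "transpose (E \<alpha>) + (L ** pd \<alpha> g x ** transpose L + E \<alpha>) = 0"
    by (simp add: bounded_bilinear.add_left[OF bb] matrix_mul_assoc)
  then have "(transpose (E \<alpha>) + (L ** pd \<alpha> g x ** transpose L + E \<alpha>)) $ j $ k = 0" by simp
  then show ?thesis by (simp add: transpose_def)
qed

lemma conj_nth: "(L ** M ** transpose L) $ j $ k = (\<Sum>\<delta>\<in>UNIV. \<Sum>\<gamma>\<in>UNIV. L $ j $ \<delta> * L $ k $ \<gamma> * M $ \<delta> $ \<gamma>)"
  by (simp add: matrix_matrix_mult_def transpose_def sum_3 algebra_simps)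

lemma metric_deriv_frame:
  "(\<Sum>\<alpha>\<in>UNIV. L $ l $ \<alpha> * (L ** pd \<alpha> g x ** transpose L) $ j $ k) = - (D l j k + D l k j)"
  unfolding metric_compatible frame_deriv_def by (simp add: sum.distrib[symmetric] sum_negf[symmetric] algebra_simps)

text \<open>The Christoffel symbol of the first kind, with \<delta> the lowered index.\<close>

definition "lower_christoffel \<delta> \<alpha> \<gamma> =
  (pd \<alpha> g x $ \<gamma> $ \<delta> + pd \<gamma> g x $ \<alpha> $ \<delta> - pd \<delta> g x $ \<alpha> $ \<gamma>) / 2"

lemma christoffel_eq: "christoffel g \<beta> \<alpha> \<gamma> x = (\<Sum>\<delta>\<in>UNIV. H $ \<beta> $ \<delta> * lower_christoffel \<delta> \<alpha> \<gamma>)"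
  unfolding christoffel_def matrix_inv_eqI[OF H_inverse] pd_nth2[OF dg] lower_christoffel_def
  by (simp add: sum_divide_distrib[symmetric])

text \<open>\<open>W\<close> lowers the index that the inverse metric \<open>H\<close> has raised,
  so the inverse metric disappears from the computation.\<close>

lemma W_christoffel:
  "(\<Sum>\<beta>\<in>UNIV. W $ \<beta> $ j * christoffel g \<beta> \<alpha> \<gamma> x) = (\<Sum>\<delta>\<in>UNIV. L $ j $ \<delta> * lower_christoffel \<delta> \<alpha> \<gamma>)"
proof -
  have "(\<Sum>\<beta>\<in>UNIV. W $ \<beta> $ j * christoffel g \<beta> \<alpha> \<gamma> x) =
      (\<Sum>\<delta>\<in>UNIV. (\<Sum>\<beta>\<in>UNIV. W $ \<beta> $ j * H $ \<beta> $ \<delta>) * lower_christoffel \<delta> \<alpha> \<gamma>)"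
    unfolding christoffel_eq sum_distrib_left sum_distrib_right mult.assoc by (rule sum.swap)
  moreover have "(\<Sum>\<beta>\<in>UNIV. W $ \<beta> $ j * H $ \<beta> $ \<delta>) = L $ j $ \<delta>" for \<delta>
  proof -
    have "(transpose W ** H) $ j $ \<delta> = (\<Sum>\<beta>\<in>UNIV. W $ \<beta> $ j * H $ \<beta> $ \<delta>)"
      unfolding matrix_matrix_mult_def[of "transpose W"] by (simp add: transpose_def[of W])
    then show ?thesis unfolding transpose_W_H by (rule HOL.sym)
  qed
  ultimately show ?thesis by (simp only:)
qed

text \<open>With \<nabla> the Levi-Civita connection, this is the inner product of V_j with the
  derivative \<nabla>_\<alpha> V_k.\<close>

definition "connection \<alpha> j k = E \<alpha> $ k $ j + (\<Sum>\<gamma>\<in>UNIV. L $ k $ \<gamma> * (\<Sum>\<delta>\<in>UNIV. L $ j $ \<delta> * lower_christoffel \<delta> \<alpha> \<gamma>))"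

text \<open>Koszul's formula for an orthonormal frame; the component of the commutator of V_l and
  V_k along V_j is \<open>D l k j - D k l j\<close>.\<close>

lemma connection_frame:
  "(\<Sum>\<alpha>\<in>UNIV. L $ l $ \<alpha> * connection \<alpha> j k) =
     (D l k j - D l j k - D k l j - D k j l + D j l k + D j k l) / 2"
proof -
  let ?K = "\<lambda>l j k. \<Sum>\<alpha>\<in>UNIV. L $ l $ \<alpha> * (L ** pd \<alpha> g x ** transpose L) $ j $ k"
  have "(\<Sum>\<alpha>\<in>UNIV. L $ l $ \<alpha> * connection \<alpha> j k) = D l k j + (?K l k j + ?K k l j - ?K j l k) / 2"
    unfolding connection_def lower_christoffel_def conj_nth frame_deriv_def
    by (simp add: sum_3 field_simps)
  then show ?thesis unfolding metric_deriv_frame by (simp add: field_simps)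
qed

lemma sigma_up_eq: "sigma_up V \<alpha> y = (\<Sum>j\<in>UNIV. (F y $ j $ \<alpha>) *\<^sub>R pauli j)"
  by (simp add: sigma_up_def)

lemma pd_sigma_up: "pd \<alpha> (sigma_up V \<beta>) x = (\<Sum>k\<in>UNIV. (pd \<alpha> F x $ k $ \<beta>) *\<^sub>R pauli k)"
proof -
  have "bounded_linear (\<lambda>M::real^3^3. \<Sum>j\<in>UNIV. (M $ j $ \<beta>) *\<^sub>R pauli j)"
    unfolding linear_conv_bounded_linear[symmetric]
    by (rule linearI) (simp_all add: scaleR_left_distrib sum.distrib scaleR_sum_right)
  from pd_bounded_linear[OF this dF] show ?thesis unfolding sigma_up_def[abs_def] .
qed

lemma sigma_down_eq: "sigma_down g V \<beta> x = (\<Sum>j\<in>UNIV. (W $ \<beta> $ j) *\<^sub>R pauli j)"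
  unfolding sigma_down_def sigma_up_eq scaleR_sum_right
  by (subst sum.swap) (simp add: matrix_matrix_mult_def transpose_def scaleR_sum_left)

definition "spin \<alpha> = (\<Sum>\<beta>\<in>UNIV. sigma_down g V \<beta> x **
    (pd \<alpha> (sigma_up V \<beta>) x + (\<Sum>\<gamma>\<in>UNIV. christoffel g \<beta> \<alpha> \<gamma> x *\<^sub>R sigma_up V \<gamma> x)))"

lemma spin_eq: "spin \<alpha> = (\<Sum>j\<in>UNIV. \<Sum>k\<in>UNIV. connection \<alpha> j k *\<^sub>R (pauli j ** pauli k))"
proof -
  let ?N = "\<lambda>\<beta> k. pd \<alpha> F x $ k $ \<beta> + (\<Sum>\<gamma>\<in>UNIV. christoffel g \<beta> \<alpha> \<gamma> x * L $ k $ \<gamma>)"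
  have N: "pd \<alpha> (sigma_up V \<beta>) x + (\<Sum>\<gamma>\<in>UNIV. christoffel g \<beta> \<alpha> \<gamma> x *\<^sub>R sigma_up V \<gamma> x) =
      (\<Sum>k\<in>UNIV. ?N \<beta> k *\<^sub>R pauli k)" for \<beta>
  proof -
    have "(\<Sum>\<gamma>\<in>UNIV. christoffel g \<beta> \<alpha> \<gamma> x *\<^sub>R sigma_up V \<gamma> x) =
        (\<Sum>k\<in>UNIV. (\<Sum>\<gamma>\<in>UNIV. christoffel g \<beta> \<alpha> \<gamma> x * L $ k $ \<gamma>) *\<^sub>R pauli k)"
      unfolding sigma_up_eq scaleR_sum_right scaleR_scaleR scaleR_sum_left by (rule sum.swap)
    then show ?thesis unfolding pd_sigma_up by (simp add: scaleR_left_distrib sum.distrib)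
  qed
  have "spin \<alpha> = (\<Sum>\<beta>\<in>UNIV. \<Sum>j\<in>UNIV. \<Sum>k\<in>UNIV. (W $ \<beta> $ j * ?N \<beta> k) *\<^sub>R (pauli j ** pauli k))"
    unfolding spin_def N sigma_down_eq by (intro sum.cong refl matrix_mult_combination)
  also have "\<dots> = (\<Sum>j\<in>UNIV. \<Sum>k\<in>UNIV. (\<Sum>\<beta>\<in>UNIV. W $ \<beta> $ j * ?N \<beta> k) *\<^sub>R (pauli j ** pauli k))"
    unfolding scaleR_sum_left by (rule trans[OF sum.swap]) (intro sum.cong refl sum.swap)
  finally have "spin \<alpha> = (\<Sum>j\<in>UNIV. \<Sum>k\<in>UNIV. (\<Sum>\<beta>\<in>UNIV. W $ \<beta> $ j * ?N \<beta> k) *\<^sub>R (pauli j ** pauli k))" .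
  moreover have "(\<Sum>\<beta>\<in>UNIV. W $ \<beta> $ j * ?N \<beta> k) = connection \<alpha> j k" for j k
  proof -
    have "(\<Sum>\<beta>\<in>UNIV. W $ \<beta> $ j * ?N \<beta> k) = (\<Sum>\<beta>\<in>UNIV. pd \<alpha> F x $ k $ \<beta> * W $ \<beta> $ j) +
        (\<Sum>\<beta>\<in>UNIV. \<Sum>\<gamma>\<in>UNIV. L $ k $ \<gamma> * (W $ \<beta> $ j * christoffel g \<beta> \<alpha> \<gamma> x))"
      by (simp add: distrib_left sum.distrib sum_distrib_left mult_ac)
    also have "(\<Sum>\<beta>\<in>UNIV. \<Sum>\<gamma>\<in>UNIV. L $ k $ \<gamma> * (W $ \<beta> $ j * christoffel g \<beta> \<alpha> \<gamma> x)) =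
        (\<Sum>\<gamma>\<in>UNIV. L $ k $ \<gamma> * (\<Sum>\<beta>\<in>UNIV. W $ \<beta> $ j * christoffel g \<beta> \<alpha> \<gamma> x))"
      unfolding sum_distrib_left by (rule sum.swap)
    also have "(\<Sum>\<beta>\<in>UNIV. pd \<alpha> F x $ k $ \<beta> * W $ \<beta> $ j) = E \<alpha> $ k $ j"
      by (simp add: matrix_matrix_mult_def[of "pd \<alpha> F x"])
    finally show ?thesis unfolding connection_def W_christoffel .
  qed
  ultimately show ?thesis by (simp only:)
qed

text \<open>By \<open>pd_det\<close> this is the derivative of the logarithm of det g.\<close>

definition "log_det_deriv \<alpha> = trace (H ** pd \<alpha> g x)"

lemma log_det_deriv_eq: "log_det_deriv \<alpha> = - 2 * (\<Sum>m\<in>UNIV. E \<alpha> $ m $ m)"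
proof -
  have "log_det_deriv \<alpha> = trace (L ** pd \<alpha> g x ** transpose L)"
    unfolding log_det_deriv_def by (metis matrix_mul_assoc trace_mul_sym)
  then show ?thesis unfolding trace_def metric_compatible by (simp add: sum_distrib_left)
qed

text \<open>The mixed derivative (A_1)_{x^\<alpha> \<xi>_\<alpha>} of the principal symbol belonging
  to the frame, that is, the correction term in the subprincipal symbol before the factor
  i/2.\<close>

definition "div_matrix = (\<Sum>k\<in>UNIV. (\<Sum>\<alpha>\<in>UNIV. pd \<alpha> F x $ k $ \<alpha>) *\<^sub>R pauli k)"

lemma frame_divergence: "(\<Sum>l\<in>UNIV. D l k l) = (\<Sum>\<alpha>\<in>UNIV. pd \<alpha> F x $ k $ \<alpha>)"
proof -
  have "(\<Sum>l\<in>UNIV. D l k l) = (\<Sum>\<alpha>\<in>UNIV. (E \<alpha> ** L) $ k $ \<alpha>)"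
    unfolding frame_deriv_def matrix_matrix_mult_def[of "E _"]
    by (subst sum.swap) (simp add: mult.commute)
  moreover have "E \<alpha> ** L = pd \<alpha> F x" for \<alpha>
    by (subst matrix_mul_assoc[symmetric]) (simp only: WL matrix_mul_rid)
  ultimately show ?thesis by (simp only:)
qed

lemma spin_contraction:
  "(\<Sum>\<alpha>\<in>UNIV. sigma_up V \<alpha> x ** spin \<alpha> - log_det_deriv \<alpha> *\<^sub>R sigma_up V \<alpha> x) =
    mat (\<i> * complex_of_real (axial L (\<lambda>\<alpha>. pd \<alpha> F x) W)) + 2 *\<^sub>R div_matrix"
proof -
  have "sigma_up V \<alpha> x ** spin \<alpha> = (\<Sum>l\<in>UNIV. \<Sum>j\<in>UNIV. \<Sum>k\<in>UNIV.
      (L $ l $ \<alpha> * connection \<alpha> j k) *\<^sub>R (pauli l ** (pauli j ** pauli k)))" for \<alpha>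
  proof -
    note mm = bounded_bilinear_matrix_matrix_mult
    have "sigma_up V \<alpha> x ** spin \<alpha> = (\<Sum>l\<in>UNIV. (L $ l $ \<alpha>) *\<^sub>R (pauli l ** spin \<alpha>))"
      unfolding sigma_up_eq by (simp only: bounded_bilinear.sum_left[OF mm] bounded_bilinear.scaleR_left[OF mm])
    also have "\<dots> = (\<Sum>l\<in>UNIV. (L $ l $ \<alpha>) *\<^sub>R (\<Sum>j\<in>UNIV. \<Sum>k\<in>UNIV. connection \<alpha> j k *\<^sub>R (pauli l ** (pauli j ** pauli k))))"
      unfolding spin_eq by (simp only: bounded_bilinear.sum_right[OF mm] bounded_bilinear.scaleR_right[OF mm])
    finally show ?thesis by (simp only: scaleR_sum_right scaleR_scaleR)
  qed
  then have "(\<Sum>\<alpha>\<in>UNIV. sigma_up V \<alpha> x ** spin \<alpha>) =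
      (\<Sum>\<alpha>\<in>UNIV. \<Sum>l\<in>UNIV. \<Sum>j\<in>UNIV. \<Sum>k\<in>UNIV. (L $ l $ \<alpha> * connection \<alpha> j k) *\<^sub>R (pauli l ** (pauli j ** pauli k)))"
    by (simp only:)
  also have "\<dots> = (\<Sum>l\<in>UNIV. \<Sum>j\<in>UNIV. \<Sum>k\<in>UNIV. (\<Sum>\<alpha>\<in>UNIV. L $ l $ \<alpha> * connection \<alpha> j k) *\<^sub>R (pauli l ** (pauli j ** pauli k)))"
    unfolding scaleR_sum_left
    by (rule trans[OF sum.swap], rule sum.cong[OF refl], rule trans[OF sum.swap], rule sum.cong[OF refl], rule sum.swap)
  finally have 1: "(\<Sum>\<alpha>\<in>UNIV. sigma_up V \<alpha> x ** spin \<alpha>) = (\<Sum>l\<in>UNIV. \<Sum>j\<in>UNIV. \<Sum>k\<in>UNIV.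
      ((D l k j - D l j k - D k l j - D k j l + D j l k + D j k l) / 2) *\<^sub>R (pauli l ** (pauli j ** pauli k)))"
    unfolding connection_frame .
  have "(\<Sum>\<alpha>\<in>UNIV. log_det_deriv \<alpha> *\<^sub>R sigma_up V \<alpha> x) =
      (\<Sum>l\<in>UNIV. (\<Sum>\<alpha>\<in>UNIV. log_det_deriv \<alpha> * L $ l $ \<alpha>) *\<^sub>R pauli l)"
    unfolding sigma_up_eq scaleR_sum_right scaleR_scaleR scaleR_sum_left by (rule sum.swap)
  moreover have "(\<Sum>\<alpha>\<in>UNIV. log_det_deriv \<alpha> * L $ l $ \<alpha>) = - (2 * (\<Sum>m\<in>UNIV. D l m m))" for l
  proof -
    have "(\<Sum>m\<in>UNIV. D l m m) = (\<Sum>\<alpha>\<in>UNIV. L $ l $ \<alpha> * (\<Sum>m\<in>UNIV. E \<alpha> $ m $ m))"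
      unfolding frame_deriv_def sum_distrib_left by (rule sum.swap)
    then show ?thesis unfolding log_det_deriv_eq by (simp add: sum_distrib_left sum_negf[symmetric] mult_ac)
  qed
  ultimately have 2: "(\<Sum>\<alpha>\<in>UNIV. log_det_deriv \<alpha> *\<^sub>R sigma_up V \<alpha> x) = - (\<Sum>l\<in>UNIV. (2 * (\<Sum>m\<in>UNIV. D l m m)) *\<^sub>R pauli l)"
    by (simp add: sum_negf)
  show ?thesis
    unfolding sum_subtractf 1 2 diff_minus_eq_add spin_connection_contraction axial_def Let_def frame_divergence div_matrix_def ..
qed

lemma det_pos: "det (g x) > 0"
proof -
  have "det L * det (g x) * det L = 1"
    using arg_cong[OF orth[OF U(2)], of det] by (simp add: det_mul)
  then have "det (g x) * (det L)\<^sup>2 = 1" by (simp add: power2_eq_square mult_ac)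
  then show ?thesis by (metis zero_less_mult_pos2 zero_less_one zero_less_power2 mult_zero_right power_zero_numeral)
qed

text \<open>The half-density conjugation turns the logarithmic derivative of \<open>det g\<close> into the term that cancels the
  trace of the spin connection.\<close>

lemma dirac_W_half_eq:
  assumes u: "u differentiable (at x)"
  shows "dirac_W_half g V u x =
    (\<Sum>\<alpha>\<in>UNIV. (mat (- \<i>) ** sigma_up V \<alpha> x) *v pd \<alpha> u x) +
    (mat (complex_of_real (axial L (\<lambda>\<alpha>. pd \<alpha> F x) W / 4)) - mat (\<i> / 2) ** div_matrix) *v u x"
proof -
  note mv = bounded_bilinear_matrix_vector_mult and mm = bounded_bilinear_matrix_matrix_mult
  let ?\<delta> = "\<lambda>y. det (g y) powr (- 1/4)" and ?d = "det (g x)"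
  let ?S = "\<lambda>\<alpha>. sigma_up V \<alpha> x"
  note dd = pd_det[OF dg H_inverse]
  have d\<delta>: "(?\<delta> has_derivative (\<lambda>h. (- 1/4 * (?d powr (- 1/4 - 1))) * frechet_derivative (\<lambda>y. det (g y)) (at x) h)) (at x)"
  proof -
    have "((\<lambda>t. t powr (- 1/4)) has_derivative (\<lambda>h. (- 1/4 * (?d powr (- 1/4 - 1))) * h)) (at ?d)"
      using has_real_derivative_powr[OF det_pos, of "- 1/4"] unfolding has_field_derivative_def .
    from has_derivative_compose[OF pd_has_derivative[OF dd(1)] this] show ?thesis .
  qed
  have p\<delta>: "pd \<alpha> ?\<delta> x = - 1/4 * ?\<delta> x * log_det_deriv \<alpha>" for \<alpha>
  proof -
    have "pd \<alpha> ?\<delta> x = - 1/4 * (?d powr (- 1/4 - 1)) * (?d * log_det_deriv \<alpha>)"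
      using pd_eqI[OF d\<delta>] dd(2) unfolding log_det_deriv_def pd_def by simp
    moreover have "?d powr (- 1/4 - 1) * ?d = ?\<delta> x"
      using det_pos powr_add[of ?d "- 1/4 - 1" 1] by simp
    ultimately show ?thesis by (metis (no_types, lifting) mult.assoc)
  qed
  have \<delta>diff: "?\<delta> differentiable (at x)" using d\<delta> unfolding differentiable_def by blast
  have pw: "pd \<alpha> (\<lambda>y. ?\<delta> y *\<^sub>R u y) x = ?\<delta> x *\<^sub>R (pd \<alpha> u x - (log_det_deriv \<alpha> / 4) *\<^sub>R u x)" for \<alpha>
    unfolding pd_bilinear[OF bounded_bilinear_scaleR \<delta>diff u] p\<delta> by (simp add: scaleR_diff_right mult.commute)
  have one: "?d powr (1/4) * ?\<delta> x = 1" using det_pos by (simp add: powr_add[symmetric])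
  \<comment> \<open>The exponent - 1/4 of det g matches the factor 1/4 of the spin connection, so
    both contributions combine into the matrix evaluated in \<open>spin_contraction\<close>.\<close>
  have t: "?S \<alpha> *v (pd \<alpha> (\<lambda>y. ?\<delta> y *\<^sub>R u y) x + ((1/4) *\<^sub>R spin \<alpha>) *v (?\<delta> x *\<^sub>R u x)) =
      ?\<delta> x *\<^sub>R (?S \<alpha> *v pd \<alpha> u x + (1/4) *\<^sub>R ((?S \<alpha> ** spin \<alpha> - log_det_deriv \<alpha> *\<^sub>R ?S \<alpha>) *v u x))" for \<alpha>
    unfolding pw
    by (simp add: bounded_bilinear.add_right[OF mv] bounded_bilinear.diff_right[OF mv] bounded_bilinear.diff_left[OF mv]
        matrix_vector_mult_scaleR_right matrix_vector_mult_scaleR_left scaleR_add_right scaleR_diff_right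
        matrix_vector_mul_assoc)
  have "dirac_W_half g V u x = ?d powr (1/4) *\<^sub>R ((- \<i>) *s (\<Sum>\<alpha>\<in>UNIV. ?\<delta> x *\<^sub>R (?S \<alpha> *v pd \<alpha> u x +
      (1/4) *\<^sub>R ((?S \<alpha> ** spin \<alpha> - log_det_deriv \<alpha> *\<^sub>R ?S \<alpha>) *v u x))))"
    unfolding dirac_W_half_def dirac_W_def spin_def[symmetric] t ..
  also have "\<dots> = (- \<i>) *s (\<Sum>\<alpha>\<in>UNIV. ?S \<alpha> *v pd \<alpha> u x +
      (1/4) *\<^sub>R ((?S \<alpha> ** spin \<alpha> - log_det_deriv \<alpha> *\<^sub>R ?S \<alpha>) *v u x))"
  proof -
    have "r *\<^sub>R (z *s (\<Sum>\<alpha>\<in>UNIV. s *\<^sub>R f \<alpha>)) = z *s (\<Sum>\<alpha>\<in>UNIV. f \<alpha>)" if "r * s = 1" for r s z and f :: "3 \<Rightarrow> complex^2"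
    proof -
      have "r *\<^sub>R (z *s (\<Sum>\<alpha>\<in>UNIV. s *\<^sub>R f \<alpha>)) = (r * s) *\<^sub>R (z *s (\<Sum>\<alpha>\<in>UNIV. f \<alpha>))"
        by (simp add: vec_eq_iff scaleR_sum_right[symmetric])
      then show ?thesis using that by simp
    qed
    from this[OF one] show ?thesis .
  qed
  also have "\<dots> = (- \<i>) *s (\<Sum>\<alpha>\<in>UNIV. ?S \<alpha> *v pd \<alpha> u x) +
      (- \<i>) *s (((1/4) *\<^sub>R (\<Sum>\<alpha>\<in>UNIV. ?S \<alpha> ** spin \<alpha> - log_det_deriv \<alpha> *\<^sub>R ?S \<alpha>)) *v u x)"
    by (simp only: sum.distrib vector_add_ldistrib scaleR_sum_right[symmetric] bounded_bilinear.sum_left[OF mv, symmetric]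
        matrix_vector_mult_scaleR_left)
  also have "(- \<i>) *s (\<Sum>\<alpha>\<in>UNIV. ?S \<alpha> *v pd \<alpha> u x) = (\<Sum>\<alpha>\<in>UNIV. (mat (- \<i>) ** ?S \<alpha>) *v pd \<alpha> u x)"
    by (simp only: vec.scale_sum_right smult_matrix_vector)
  also have "(- \<i>) *s (((1/4) *\<^sub>R (\<Sum>\<alpha>\<in>UNIV. ?S \<alpha> ** spin \<alpha> - log_det_deriv \<alpha> *\<^sub>R ?S \<alpha>)) *v u x) =
      (mat (complex_of_real (axial L (\<lambda>\<alpha>. pd \<alpha> F x) W / 4)) - mat (\<i> / 2) ** div_matrix) *v u x"
  proof -
    have s: "(r *\<^sub>R M) $ a $ b = complex_of_real r * M $ a $ b" for r a b and M :: "complex^2^2"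
      by (simp only: vector_scaleR_component) (simp only: scaleR_conv_of_real)
    \<comment> \<open>This is - (i/4) (i T + 2 M) = T/4 - (i/2) M; the second term is exactly what
      the definition of the subprincipal symbol adds back.\<close>
    have "mat (- \<i>) ** ((1/4) *\<^sub>R (mat (\<i> * complex_of_real T) + 2 *\<^sub>R M)) = mat (complex_of_real (T / 4)) - mat (\<i> / 2) ** M"
      for T and M :: "complex^2^2"
      unfolding vec_eq_iff forall_2 mat_mult_nth s vector_add_component vector_minus_component
      by (simp add: mat_def field_simps)
    then show ?thesis unfolding smult_matrix_vector spin_contraction by (simp only:)
  qed
  finally show ?thesis .
qed

end

section \<open>Comparison of the symbols\<close>

lemma pauli_vec_column: "pauli_vec (M *v axis \<alpha> 1) = (\<Sum>k\<in>UNIV. (M $ k $ \<alpha>) *\<^sub>R pauli k)"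
proof -
  have "(M *v axis \<alpha> 1) $ k = M $ k $ \<alpha>" for k
    by (simp add: matrix_vector_mult_def axis_def if_distrib cong: if_cong)
  then show ?thesis by (simp add: pauli_vec_def)
qed

lemma pauli_vec_inject:
  assumes "pauli_vec p = pauli_vec q"
  shows "p = q"
proof -
  have "pauli_vec p $ 1 $ 1 = pauli_vec q $ 1 $ 1" "pauli_vec p $ 2 $ 1 = pauli_vec q $ 2 $ 1" using assms by simp_all
  then show ?thesis unfolding pauli_vec_entries vec_eq_iff forall_3 by (simp add: complex_eq_iff)
qed

lemma mat_i_inverse: "mat \<i> ** M = N \<longleftrightarrow> M = mat (- \<i>) ** N" for M N :: "complex^2^2"
proof
  assume "mat \<i> ** M = N"
  then show "M = mat (- \<i>) ** N" by (simp add: vec_eq_iff mat_mult_nth) (metis (no_types) mat_mult_nth mult_minus_left i_squared mult.assoc mult_1 minus_minus)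
next
  assume "M = mat (- \<i>) ** N"
  then show "mat \<i> ** M = N" by (simp add: vec_eq_iff mat_mult_nth)
qed

lemma smooth_on_matrix_inv:
  fixes M :: "'a::euclidean_space \<Rightarrow> real^3^3"
  assumes S: "open S" and M: "smooth_on S M" and inv: "\<And>x. x \<in> S \<Longrightarrow> invertible (M x)"
  shows "smooth_on S (\<lambda>x. matrix_inv (M x))"
proof -
  have e: "smooth_on S (\<lambda>x. M x $ i $ j)" for i j by (intro smooth_on_nth[OF S] M)
  have d: "smooth_on S (\<lambda>x. det (M x))"
    unfolding det_3 by (intro smooth_on_add[OF S] smooth_on_diff[OF S] smooth_on_mult[OF S] e)
  have d0: "det (M x) \<noteq> 0" if "x \<in> S" for x using inv[OF that] by (simp add: invertible_det_nz)
  have "smooth_on S (\<lambda>x. adjugate3 (M x) $ i $ j)" for i j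
    unfolding adjugate3_def
    using exhaust_3[of i] exhaust_3[of j]
    by (elim disjE; hypsubst; simp only: vector_3; intro smooth_on_diff[OF S] smooth_on_mult[OF S] e)
  then have "smooth_on S (\<lambda>x. \<chi> i. \<chi> j. inverse (det (M x)) * adjugate3 (M x) $ i $ j)"
    by (intro smooth_on_vec_lambda[OF S] smooth_on_mult[OF S] smooth_on_inverse[OF S d d0])
  then show ?thesis
  proof (rule smooth_on_cong[OF S, rotated])
    fix x assume x: "x \<in> S"
    have "M x ** (inverse (det (M x)) *\<^sub>R adjugate3 (M x)) = mat 1"
      using d0[OF x] by (simp add: bounded_bilinear.scaleR_right[OF bounded_bilinear_real_matrix_matrix_mult] mult_adjugate3)
    then have "(inverse (det (M x)) *\<^sub>R adjugate3 (M x)) ** M x = mat 1" by (simp add: matrix_left_right_inverse)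
    from matrix_inv_eqI[OF this]
    show "(\<chi> i j. inverse (det (M x)) * adjugate3 (M x) $ i $ j) = matrix_inv (M x)"
      by (simp add: vec_eq_iff)
  qed
qed

context elliptic_op
begin

text \<open>Identifies the correction to the zeroth order coefficient as i/2 times the coordinate
  divergence of the frame, in the form in which it appears with opposite sign in
  \<open>dirac_W_half_eq\<close>.\<close>

lemma subprincipal_frame:
  assumes c: "c \<in> \<A>" and x: "x \<in> coords c"
  shows "subprincipal \<A> A c x = Q c x + mat (\<i> / 2) **
    (\<Sum>k\<in>UNIV. (\<Sum>\<alpha>\<in>UNIV. pd \<alpha> (frame c) x $ k $ \<alpha>) *\<^sub>R pauli k)"
proof -
  have dF: "frame c differentiable (at x)" by (rule smooth_on_differentiable[OF smooth_frame[OF c] x])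
  let ?f = "\<lambda>\<alpha> M. pauli_vec (M *v axis \<alpha> 1)"
  have bl: "bounded_linear (?f \<alpha>)" for \<alpha>
    by (rule bounded_linear_compose[OF bounded_linear_pauli_vec
          bounded_bilinear.bounded_linear_left[OF bounded_bilinear_real_matrix_vector_mult]])
  have "pd \<alpha> (\<lambda>y. pd \<alpha> (\<lambda>\<xi>. sym1 \<A> A c y \<xi>) 0) x = (\<Sum>k\<in>UNIV. (pd \<alpha> (frame c) x $ k $ \<alpha>) *\<^sub>R pauli k)" for \<alpha>
  proof -
    have s: "pd \<alpha> (\<lambda>\<xi>. sym1 \<A> A c y \<xi>) 0 = ?f \<alpha> (frame c y)" if "y \<in> coords c" for y
    proof -
      have "bounded_linear (\<lambda>\<xi>. pauli_vec (frame c y *v \<xi>))"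
        by (rule bounded_linear_compose[OF bounded_linear_pauli_vec matrix_vector_mul_bounded_linear])
      from pd_eqI[OF bounded_linear_imp_has_derivative[OF this]] show ?thesis
        unfolding sym1_frame[OF c that] .
    qed
    have d: "(\<lambda>y. ?f \<alpha> (frame c y)) differentiable (at x)"
      using bounded_linear.has_derivative[OF bl] dF unfolding differentiable_def by blast
    have "pd \<alpha> (\<lambda>y. ?f \<alpha> (frame c y)) x = pd \<alpha> (\<lambda>y. pd \<alpha> (\<lambda>\<xi>. sym1 \<A> A c y \<xi>) 0) x"
      by (rule pd_cong_open[OF open_coords[OF c] x s[symmetric] d])
    then show ?thesis using pd_bounded_linear[OF bl dF, of \<alpha>] by (simp add: pauli_vec_column)
  qed
  then show ?thesis
    unfolding subprincipal_def sym0_def scaleR_sum_left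
    by (simp only:) (subst sum.swap, rule refl)
qed

lemma principal_sigma:
  assumes c: "c \<in> \<A>" and x: "x \<in> coords c"
  shows "P c x $ \<alpha> = mat (- \<i>) ** (\<Sum>j\<in>UNIV. (frame c x $ j $ \<alpha>) *\<^sub>R pauli j)"
  using principal_frame[OF c x, of \<alpha>] unfolding pauli_vec_column mat_i_inverse .

text \<open>The given frame is not an additional datum: uniqueness of the coefficients and of the
  Pauli components shows that it is \<open>frame\<close>. Orthonormality then makes \<open>W\<close>
  the inverse of the frame matrix, so the axial contraction is the same on both sides.\<close>

lemma dirac_imp_conditions:
  assumes md: "massless_dirac_half \<A> A" and c: "c \<in> \<A>" and x: "x \<in> coords c"
  shows "subprincipal \<A> A c x = mat (complex_of_real (axial_at c x / 4))"
proof -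
  obtain g V where g: "riemannian_metric \<A> g" and V: "orthonormal_frame \<A> g V"
    and A: "\<And>v c x. half_density \<A> v \<Longrightarrow> c \<in> \<A> \<Longrightarrow> x \<in> coords c \<Longrightarrow>
      A v c x = dirac_W_half (g c) (\<lambda>j. V j c) (v c) x"
    using md unfolding massless_dirac_half_def by blast
  define F where "F = (\<lambda>y. \<chi> j. V j c y)"
  have oc: "open (coords c)" by (rule open_coords[OF c])
  have sF: "smooth_on (coords c) F"
    unfolding F_def using V c unfolding orthonormal_frame_def vector_field_def
    by (intro smooth_on_vec_lambda[OF oc]) blast
  have sg: "smooth_on (coords c) (g c)" using g c unfolding riemannian_metric_def by blast
  have ofa: "orthonormal_frame_at F (g c) (coords c) y" if y: "y \<in> coords c" for y
  proof
    show "F z ** g c z ** transpose (F z) = mat 1" if z: "z \<in> coords c" for z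
    proof -
      have "(F z ** g c z ** transpose (F z)) $ j $ k = V j c z \<bullet> (g c z *v V k c z)" for j k
        by (simp add: F_def matrix_matrix_mult_def matrix_vector_mult_def transpose_def inner_vec_def sum_3 algebra_simps)
      then show ?thesis using V c z unfolding orthonormal_frame_def by (simp add: vec_eq_iff mat_def)
    qed
    show "transpose (g c z) = g c z" if "z \<in> coords c" for z
      using g c that unfolding riemannian_metric_def by blast
    show "F differentiable (at y)" "g c differentiable (at y)"
      using smooth_on_differentiable[OF sF y] smooth_on_differentiable[OF sg y] by auto
  qed (use oc y in auto)
  have Vj: "(\<lambda>j y. F y $ j) = (\<lambda>j. V j c)" by (simp add: F_def fun_eq_iff)
  have co: "P c y = (\<chi> \<alpha>. mat (- \<i>) ** sigma_up (\<lambda>j. V j c) \<alpha> y) \<and>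
     Q c y = mat (complex_of_real (axial (F y) (\<lambda>\<alpha>. pd \<alpha> F y) (g c y ** transpose (F y)) / 4)) -
       mat (\<i> / 2) ** (\<Sum>k\<in>UNIV. (\<Sum>\<alpha>\<in>UNIV. pd \<alpha> F y $ k $ \<alpha>) *\<^sub>R pauli k)" if y: "y \<in> coords c" for y
  proof (rule coeffs_eqI[OF c y])
    interpret orthonormal_frame_at F "g c" "coords c" y by (rule ofa[OF y])
    fix v assume v: "half_density \<A> v"
    then have dv: "v c differentiable (at y)"
      using smooth_on_differentiable[OF _ y, of "v c"] c unfolding half_density_def by blast
    show "A v c y = (\<Sum>\<alpha>\<in>UNIV. (\<chi> \<alpha>. mat (- \<i>) ** sigma_up (\<lambda>j. V j c) \<alpha> y) $ \<alpha> *v pd \<alpha> (v c) y) +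
      (mat (complex_of_real (axial (F y) (\<lambda>\<alpha>. pd \<alpha> F y) (g c y ** transpose (F y)) / 4)) -
       mat (\<i> / 2) ** (\<Sum>k\<in>UNIV. (\<Sum>\<alpha>\<in>UNIV. pd \<alpha> F y $ k $ \<alpha>) *\<^sub>R pauli k)) *v v c y"
      unfolding A[OF v c y] vec_lambda_beta using dirac_W_half_eq[OF dv] unfolding Vj div_matrix_def .
  qed
  \<comment> \<open>Equality is needed on the whole chart, since first derivatives at
    \<open>x\<close> are compared next.\<close>
  have fr: "frame c y = F y" if y: "y \<in> coords c" for y
  proof -
    have "pauli_vec (frame c y *v axis \<alpha> 1) = pauli_vec (F y *v axis \<alpha> 1)" for \<alpha>
    proof -
      have "pauli_vec (frame c y *v axis \<alpha> 1) = mat \<i> ** (mat (- \<i>) ** sigma_up (\<lambda>j. V j c) \<alpha> y)"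
        using principal_frame[OF c y, of \<alpha>] co[OF y] by simp
      also have "\<dots> = sigma_up (\<lambda>j. V j c) \<alpha> y" unfolding mat_i_inverse ..
      finally show ?thesis by (simp add: pauli_vec_column sigma_up_def F_def)
    qed
    then have "frame c y *v axis \<alpha> 1 = F y *v axis \<alpha> 1" for \<alpha> by (rule pauli_vec_inject)
    then have "(frame c y *v axis \<alpha> 1) $ j = (F y *v axis \<alpha> 1) $ j" for \<alpha> j by simp
    then show ?thesis
      by (simp add: vec_eq_iff matrix_vector_mult_def axis_def if_distrib cong: if_cong)
  qed
  have pf: "pd \<alpha> (frame c) x = pd \<alpha> F x" for \<alpha>
    by (rule pd_cong_open[OF oc x fr smooth_on_differentiable[OF smooth_frame[OF c] x]])
  interpret orthonormal_frame_at F "g c" "coords c" x by (rule ofa[OF x])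
  have "axial_at c x = axial (F x) (\<lambda>\<alpha>. pd \<alpha> F x) (g c x ** transpose (F x))"
    unfolding axial_at_def pf fr[OF x] matrix_inv_eqI[OF WL] ..
  then show ?thesis unfolding subprincipal_frame[OF c x] pf using co[OF x] by simp
qed

text \<open>The only metric for which the rows of \<open>frame c x\<close> are orthonormal.\<close>

definition frame_metric :: "'a chart \<Rightarrow> real^3 \<Rightarrow> real^3^3" where
  "frame_metric c x = matrix_inv (frame c x) ** transpose (matrix_inv (frame c x))"

text \<open>Only the column index is a coordinate index; the row index labels fixed Pauli matrices
  and is untouched. Each row is thus a vector field on the whole manifold.\<close>

lemma frame_transform:
  assumes c: "c \<in> \<A>" and d: "d \<in> \<A>" and x: "x \<in> overlap c d"
  shows "frame d (transition c d x) = frame c x ** transpose (jac c d x)"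
proof -
  let ?z = "transition c d x"
  have "P d ?z $ \<beta> = (\<Sum>\<alpha>\<in>UNIV. (jac c d x $ \<beta> $ \<alpha>) *\<^sub>R P c x $ \<alpha>)" for \<beta>
    using principal_transform[OF d c transition_in[OF c d x], of \<beta>]
    unfolding transition_inverse[OF c d x] .
  then show ?thesis
    by (simp add: vec_eq_iff frame_def matrix_matrix_mult_def transpose_def sum_distrib_left
        sum_negf[symmetric] mult.commute)
qed

lemma frame_metric_orthonormal:
  assumes c: "c \<in> \<A>" and x: "x \<in> coords c"
  shows "frame c x ** frame_metric c x ** transpose (frame c x) = mat 1"
proof -
  note inv = frame_inverse[OF c x]
  have "frame c x ** frame_metric c x ** transpose (frame c x) =
      (frame c x ** matrix_inv (frame c x)) ** transpose (frame c x ** matrix_inv (frame c x))"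
    unfolding frame_metric_def matrix_transpose_mul by (simp only: matrix_mul_assoc)
  then show ?thesis by (simp add: inv)
qed

lemma frame_metric_sym: "transpose (frame_metric c x) = frame_metric c x"
  by (simp add: frame_metric_def matrix_transpose_mul)

lemma smooth_frame_metric:
  assumes c: "c \<in> \<A>"
  shows "smooth_on (coords c) (frame_metric c)"
proof -
  note o = open_coords[OF c]
  have "invertible (frame c x)" if "x \<in> coords c" for x
    using frame_inverse[OF c that] unfolding invertible_def by blast
  then have s: "smooth_on (coords c) (\<lambda>x. matrix_inv (frame c x))"
    by (rule smooth_on_matrix_inv[OF o smooth_frame[OF c]])
  have "smooth_on (coords c) (\<lambda>x. matrix_inv (frame c x) ** transpose (matrix_inv (frame c x)))"
    by (rule bounded_bilinear.smooth_on_prod[OF bounded_bilinear_real_matrix_matrix_mult o s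
          bounded_linear.smooth_on_comp[OF bounded_linear_transpose o s]])
  then show ?thesis unfolding frame_metric_def[abs_def] .
qed

lemma riemannian_frame_metric: "riemannian_metric \<A> frame_metric"
  unfolding riemannian_metric_def
proof (intro conjI ballI allI impI)
  fix c x and u :: "real^3" assume c: "c \<in> \<A>" and x: "x \<in> coords c" and u: "u \<noteq> 0"
  let ?W = "matrix_inv (frame c x)"
  have "transpose (frame c x) ** transpose ?W = mat 1"
    using frame_inverse[OF c x] by (simp add: matrix_transpose_mul[symmetric])
  then have "transpose (frame c x) *v (transpose ?W *v u) = u"
    by (simp only: matrix_vector_mul_assoc matrix_vector_mul_lid)
  then have "transpose ?W *v u \<noteq> 0" using u by auto
  moreover have "u \<bullet> (frame_metric c x *v u) = (transpose ?W *v u) \<bullet> (transpose ?W *v u)"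
    unfolding frame_metric_def
    by (simp add: matrix_vector_mul_assoc[symmetric] dot_lmul_matrix[symmetric] transpose_matrix_vector)
  ultimately show "u \<bullet> (frame_metric c x *v u) > 0" by simp
next
  fix c d x assume c: "c \<in> \<A>" and d: "d \<in> \<A>" and x: "x \<in> overlap c d"
  let ?J = "transpose (jac c d x)" and ?z = "transition c d x"
  have z: "?z \<in> coords d" using transition_in[OF c d x] overlap_subset[OF d] by blast
  have "frame c x ** (?J ** matrix_inv (frame d ?z)) = mat 1"
    using frame_inverse(2)[OF d z] unfolding frame_transform[OF c d x] by (simp only: matrix_mul_assoc)
  then have "(?J ** matrix_inv (frame d ?z)) ** frame c x = mat 1"
    using matrix_left_right_inverse by blast
  from matrix_inv_eqI[OF this]
  show "frame_metric c x = transpose (jac c d x) ** frame_metric d ?z ** jac c d x"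
    unfolding frame_metric_def by (simp add: matrix_transpose_mul matrix_mul_assoc)
qed (use smooth_frame_metric frame_metric_sym in auto)

lemma orthonormal_frame_metric: "orthonormal_frame \<A> frame_metric (\<lambda>j c x. frame c x $ j)"
  unfolding orthonormal_frame_def vector_field_def
proof (intro conjI ballI allI)
  fix j c assume c: "c \<in> \<A>"
  show "smooth_on (coords c) (\<lambda>x. frame c x $ j)"
    by (rule smooth_on_nth[OF open_coords[OF c] smooth_frame[OF c]])
next
  fix j c d x assume c: "c \<in> \<A>" and d: "d \<in> \<A>" and x: "x \<in> overlap c d"
  show "frame d (transition c d x) $ j = jac c d x *v (frame c x $ j)"
    unfolding frame_transform[OF c d x]
    by (simp add: vec_eq_iff matrix_matrix_mult_def matrix_vector_mult_def transpose_def mult.commute)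
next
  fix c x j k assume c: "c \<in> \<A>" and x: "x \<in> coords c"
  have "frame c x $ j \<bullet> (frame_metric c x *v frame c x $ k) = (frame c x ** frame_metric c x ** transpose (frame c x)) $ j $ k"
    by (simp add: matrix_matrix_mult_def matrix_vector_mult_def transpose_def inner_vec_def sum_3 algebra_simps)
  then show "frame c x $ j \<bullet> (frame_metric c x *v frame c x $ k) = (if j = k then 1 else 0)"
    unfolding frame_metric_orthonormal[OF c x] by (simp add: mat_def)
qed

text \<open>The principal symbol fixes the frame and with it a Dirac operator having the same first
  order coefficients. The condition on the subprincipal symbol then makes the zeroth order
  coefficients agree as well.\<close>

lemma conditions_imp_dirac:
  assumes sub: "\<And>c x. c \<in> \<A> \<Longrightarrow> x \<in> coords c \<Longrightarrow>
    subprincipal \<A> A c x = mat (complex_of_real (axial_at c x / 4))"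
  shows "massless_dirac_half \<A> A"
  unfolding massless_dirac_half_def
proof (intro exI conjI allI impI ballI)
  show "riemannian_metric \<A> frame_metric" by (rule riemannian_frame_metric)
  show "orthonormal_frame \<A> frame_metric (\<lambda>j c x. frame c x $ j)" by (rule orthonormal_frame_metric)
  fix v c x assume v: "half_density \<A> v" and c: "c \<in> \<A>" and x: "x \<in> coords c"
  interpret orthonormal_frame_at "frame c" "frame_metric c" "coords c" x
    by unfold_locales
      (use open_coords[OF c] x frame_metric_orthonormal[OF c] frame_metric_sym
        smooth_on_differentiable[OF smooth_frame[OF c] x] smooth_on_differentiable[OF smooth_frame_metric[OF c] x] in auto)
  have dv: "v c differentiable (at x)"
    using smooth_on_differentiable[OF _ x, of "v c"] v c unfolding half_density_def by blast
  have ax: "axial_at c x = axial (frame c x) (\<lambda>\<alpha>. pd \<alpha> (frame c) x) (frame_metric c x ** transpose (frame c x))"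
    unfolding axial_at_def matrix_inv_eqI[OF WL] ..
  have Q: "Q c x = mat (complex_of_real (axial_at c x / 4)) - mat (\<i> / 2) ** div_matrix"
    using sub[OF c x] unfolding subprincipal_frame[OF c x] div_matrix_def by (simp add: algebra_simps)
  show "A v c x = dirac_W_half (frame_metric c) (\<lambda>j x. frame c x $ j) (v c) x"
    unfolding op_eq[OF c v x] dirac_W_half_eq[OF dv] Q ax principal_sigma[OF c x] sigma_up_eq ..
qed

end

theorem theorem1p1:
  fixes \<A> :: "'a::t2_space chart set" and A :: "'a hd_op"
  assumes "smooth_atlas \<A>"
    and "compact (UNIV :: 'a set)" and "connected (UNIV :: 'a set)"
    and "first_order_diff_op \<A> A"
    and "elliptic \<A> A"
    and "formally_self_adjoint \<A> A"
    and "trace_free \<A> A"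
  shows "massless_dirac_half \<A> A \<longleftrightarrow>
    (\<forall>c\<in>\<A>. \<forall>x\<in>coords c.
       (\<exists>k. subprincipal \<A> A c x = mat k) \<and> b_coeff \<A> A c x = 0)"
proof -
  interpret elliptic_op \<A> A
    using assms by unfold_locales
  show ?thesis
  proof
    assume md: "massless_dirac_half \<A> A"
    show "\<forall>c\<in>\<A>. \<forall>x\<in>coords c. (\<exists>k. subprincipal \<A> A c x = mat k) \<and> b_coeff \<A> A c x = 0"
    proof (intro ballI)
      fix c x assume c: "c \<in> \<A>" and x: "x \<in> coords c"
      note sub = dirac_imp_conditions[OF md c x]
      have "b_coeff \<A> A c x = 0" by (rule b_coeff_frame[OF c x sub, THEN iffD2]) (rule refl)
      with sub show "(\<exists>k. subprincipal \<A> A c x = mat k) \<and> b_coeff \<A> A c x = 0" by (intro conjI exI)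
    qed
  next
    assume R: "\<forall>c\<in>\<A>. \<forall>x\<in>coords c. (\<exists>k. subprincipal \<A> A c x = mat k) \<and> b_coeff \<A> A c x = 0"
    show "massless_dirac_half \<A> A"
    proof (rule conditions_imp_dirac)
      fix c x assume c: "c \<in> \<A>" and x: "x \<in> coords c"
      obtain k where sub: "subprincipal \<A> A c x = mat k" and "b_coeff \<A> A c x = 0" using R c x by blast
      \<comment> \<open>Only here does the scalar k, so far an arbitrary complex number, turn out to
        be real.\<close>
      then have "k = complex_of_real (axial_at c x / 4)" using b_coeff_frame[OF c x sub] by blast
      with sub show "subprincipal \<A> A c x = mat (complex_of_real (axial_at c x / 4))" by (simp only:)
    qed
  qed
qed

end
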